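(* Let $f_0:\mathbb R\to\mathbb R$ be an increasing homeomorphism such that: $f_0(x+1)=f_0(x)+1$ for all $x$; $f_0(0)=0$; $f_0$ is at least three times continuously differentiable; $f_0'(x)=0$ if and only if $x\in\mathbb Z$; and for some integer $l\ge 1$ the $l$-th derivative of $f_0$ exists and is continuous everywhere and $f_0^{(l)}(0)\neq 0$. For $t\in(0,1)$ put $f_t(x)=f_0(x)+t$ and let $\rho(t)=\lim_{n\to\infty} f_t^n(x)/n$ be its rotation number. Then the function $\rho:(0,1)\to\mathbb R$ is Hölder continuous, i.e. there are constants $C>0$ and $\alpha\in(0,1]$ such that $|\rho(t)-\rho(s)|\le C|t-s|^{\alpha}$ for all $s,t\in(0,1)$.
   Context: $f_t$ is a lift to the real line of the circle homeomorphism $F_t(x)=F_0(x)+t \pmod 1$ of $\mathbb R/\mathbb Z$, where $F_0$ is a degree one circle homeomorphism with a single critical point, located at the fixed point $0$. $f_t^n$ denotes the $n$-th iterate. The limit defining $\rho(t)$ exists and is independent of $x$. *)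

theory Defs
  imports "HOL-Analysis.Analysis"
begin

text \<open>The iterated derivative is \<open>(deriv ^^ i) f\<close>. Since \<open>deriv\<close> is total, differentiability of
  all derivatives of order below \<open>k\<close> has to be demanded separately.\<close>

definition C_diff :: "nat \<Rightarrow> (real \<Rightarrow> real) \<Rightarrow> bool" where
  "C_diff k f \<longleftrightarrow>
     (\<forall>i<k. \<forall>x. (deriv ^^ i) f field_differentiable at x) \<and>
     continuous_on UNIV ((deriv ^^ k) f)"

text \<open>Meaningful for lifts of circle homeomorphisms, for which the limit exists and is the same
  for every starting point; the description requires both.\<close>

definition rotation_number :: "(real \<Rightarrow> real) \<Rightarrow> real" where
  "rotation_number f = (THE r. \<forall>x. (\<lambda>n. (f ^^ n) x / real n) \<longlonglongrightarrow> r)"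

end

theory Submission
  imports Defs
begin

text \<open>
  The rotation number \<open>\<rho>\<close> is a monotone function of the parameter, so the point is that parameters
  \<open>s < t\<close> with different rotation numbers cannot be too close. Between \<open>\<rho> s\<close> and \<open>\<rho> t\<close> there is a
  rational number \<open>p/q\<close> in lowest terms with \<open>q \<le> 3 / (\<rho> t - \<rho> s)\<close>, and all parameters with rotation
  number \<open>p/q\<close> (the tongue of \<open>p/q\<close>) lie between \<open>s\<close> and \<open>t\<close>. So the theorem follows from a lower
  bound for the width of tongues by a negative power of \<open>q\<close>, which is lemma \<open>tongue_width\<close>.

  The tongue of \<open>p/q\<close> contains the superstable parameter \<open>u\<close>, for which the critical point \<open>0\<close> is
  periodic. The derivative of the return map vanishes there, so an interval to the right of \<open>0\<close> is
  mapped deep into itself, and it still traps orbits for slightly larger parameters. How much larger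
  is decided by the speed at which the return map moves with the parameter; this speed is controlled
  by the sum of the reciprocals of the gaps of the cycle, and lemma \<open>trap\<close> bounds the width
  from below by a constant divided by this sum.

  Every distortion estimate is a statement about cross-ratios. The function \<open>log f'\<close> is concave near
  the critical point and semi-concave elsewhere, because the critical point is not flat; hence \<open>f\<close>
  increases the cross-ratio of four nearby points at most by a factor close to \<open>1\<close> if no critical point
  lies between them, and at most by a bounded factor otherwise. Along an orbit of disjoint intervals the product of these
  factors stays bounded. Pulling back the smallest gap of a cycle shows that
  adjacent gaps are comparable (\<open>gap_adjacent\<close>).

  The sum of the reciprocals of the gaps is estimated by comparing \<open>p/q\<close> with a fraction \<open>p'/q'\<close> such
  that \<open>q' p - p' q = \<plusminus>1\<close> and \<open>q' \<le> q/2\<close>. Changing the parameter from \<open>u\<close> to the superstable parameter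
  \<open>u'\<close> of \<open>p'/q'\<close> pushes the first \<open>q'\<close> points of the critical orbit by no more than the adjacent gaps, so the
  sum over these gaps is at most a constant divided by \<open>\<bar>u - u'\<bar>\<close> (\<open>push\<close>). The other gaps form
  chains of at most \<open>k = q div q' + 1\<close> gaps, each the image of the previous one under \<open>q'\<close> steps, and a
  chain joins gaps of the first kind. Such a chain may pass through a nearly parabolic region, but its gaps shrink there at
  most by a factor of order \<open>k\<^sup>2\<close> (\<open>chain_bound\<close>). As \<open>\<bar>u - u'\<bar>\<close> is at least the width for \<open>p'/q'\<close>, the
  width for \<open>p/q\<close> is at least \<open>c k\<^sup>-\<^sup>3\<close> times the width for \<open>p'/q'\<close>. The denominator is at least halved
  each time, so that the constants accumulate only to a power of \<open>q\<close>.
\<close>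

section \<open>Cross-ratios and critical lifts\<close>

lemma lift_shift_int:
  fixes f :: "real \<Rightarrow> real"
  assumes shift: "\<And>x. f (x + 1) = f x + 1"
  shows "f (x + of_int n) = f x + of_int n"
proof -
  have nat: "f (x + real k) = f x + real k" for x k
  proof (induction k)
    case (Suc k)
    then show ?case using shift[of "x + real k"] by (simp add: add_ac)
  qed simp
  show ?thesis
  proof (cases "0 \<le> n")
    case True
    then show ?thesis using nat[of x "nat n"] by simp
  next
    case False
    then show ?thesis using nat[of "x + of_int n" "nat (- n)"] by simp
  qed
qed

text \<open>For consecutive intervals of lengths \<open>L\<close>, \<open>J\<close>, \<open>R\<close> with total length \<open>T\<close> this is
  \<open>L R / (L R + J T)\<close>, a Moebius invariant that is small precisely if the middle interval is
  long compared with one of its neighbours.\<close>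

definition cr :: "real \<Rightarrow> real \<Rightarrow> real \<Rightarrow> real \<Rightarrow> real" where
  "cr a b c d = (b - a) * (d - c) / ((c - a) * (d - b))"

text \<open>All that the dynamical part of the argument uses about the map. In the notation above \<open>smooth\<close>
  bounds the growth of \<open>1 + L R / (J T)\<close> away from the critical points, \<open>rough\<close> says that passing a
  critical point costs no more than a constant factor, and the last two conditions express
  quantitatively that the derivative vanishes at \<open>0\<close>. The class is closed under \<open>f \<mapsto> (\<lambda>x. - f (- x))\<close>, which exchanges
  left and right; for this reason most of what follows is stated for one side only.\<close>

locale critical_lift =
  fixes f :: "real \<Rightarrow> real" and K C :: real
  assumes strict: "x < y \<Longrightarrow> f x < f y"
    and cont: "isCont f x"
    and shift: "f (x + 1) = f x + 1"
    and f_zero: "f 0 = 0"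
    and K_nonneg: "0 \<le> K"
    and C_ge_1: "1 \<le> C"
    and smooth: "\<lbrakk>a < b; b < c; c < d; {a<..<d} \<inter> \<int> = {}\<rbrakk> \<Longrightarrow>
      (f c - f a) * (f d - f b) * ((c - b) * (d - a))
        \<le> exp (K * ((b - a) * (d - c))) * ((c - a) * (d - b) * ((f c - f b) * (f d - f a)))"
    and rough: "\<lbrakk>a \<le> b; b \<le> c; c \<le> d; a < c; b < d; d - a \<le> 3\<rbrakk> \<Longrightarrow>
      cr (f a) (f b) (f c) (f d) \<le> C * cr a b c d"
    and flat_right: "\<lbrakk>0 < \<theta>; \<theta> \<le> 1; 0 < b; b \<le> 1\<rbrakk> \<Longrightarrow> f (\<theta> * b) \<le> C * \<theta>\<^sup>2 * f b"
    and flat_left: "\<lbrakk>0 < \<theta>; \<theta> \<le> 1; 0 < b; b \<le> 1\<rbrakk> \<Longrightarrow> - f (- (\<theta> * b)) \<le> C * \<theta>\<^sup>2 * - f (- b)"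
begin

lemma mono_le: "x \<le> y \<Longrightarrow> f x \<le> f y"
  using strict[of x y] by (cases "x = y") auto

lemma ptolemy: "(c-a)*(d-b) = (b-a)*(d-c) + (c-b)*(d-a)" for a b c d :: real
  by (simp add: algebra_simps)

text \<open>Two readings of \<open>smooth\<close>, with \<open>P = L R\<close>, \<open>Q = J T\<close> and dashes for the images: in the bound for
  the cross-ratio the error involves \<open>J T\<close> instead of \<open>L R\<close>, so that it is small along with the middle
  interval; and \<open>J T / (L R)\<close> can be bounded before the map in terms of its value after it.\<close>

lemma cr_algebra:
  fixes P Q P' Q' k :: real
  assumes "P > 0" "Q > 0" "P' > 0" "Q' > 0" "k \<ge> 0"
    and h: "(P' + Q') * Q \<le> exp (k * P) * ((P + Q) * Q')"
  shows "P' / (P' + Q') \<le> exp (k * Q) * (P / (P + Q))"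
    and "Q * P' \<le> exp (k * (P + Q)) * (P * Q')"
proof -
  have e1: "exp (k*P) * (1 - k * P) \<le> 1"
  proof -
    have "1 - k*P \<le> exp (-(k*P))" using exp_ge_add_one_self[of "-(k*P)"] by simp
    then have "exp (k*P) * (1 - k*P) \<le> exp (k*P) * exp (-(k*P))" by simp
    then show ?thesis by (simp add: exp_minus)
  qed
  have "(1 - k*P) * ((P' + Q') * Q) \<le> (P+Q) * Q'"
  proof (cases "1 - k*P \<ge> 0")
    case True
    have "(1 - k*P) * ((P' + Q') * Q) \<le> (1-k*P) * (exp (k * P) * ((P + Q) * Q'))"
      by (rule mult_left_mono[OF h True])
    also have "\<dots> = (exp (k*P) * (1 - k*P)) * ((P+Q) * Q')" by simp
    also have "\<dots> \<le> 1 * ((P+Q) * Q')"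
      by (rule mult_right_mono[OF e1]) (use assms in auto)
    finally show ?thesis by simp
  next
    case False
    then have "(1 - k*P) * ((P' + Q') * Q) \<le> 0"
      using assms by (intro mult_nonpos_nonneg) auto
    also have "0 \<le> (P+Q)*Q'" using assms by auto
    finally show ?thesis .
  qed
  then have "P' * (P + Q) \<le> (1 + k*Q) * P * (P' + Q')"
    using assms by (simp add: algebra_simps)
  also have "\<dots> \<le> exp (k*Q) * P * (P' + Q')"
    using exp_ge_add_one_self[of "k*Q"] assms by (intro mult_right_mono) auto
  finally show "P' / (P' + Q') \<le> exp (k * Q) * (P / (P + Q))"
    using assms by (simp add: field_simps)
  have e2: "exp (k*P) - 1 \<le> k * P * exp (k*P)"
    using e1 by (simp add: algebra_simps)
  have "Q * P' \<le> exp (k*P) * (P*Q') + (exp (k*P) - 1) * (Q * Q')"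
    using h by (simp add: algebra_simps)
  also have "\<dots> \<le> exp (k*P) * (P*Q') + (k * P * exp (k*P)) * (Q * Q')"
    using e2 assms by (intro add_left_mono mult_right_mono) auto
  also have "\<dots> = exp (k*P) * (P * Q') * (1 + k * Q)" by (simp add: algebra_simps)
  also have "\<dots> \<le> exp (k*P) * (P * Q') * exp (k * Q)"
    using assms by (intro mult_left_mono exp_ge_add_one_self) auto
  also have "\<dots> = exp (k * (P+Q)) * (P*Q')" by (simp add: exp_add algebra_simps)
  finally show "Q * P' \<le> exp (k * (P + Q)) * (P * Q')" .
qed

lemma cr_pos_order:
  fixes a b c d :: real
  assumes "a < b" "b < c" "c < d"
  shows "cr a b c d = ((b-a)*(d-c)) / ((b-a)*(d-c) + (c-b)*(d-a))"
  unfolding cr_def by (rule arg_cong2[where f="(/)"]) (simp_all add: algebra_simps)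

lemma cr_smooth:
  assumes o: "a \<le> b" "b \<le> c" "c \<le> d" "a < c" "b < d" and nz: "{a<..<d} \<inter> \<int> = {}"
  shows "cr (f a) (f b) (f c) (f d) \<le> exp (K * ((c - b) * (d - a))) * cr a b c d"
proof -
  consider "a = b" | "c = d" | "b = c" | "a < b" "b < c" "c < d" using o by linarith
  then show ?thesis
  proof cases
    case 3
    then show ?thesis using o strict[of a c] strict[of b d] by (simp add: cr_def)
  next
    case 4
    have s: "f a < f b" "f b < f c" "f c < f d" using 4 strict by auto
    show ?thesis unfolding cr_pos_order[OF 4] cr_pos_order[OF s]
      by (rule cr_algebra(1))
        (use 4 s K_nonneg smooth[OF 4 nz] in \<open>simp_all add: ptolemy [symmetric]\<close>)
  qed (use o in \<open>auto simp: cr_def\<close>)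
qed

lemma space_smooth:
  assumes o: "a < b" "b < c" "c < d" and nz: "{a<..<d} \<inter> \<int> = {}"
  shows "((c-b)*(d-a)) * ((f b - f a)*(f d - f c))
    \<le> exp (K * (d - a)\<^sup>2) * (((b-a)*(d-c)) * ((f c - f b)*(f d - f a)))"
proof -
  have s: "f a < f b" "f b < f c" "f c < f d" using o strict by auto
  have "((c-b)*(d-a)) * ((f b - f a)*(f d - f c))
     \<le> exp (K * ((b-a)*(d-c) + (c-b)*(d-a))) * (((b-a)*(d-c)) * ((f c - f b)*(f d - f a)))"
    by (rule cr_algebra(2))
      (use o s K_nonneg smooth[OF o nz] in \<open>simp_all add: ptolemy [symmetric]\<close>)
  also have "\<dots> \<le> exp (K * (d - a)\<^sup>2) * (((b-a)*(d-c)) * ((f c - f b)*(f d - f a)))"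
  proof (rule mult_right_mono)
    have "(c-a)*(d-b) \<le> (d-a)*(d-a)" using o by (intro mult_mono) auto
    then show "exp (K * ((b - a) * (d - c) + (c - b) * (d - a))) \<le> exp (K * (d - a)\<^sup>2)"
      using K_nonneg by (auto simp: ptolemy[symmetric] power2_eq_square intro!: mult_left_mono)
  qed (use o s in auto)
  finally show ?thesis .
qed

text \<open>A bound for the growth of \<open>cr\<close> in one step, whether or not a critical point is passed.\<close>

definition growth_factor :: "real \<Rightarrow> real \<Rightarrow> real \<Rightarrow> real \<Rightarrow> real" where
  "growth_factor a b c d = (if {a<..<d} \<inter> \<int> = {} then 1 else C) * exp (K * ((c - b) * (d - a)))"

lemma growth_factor_ge_1:
  assumes "a \<le> d" "b \<le> c"
  shows "1 \<le> growth_factor a b c d"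
proof -
  have "1 \<le> exp (K * ((c - b) * (d - a)))" using assms K_nonneg by simp
  then show ?thesis unfolding growth_factor_def using C_ge_1
    mult_mono[of 1 C 1 "exp (K * ((c - b) * (d - a)))"] by simp
qed

lemma cr_nonneg: "a \<le> b \<Longrightarrow> b \<le> c \<Longrightarrow> c \<le> d \<Longrightarrow> 0 \<le> cr a b c d"
  unfolding cr_def by auto

lemma cr_step:
  assumes o: "a \<le> b" "b \<le> c" "c \<le> d" "a < c" "b < d" and "d - a \<le> 3"
  shows "cr (f a) (f b) (f c) (f d) \<le> growth_factor a b c d * cr a b c d"
proof (cases "{a<..<d} \<inter> \<int> = {}")
  case True
  then show ?thesis using cr_smooth[OF o] by (simp add: growth_factor_def)
next
  case False
  have "cr (f a) (f b) (f c) (f d) \<le> C * cr a b c d" by (rule rough[OF assms])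
  also have "\<dots> \<le> C * exp (K * ((c - b) * (d - a))) * cr a b c d"
    using o C_ge_1 K_nonneg cr_nonneg[OF o(1-3)]
    by (intro mult_right_mono) (auto simp: mult_nonneg_nonneg)
  finally show ?thesis using False by (simp add: growth_factor_def)
qed

lemma cr_translate [simp]: "cr (a + t) (b + t) (c + t) (d + t) = cr a b c d"
  by (simp add: cr_def)

lemma prod_growth_factor_le:
  assumes "finite I" "card {i \<in> I. {a i<..<d i} \<inter> \<int> \<noteq> {}} \<le> N"
    and "(\<Sum>i\<in>I. (c i - b i) * (d i - a i)) \<le> M"
  shows "(\<Prod>i\<in>I. growth_factor (a i) (b i) (c i) (d i)) \<le> C ^ N * exp (K * M)"
proof -
  have "(\<Prod>i\<in>I. growth_factor (a i) (b i) (c i) (d i)) =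
      (\<Prod>i\<in>I. (if {a i<..<d i} \<inter> \<int> = {} then 1 else C))
      * exp (K * (\<Sum>i\<in>I. (c i - b i) * (d i - a i)))"
    using assms(1) by (simp add: growth_factor_def prod.distrib exp_sum sum_distrib_left)
  also have "(\<Prod>i\<in>I. (if {a i<..<d i} \<inter> \<int> = {} then 1 else C))
      = (\<Prod>i\<in>{i \<in> I. {a i<..<d i} \<inter> \<int> \<noteq> {}}. C)"
    using assms(1) by (intro prod.mono_neutral_cong_right) auto
  also have "\<dots> = C ^ card {i \<in> I. {a i<..<d i} \<inter> \<int> \<noteq> {}}" by simp
  also have "\<dots> * exp (K * (\<Sum>i\<in>I. (c i - b i) * (d i - a i))) \<le> C ^ N * exp (K * M)"
    using assms C_ge_1 K_nonneg
    by (intro mult_mono power_increasing) (auto intro!: mult_left_mono)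
  finally show ?thesis .
qed

end

section \<open>Superstable cycles and the comparability of adjacent gaps\<close>

lemma sum_residue_le:
  fixes \<phi> :: "int \<Rightarrow> real" and \<kappa> :: "'a \<Rightarrow> int"
  assumes "finite A" and per: "\<And>m. \<phi> (m mod n) = \<phi> m" and "\<And>m. 0 \<le> \<phi> m" and "0 < n"
    and inj: "inj_on (\<lambda>a. \<kappa> a mod n) A"
  shows "(\<Sum>a\<in>A. \<phi> (\<kappa> a)) \<le> sum \<phi> {0..<n}"
    and "card A = nat n \<Longrightarrow> (\<Sum>a\<in>A. \<phi> (\<kappa> a)) = sum \<phi> {0..<n}"
proof -
  have eq: "(\<Sum>a\<in>A. \<phi> (\<kappa> a)) = sum \<phi> ((\<lambda>a. \<kappa> a mod n) ` A)"
    by (simp add: sum.reindex[OF inj] per)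
  have sub: "(\<lambda>a. \<kappa> a mod n) ` A \<subseteq> {0..<n}" using \<open>0 < n\<close> by auto
  show "(\<Sum>a\<in>A. \<phi> (\<kappa> a)) \<le> sum \<phi> {0..<n}"
    unfolding eq by (rule sum_mono2) (use sub assms in auto)
  assume "card A = nat n"
  then have "card ((\<lambda>a. \<kappa> a mod n) ` A) = card {0..<n}" by (simp add: card_image[OF inj])
  then have "(\<lambda>a. \<kappa> a mod n) ` A = {0..<n}" by (intro card_subset_eq sub) auto
  then show "(\<Sum>a\<in>A. \<phi> (\<kappa> a)) = sum \<phi> {0..<n}" using eq by simp
qed

text \<open>The cycle of the critical point at a superstable parameter, lifted to the line and enumerated
  in increasing order. In this enumeration the map is the translation by \<open>p\<close>, and the critical points
  are the points whose index is a multiple of \<open>q\<close>.\<close>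

locale critical_cycle = critical_lift +
  fixes u :: real and p :: int and q :: nat and e :: "int \<Rightarrow> real"
  assumes q_pos: "0 < q" and p_q_coprime: "coprime p (int q)"
    and e_zero: "e 0 = 0"
    and e_less: "e m < e (m + 1)"
    and e_period: "e (m + int q) = e m + 1"
    and e_step: "f (e m) + u = e (m + p)"
begin

definition gap :: "int \<Rightarrow> real" where
  "gap m = e (m + 1) - e m"

lemma gap_pos: "0 < gap m"
  using e_less[of m] by (simp add: gap_def)

lemma e_add_nat: "e (m + int n) = e m + (\<Sum>i<n. gap (m + int i))"
  by (induction n) (simp_all add: gap_def algebra_simps)

lemma e_strict_mono: "m < n \<Longrightarrow> e m < e n"
proof -
  assume "m < n"
  then obtain k where k: "n = m + int (Suc k)" by (metis zless_iff_Suc_zadd)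
  have "e m < e (m + int (Suc k))" unfolding e_add_nat
    using sum_pos[of "{..<Suc k}" "\<lambda>i. gap (m + int i)"] gap_pos
    by (metis add_less_cancel_left add.right_neutral finite_lessThan lessThan_empty_iff nat.simps(3))
  then show ?thesis using k by simp
qed

lemma e_less_iff [simp]: "e m < e n \<longleftrightarrow> m < n"
  using e_strict_mono[of m n] e_strict_mono[of n m] by (cases m n rule: linorder_cases) auto

lemma e_le_iff [simp]: "e m \<le> e n \<longleftrightarrow> m \<le> n"
  using e_less_iff[of n m] by (simp only: not_less[symmetric])

lemma e_period_nat: "e (m + int q * int k) = e m + real k"
proof (induction k)
  case (Suc k)
  have "e (m + int q * int (Suc k)) = e ((m + int q * int k) + int q)" by (simp add: algebra_simps)
  then show ?case using Suc e_period[of "m + int q * int k"] by simp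
qed simp

lemma e_period_int: "e (m + int q * k) = e m + of_int k"
proof (cases "k \<ge> 0")
  case True
  then show ?thesis using e_period_nat[of m "nat k"] by simp
next
  case False
  have "e ((m + int q * k) + int q * int (nat (- k))) = e (m + int q * k) + real (nat (-k))"
    by (rule e_period_nat)
  then show ?thesis using False by simp
qed

lemma e_multiple: "e (int q * k) = of_int k"
  using e_period_int[of 0 k] e_zero by simp

lemma integer_between:
  assumes "{e m<..<e n} \<inter> \<int> \<noteq> {}"
  shows "\<exists>k. m < k \<and> k < n \<and> int q dvd k"
proof -
  from assms obtain x where "x \<in> \<int>" "e m < x" "x < e n" by auto
  then obtain k :: int where k: "e m < of_int k" "of_int k < e n" by (auto elim: Ints_cases)
  then have "e m < e (int q * k)" "e (int q * k) < e n" by (simp_all add: e_multiple)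
  then show ?thesis by (intro exI[of _ "int q * k"]) auto
qed

lemma gap_add_multiple: "gap (m + int q * k) = gap m"
  using e_period_int[of m k] e_period_int[of "m + 1" k] by (simp add: gap_def algebra_simps)

lemma gap_mod: "gap (m mod int q) = gap m"
  using gap_add_multiple[of "m mod int q" "m div int q"] by simp

lemma gap_cong: "m mod int q = n mod int q \<Longrightarrow> gap m = gap n"
  using gap_mod[of m] gap_mod[of n] by simp

lemma sum_gap: "sum gap {0..<int q} = 1"
proof -
  have "{0..<int q} = int ` {..<q}" by (simp add: image_int_atLeastLessThan lessThan_atLeast0)
  then have "sum gap {0..<int q} = (\<Sum>i<q. gap (int i))"
    by (simp add: sum.reindex)
  also have "\<dots> = 1" using e_add_nat[of 0 q] e_period[of 0] by simp
  finally show ?thesis .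
qed

lemma sum_gap_le_1:
  assumes "finite A" "inj_on (\<lambda>a. \<kappa> a mod int q) A"
  shows "(\<Sum>a\<in>A. gap (\<kappa> a)) \<le> 1"
  using sum_residue_le(1)[of A gap "int q" \<kappa>] assms gap_mod less_imp_le[OF gap_pos] q_pos sum_gap
  by simp

lemma gap_le_1: "gap m \<le> 1"
  using sum_gap_le_1[of "{m}" "\<lambda>x. x"] by simp

text \<open>As \<open>p\<close> is invertible modulo \<open>q\<close>, up to \<open>q\<close> consecutive images of a gap are disjoint on the
  circle, and any point of the cycle is critical at only one of \<open>q\<close> consecutive times.\<close>

lemma inj_orbit: "inj_on (\<lambda>i. (m + int i * p) mod int q) {a..<a+q}"
proof (rule inj_onI)
  have *: "i \<le> j \<Longrightarrow> i = j" if "i \<in> {a..<a+q}" "j \<in> {a..<a+q}"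
    "(m + int i * p) mod int q = (m + int j * p) mod int q" for i j
  proof -
    assume "i \<le> j"
    from that(3) have "int q dvd (m + int j * p) - (m + int i * p)"
      by (metis mod_eq_dvd_iff)
    then have "int q dvd (int j - int i) * p" by (simp add: algebra_simps)
    then have "int q dvd int j - int i"
      using p_q_coprime by (simp add: coprime_commute coprime_dvd_mult_left_iff)
    then have "q dvd j - i" using \<open>i \<le> j\<close> by (metis int_dvd_int_iff of_nat_diff)
    moreover have "j - i < q" using that \<open>i \<le> j\<close> by auto
    ultimately have "j - i = 0" by (meson dvd_imp_le linorder_not_less neq0_conv)
    then show "i = j" using \<open>i \<le> j\<close> by simp
  qed
  fix i j assume "i \<in> {a..<a+q}" "j \<in> {a..<a+q}"
    "(m + int i * p) mod int q = (m + int j * p) mod int q"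
  then show "i = j" using *[of i j] *[of j i] by (cases "i \<le> j") auto
qed

lemma card_orbit_hits: "card {i \<in> {a..<a+q}. int q dvd m + int i * p} \<le> 1"
proof -
  have "i = j" if "i \<in> {a..<a+q}" "j \<in> {a..<a+q}" "int q dvd m + int i * p" "int q dvd m + int j * p" for i j
    using inj_onD[OF inj_orbit[of m a], of i j] that by (simp add: dvd_eq_mod_eq_0)
  then have "is_singleton {i \<in> {a..<a+q}. int q dvd m + int i * p} \<or> {i \<in> {a..<a+q}. int q dvd m + int i * p} = {}"
    by (metis (mono_tags, lifting) is_singletonI' mem_Collect_eq)
  then show ?thesis by (metis (lifting) is_singleton_altdef card.empty le_numeral_extra(4) zero_le_one)
qed

lemma sum_gap_orbit_le: "b \<le> a + q \<Longrightarrow> (\<Sum>i\<in>{a..<b}. gap (m + int i * p)) \<le> 1"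
  by (rule sum_gap_le_1) (auto intro: inj_on_subset[OF inj_orbit[of m a]])

end

context critical_lift
begin

text \<open>The constant in the comparison of adjacent gaps: \<open>4\<close> comes from a gap that is not longer than its
  neighbours, \<open>C\<^sup>2\<close> from two passages of the critical point, and \<open>3\<close> bounds the length of three
  consecutive gaps.\<close>

definition spacing :: real where
  "spacing = 1 / (4 * (C\<^sup>2 * exp (3 * K)))"

lemma spacing_pos: "0 < spacing"
  using C_ge_1 by (simp add: spacing_def)

lemma spacing_le_1: "spacing \<le> 1"
proof -
  have "1 \<le> exp (3 * K)" using K_nonneg by simp
  then have "1 \<le> C\<^sup>2 * exp (3 * K)" using C_ge_1 
    mult_mono[of 1 "C\<^sup>2" 1 "exp (3 * K)"] by simp
  then show ?thesis by (simp add: spacing_def)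
qed

end

context critical_cycle
begin

lemma orbit_onto: "\<exists>i<q. (m + int i * p) mod int q = n mod int q"
proof -
  have "(\<lambda>i. (m + int i * p) mod int q) ` {0..<q} = {0..<int q}"
    by (rule card_subset_eq) (use q_pos inj_orbit[of m 0] in \<open>auto simp: card_image\<close>)
  moreover have "n mod int q \<in> {0..<int q}" using q_pos by simp
  ultimately have "n mod int q \<in> (\<lambda>i. (m + int i * p) mod int q) ` {0..<q}" by simp
  then obtain i where "i < q" "n mod int q = (m + int i * p) mod int q" by auto
  then show ?thesis by metis
qed

lemma e_step_iter: "f (e (m + int i * p)) + u = e (m + int (Suc i) * p)"
  using e_step[of "m + int i * p"] by (simp add: algebra_simps)

lemma e_diff_le: "n \<le> m + int k \<Longrightarrow> e n - e m \<le> real k"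
proof -
  assume "n \<le> m + int k"
  then have "e n \<le> e (m + int k)" by simp
  also have "\<dots> \<le> e m + (\<Sum>i<k. 1)"
    unfolding e_add_nat by (intro add_left_mono sum_mono gap_le_1)
  finally show ?thesis by simp
qed

lemma cr_e_iterate:
  assumes "a < b" "b < c" "c < d" "d \<le> a + 3"
  shows "cr (e (a + int n * p)) (e (b + int n * p)) (e (c + int n * p)) (e (d + int n * p))
    \<le> (\<Prod>i<n. growth_factor (e (a + int i * p)) (e (b + int i * p)) (e (c + int i * p)) (e (d + int i * p)))
       * cr (e a) (e b) (e c) (e d)"
proof (induction n)
  case (Suc n)
  let ?a = "e (a + int n * p)" and ?b = "e (b + int n * p)" and ?c = "e (c + int n * p)"
    and ?d = "e (d + int n * p)"
  have "cr (e (a + int (Suc n) * p)) (e (b + int (Suc n) * p)) (e (c + int (Suc n) * p))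
      (e (d + int (Suc n) * p)) = cr (f ?a) (f ?b) (f ?c) (f ?d)"
    by (simp only: e_step_iter[symmetric] cr_translate)
  also have "\<dots> \<le> growth_factor ?a ?b ?c ?d * cr ?a ?b ?c ?d"
    using assms e_diff_le[of "d + int n * p" "a + int n * p" 3] by (intro cr_step) auto
  also have "\<dots> \<le> growth_factor ?a ?b ?c ?d * ((\<Prod>i<n. growth_factor (e (a + int i * p)) (e (b + int i * p)) (e (c + int i * p)) (e (d + int i * p)))
       * cr (e a) (e b) (e c) (e d))"
  proof (rule mult_left_mono[OF Suc.IH])
    show "0 \<le> growth_factor ?a ?b ?c ?d" using growth_factor_ge_1[of ?a ?d ?b ?c] assms by simp
  qed
  finally show ?case by (simp add: mult_ac)
qed simp

text \<open>The smallest gap and its two neighbours have a cross-ratio of at least \<open>1/4\<close>. Every gap reaches the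
  smallest one in fewer than \<open>q\<close> steps. On the way its images are disjoint on the circle and the two end
  points of the gap become critical at most once each, so the cross-ratio grows by a bounded factor. It is
  therefore bounded below at the start, which means that neither neighbour is much shorter than the gap.\<close>

lemma gap_adjacent:
  shows "spacing * gap m \<le> gap (m + 1)" and "spacing * gap m \<le> gap (m - 1)"
proof -
  obtain m0 where m0: "m0 \<in> {0..<int q}" "\<And>n. n \<in> {0..<int q} \<Longrightarrow> gap m0 \<le> gap n"
    using ex_min_if_finite[of "gap ` {0..<int q}"] q_pos by (fastforce simp: not_less)
  have min: "gap m0 \<le> gap n" for n
    using m0(2)[of "n mod int q"] q_pos by (simp add: gap_mod)
  obtain i where i: "i < q" "(m + int i * p) mod int q = m0 mod int q"
    using orbit_onto by blast
  define n where "n = m + int i * p"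
  have gn: "gap n \<le> gap k" for k
    using min[of k] gap_cong[of n m0] i by (simp add: n_def)
  let ?crm = "cr (e (m-1)) (e m) (e (m+1)) (e (m+2))"
  let ?L = "C^2 * exp (3 * K)"
  have L0: "0 < ?L" using C_ge_1 by simp
  have ce: "cr (e (k-1)) (e k) (e (k+1)) (e (k+2))
      = (gap (k-1) / (gap (k-1) + gap k)) * (gap (k+1) / (gap k + gap (k+1)))" for k
    by (simp add: cr_def gap_def add.commute)
  have half: "1/2 \<le> gap k / (gap k + gap n)" for k
    using gn[of k] gap_pos[of k] gap_pos[of n] by (simp add: field_simps)
  have h: "1/2 \<le> gap (n-1) / (gap (n-1) + gap n)" "1/2 \<le> gap (n+1) / (gap n + gap (n+1))"
    using half[of "n-1"] half[of "n+1"] by (simp_all add: add.commute)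
  have "1/2 * (1/2) \<le> cr (e (n-1)) (e n) (e (n+1)) (e (n+2))"
    unfolding ce by (rule mult_mono[OF h]) (use h in linarith)+
  also have "\<dots> \<le> (\<Prod>j<i. growth_factor (e (m - 1 + int j * p)) (e (m + int j * p)) (e (m + 1 + int j * p)) (e (m + 2 + int j * p)))
       * ?crm"
    using cr_e_iterate[of "m-1" m "m+1" "m+2" i] by (simp add: n_def algebra_simps)
  also have "\<dots> \<le> ?L * ?crm"
  proof (rule mult_right_mono[OF _ cr_nonneg])
    let ?hit = "{j \<in> {..<i}. {e (m - 1 + int j * p)<..<e (m + 2 + int j * p)} \<inter> \<int> \<noteq> {}}"
    have "?hit \<subseteq> {j \<in> {0..<0+q}. int q dvd m + int j * p} \<union> {j \<in> {0..<0+q}. int q dvd (m + 1) + int j * p}"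
    proof
      fix j assume j: "j \<in> ?hit"
      then obtain k where k: "m - 1 + int j * p < k" "k < m + 2 + int j * p" "int q dvd k"
        using integer_between by blast
      then have "k = m + int j * p \<or> k = (m + 1) + int j * p" by linarith
      then show "j \<in> {j \<in> {0..<0+q}. int q dvd m + int j * p} \<union> {j \<in> {0..<0+q}. int q dvd (m + 1) + int j * p}"
        using k j i by auto
    qed
    then have "card ?hit \<le> card ({j \<in> {0..<0+q}. int q dvd m + int j * p} \<union> {j \<in> {0..<0+q}. int q dvd (m + 1) + int j * p})"
      by (rule card_mono[rotated]) simp
    also have "\<dots> \<le> 1 + 1"
      by (rule order_trans[OF card_Un_le add_mono[OF card_orbit_hits card_orbit_hits]])
    finally have hit: "card ?hit \<le> 2" by simp
    have "(\<Sum>j<i. (e (m + 1 + int j * p) - e (m + int j * p)) * (e (m + 2 + int j * p) - e (m - 1 + int j * p)))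
       \<le> (\<Sum>j<i. gap (m + int j * p) * 3)"
    proof (rule sum_mono)
      fix j
      show "(e (m + 1 + int j * p) - e (m + int j * p)) * (e (m + 2 + int j * p) - e (m - 1 + int j * p))
        \<le> gap (m + int j * p) * 3"
        using e_diff_le[of "m + 2 + int j * p" "m - 1 + int j * p" 3] gap_pos[of "m + int j * p"]
        by (intro mult_mono) (auto simp: gap_def algebra_simps)
    qed
    also have "\<dots> = 3 * (\<Sum>j\<in>{0..<i}. gap (m + int j * p))"
      by (simp add: sum_distrib_left lessThan_atLeast0 mult.commute)
    also have "\<dots> \<le> 3 * 1"
      using sum_gap_orbit_le[of i 0 m] i by (intro mult_left_mono) auto
    finally have sm: "(\<Sum>j<i. (e (m + 1 + int j * p) - e (m + int j * p)) * (e (m + 2 + int j * p) - e (m - 1 + int j * p))) \<le> 3"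
      by simp
    show "(\<Prod>j<i. growth_factor (e (m - 1 + int j * p)) (e (m + int j * p)) (e (m + 1 + int j * p)) (e (m + 2 + int j * p)))
      \<le> ?L" using prod_growth_factor_le[OF finite_lessThan hit sm] by (simp add: mult.commute)
  qed auto
  finally have "spacing \<le> ?crm" using L0 by (simp add: spacing_def field_simps)
  then have *: "spacing \<le> (gap (m-1) / (gap (m-1) + gap m)) * (gap (m+1) / (gap m + gap (m+1)))"
    by (simp add: ce)
  have p: "0 < gap (m-1)" "0 < gap m" "0 < gap (m+1)" by (simp_all add: gap_pos)
  have "spacing \<le> gap (m-1) / (gap (m-1) + gap m)"
    by (rule order_trans[OF * mult_left_le]) (use p in auto)
  then have "spacing * (gap (m-1) + gap m) \<le> gap (m-1)" using p by (simp add: field_simps)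
  moreover have "spacing * gap (m-1) \<ge> 0" using p spacing_pos by simp
  ultimately show "spacing * gap m \<le> gap (m - 1)" by (simp add: algebra_simps)
  have "spacing \<le> gap (m+1) / (gap m + gap (m+1))"
    by (rule order_trans[OF * mult_left_le_one_le]) (use p in auto)
  then have "spacing * (gap (m+1) + gap m) \<le> gap (m+1)" using p by (simp add: field_simps)
  moreover have "spacing * gap (m+1) \<ge> 0" using p spacing_pos by simp
  ultimately show "spacing * gap m \<le> gap (m + 1)" by (simp add: algebra_simps)
qed

end

section \<open>The trap around a superstable cycle\<close>

lemma quotient_cancel:
  fixes R s t L :: real
  assumes "R \<noteq> 0" "L \<noteq> 0"
  shows "R * s * t / (L * (R * R)) = s / L * (t / R)"
  using assms by (simp add: field_simps)

text \<open>The next lemmas concern four points of which the second one moves. If \<open>d - c\<close> is not much smaller than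
  \<open>c - a\<close>, the cross-ratio is comparable with the relative position \<open>(y - a) / (c - a)\<close>, and moving \<open>y\<close>
  by \<open>s\<close> changes it by an amount comparable with \<open>s / (c - a)\<close>. This converts perturbations of the
  parameter into additive terms.\<close>

lemma cr_push_up:
  fixes a y c d s r :: real
  assumes "a \<le> y" "y + s \<le> c" "a < c" "c < d" "0 \<le> s" "0 < r" "r \<le> 1" "r * (c - a) \<le> d - c"
  shows "cr a (y + s) c d \<le> cr a y c d + 2 / r * (s / (c - a))"
proof -
  have "cr a (y + s) c d - cr a y c d = (d - c) * s * (d - a) / ((c - a) * ((d - y - s) * (d - y)))"
    using assms by (simp add: cr_def divide_simps) (simp add: algebra_simps)
  also have "\<dots> \<le> (d - c) * s * (d - a) / ((c - a) * ((d - c) * (d - c)))"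
    using assms by (intro divide_left_mono mult_left_mono mult_mono mult_pos_pos) auto
  also have "\<dots> = s / (c - a) * ((d - a) / (d - c))"
    using assms by (intro quotient_cancel) auto
  also have "\<dots> \<le> s / (c - a) * (2 / r)"
  proof (rule mult_left_mono)
    have "r * (d - c) \<le> 1 * (d - c)" using assms by (intro mult_right_mono) auto
    then have "r * (d - a) \<le> 2 * (d - c)" using assms by (simp add: algebra_simps)
    then show "(d - a) / (d - c) \<le> 2 / r" using assms by (simp add: field_simps)
  qed (use assms in auto)
  finally show ?thesis by (simp add: algebra_simps)
qed

lemma cr_push_down:
  fixes a y c d s r :: real
  assumes "a \<le> y - s" "y \<le> c" "a < c" "c < d" "0 \<le> s" "0 < r" "r \<le> 1" "r * (c - a) \<le> d - c"
  shows "cr a (y - s) c d + r / 2 * (s / (c - a)) \<le> cr a y c d"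
proof -
  have "s / (c - a) * (r / 2) \<le> s / (c - a) * ((d - c) / (d - a))"
  proof (rule mult_left_mono)
    have "r * (d - c) \<le> 1 * (d - c)" using assms by (intro mult_right_mono) auto
    then have "r * (d - a) \<le> 2 * (d - c)" using assms by (simp add: algebra_simps)
    then show "r / 2 \<le> (d - c) / (d - a)" using assms by (simp add: field_simps)
  qed (use assms in auto)
  also have "\<dots> = (d - c) * s * (d - a) / ((c - a) * ((d - a) * (d - a)))"
    using assms quotient_cancel[of "d - a" "c - a" s "d - c"] by (simp add: mult_ac)
  also have "\<dots> \<le> (d - c) * s * (d - a) / ((c - a) * ((d - y + s) * (d - y)))"
    using assms by (intro divide_left_mono mult_left_mono mult_mono mult_pos_pos) auto
  also have "\<dots> = cr a y c d - cr a (y - s) c d"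
    using assms by (simp add: cr_def divide_simps) (simp add: algebra_simps)
  finally show ?thesis by (simp add: algebra_simps)
qed

lemma cr_position:
  fixes a y c d r :: real
  assumes "a \<le> y" "y \<le> c" "a < c" "c < d" "0 < r" "r \<le> 1" "r * (c - a) \<le> d - c"
  shows "y - a \<le> 2 / r * cr a y c d * (c - a)" and "cr a y c d \<le> (y - a) / (c - a)"
proof -
  have "r * (d - c) \<le> 1 * (d - c)" using assms by (intro mult_right_mono) auto
  then have "r * (d - a) \<le> 2 * (d - c)" using assms by (simp add: algebra_simps)
  moreover have "r * (d - y) \<le> r * (d - a)" using assms by (intro mult_left_mono) auto
  ultimately have "r * (d - y) \<le> 2 * (d - c)" by simp
  then have "(y - a) * (r * (d - y)) \<le> (y - a) * (2 * (d - c))" using assms by (intro mult_left_mono) auto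
  then have "r * (y - a) * (d - y) \<le> 2 * ((y - a) * (d - c))" by (simp only: mult_ac)
  then have "r * (y - a) \<le> 2 * ((y - a) * (d - c)) / (d - y)" using assms by (simp add: pos_le_divide_eq)
  then have "r * (y - a) \<le> 2 * (cr a y c d * (c - a))" using assms by (simp add: cr_def)
  then show "y - a \<le> 2 / r * cr a y c d * (c - a)" using assms
    by (simp add: pos_le_divide_eq mult.commute mult.assoc)
  have "cr a y c d = (y - a) / (c - a) * ((d - c) / (d - y))" by (simp add: cr_def)
  also have "\<dots> \<le> (y - a) / (c - a) * 1" using assms by (intro mult_left_mono) auto
  finally show "cr a y c d \<le> (y - a) / (c - a)" by simp
qed

context critical_lift
begin

definition distortion :: real where "distortion = C * exp (2 * K)"

text \<open>The position of the right end of the trap, relative to the gap to the right of \<open>0\<close>. The first step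
  squares this position and the other steps lose at most the factor \<open>distortion\<close>, up to constants;
  the value is chosen such that the square wins by a factor \<open>4\<close>.\<close>

definition trap_pos :: real where "trap_pos = spacing / (8 * distortion * C)"

definition trap_width :: real where "trap_width = spacing\<^sup>2 * trap_pos / (16 * distortion)"

lemma distortion_ge_1: "1 \<le> distortion"
  unfolding distortion_def using C_ge_1 K_nonneg mult_mono[of 1 C 1 "exp (2 * K)"] by simp

lemma trap_pos_bounds: "0 < trap_pos" "trap_pos \<le> 1/8"
proof -
  have "1 \<le> distortion * C" using distortion_ge_1 C_ge_1 mult_mono[of 1 distortion 1 C] by simp
  then show "0 < trap_pos" "trap_pos \<le> 1/8"
    using spacing_pos spacing_le_1 by (auto simp: trap_pos_def field_simps)
qed

lemma trap_width_pos: "0 < trap_width"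
  using spacing_pos trap_pos_bounds distortion_ge_1 by (simp add: trap_width_def)

end

context critical_cycle
begin

definition inv_gap_sum :: real where
  "inv_gap_sum = (\<Sum>m\<in>{0..<int q}. 1 / gap m)"

lemma sum_inv_gap_orbit_le:
  "b \<le> a + q \<Longrightarrow> (\<Sum>i\<in>{a..<b}. 1 / gap (m + int i * p)) \<le> inv_gap_sum"
  unfolding inv_gap_sum_def
  by (rule sum_residue_le(1)[where \<phi>="\<lambda>m. 1 / gap m"])
    (use q_pos gap_pos in \<open>auto simp: gap_mod less_imp_le intro: inj_on_subset[OF inj_orbit[of m a]]\<close>)

lemma sum_inv_gap_orbit:
  "(\<Sum>i\<in>{a..<a+q}. 1 / gap (m + int i * p)) = inv_gap_sum"
  unfolding inv_gap_sum_def
  by (rule sum_residue_le(2)[where \<phi>="\<lambda>m. 1 / gap m"])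
    (use q_pos gap_pos in \<open>auto simp: gap_mod less_imp_le intro: inj_on_subset[OF inj_orbit[of m a]]\<close>)

text \<open>A moving point between two neighbours of the cycle, followed for at most \<open>q\<close> steps: the only point
  of the cycle strictly inside the four points is the third one, which is critical at most once.\<close>

lemma prod_growth_factor_between:
  assumes "b \<le> a + q" and y: "\<And>i. i \<in> {a..<b} \<Longrightarrow> e (m + int i * p) \<le> y i \<and> y i \<le> e (m + int i * p + 1)"
  shows "(\<Prod>i\<in>{a..<b}. growth_factor (e (m + int i * p)) (y i) (e (m + int i * p + 1)) (e (m + int i * p + 2))) \<le> distortion"
proof -
  let ?hit = "{i \<in> {a..<b}. {e (m + int i * p)<..<e (m + int i * p + 2)} \<inter> \<int> \<noteq> {}}"
  have "?hit \<subseteq> {i \<in> {a..<a+q}. int q dvd (m + 1) + int i * p}"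
  proof
    fix i assume i: "i \<in> ?hit"
    then obtain k where k: "m + int i * p < k" "k < m + int i * p + 2" "int q dvd k"
      using integer_between by blast
    then have "k = (m + 1) + int i * p" by linarith
    moreover have "i \<in> {a..<a+q}" using i assms(1) by auto
    ultimately show "i \<in> {i \<in> {a..<a+q}. int q dvd (m + 1) + int i * p}" using k(3) by simp
  qed
  then have "card ?hit \<le> card {i \<in> {a..<a+q}. int q dvd (m + 1) + int i * p}"
    by (rule card_mono[rotated]) simp
  then have hit: "card ?hit \<le> 1" using card_orbit_hits[where a=a and m="m+1"] by linarith
  have "(\<Sum>i\<in>{a..<b}. (e (m + int i * p + 1) - y i) * (e (m + int i * p + 2) - e (m + int i * p)))
      \<le> (\<Sum>i\<in>{a..<b}. gap (m + int i * p) * 2)"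
  proof (rule sum_mono)
    fix i assume "i \<in> {a..<b}"
    then show "(e (m + int i * p + 1) - y i) * (e (m + int i * p + 2) - e (m + int i * p)) \<le> gap (m + int i * p) * 2"
      using e_diff_le[of "m + int i * p + 2" "m + int i * p" 2] gap_pos[of "m + int i * p"] y[of i]
      by (intro mult_mono) (auto simp: gap_def)
  qed
  also have "\<dots> = 2 * (\<Sum>i\<in>{a..<b}. gap (m + int i * p))"
    by (simp add: sum_distrib_left mult.commute)
  also have "\<dots> \<le> 2 * 1" using sum_gap_orbit_le[OF assms(1)] by (intro mult_left_mono) auto
  finally have "(\<Sum>i\<in>{a..<b}. (e (m + int i * p + 1) - y i) * (e (m + int i * p + 2) - e (m + int i * p))) \<le> 2"
    by simp
  from prod_growth_factor_le[OF _ hit this] show ?thesis by (simp add: distortion_def mult.commute)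
qed

lemma spacing_next: "spacing * (e (m + 1) - e m) \<le> e (m + 2) - e (m + 1)"
  using gap_adjacent(1)[of m] by (simp add: gap_def add.assoc)

text \<open>Start at the fraction \<open>trap_pos\<close> of the gap to the right of \<open>0\<close> and compare with the unperturbed cycle.
  Because of the flatness at \<open>0\<close>, after one step the relative position in the gap is of the order
  \<open>trap_pos\<^sup>2\<close>. From then on it grows by a bounded factor altogether, apart from the shift
  by \<open>s\<close> in each step, which contributes \<open>s\<close> divided by the current gap. After \<open>q\<close> steps the point is
  thus still to the left of the translate of its starting point.\<close>

lemma trap:
  assumes s: "0 \<le> s" "s * inv_gap_sum \<le> trap_width"
  shows "\<exists>x. ((\<lambda>x. f x + (u + s)) ^^ q) x \<le> x + of_int p"
proof -
  let ?\<theta> = trap_pos and ?r = spacing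
  define y where "y i = ((\<lambda>x. f x + (u + s)) ^^ i) (?\<theta> * gap 0)" for i
  define x where "x i = e (int i * p)" for i
  define x1 where "x1 i = e (int i * p + 1)" for i
  define x2 where "x2 i = e (int i * p + 2)" for i
  define \<Lambda> where "\<Lambda> i = (\<Prod>j\<in>{1..<i}. growth_factor (x j) (y j) (x1 j) (x2 j))" for i
  define E where "E i = C * ?\<theta>\<^sup>2 + 2 / ?r * s * (\<Sum>j\<in>{1..<Suc i}. 1 / (x1 j - x j))" for i
  have y_Suc: "y (Suc i) = (f (y i) + u) + s" for i by (simp add: y_def)
  have x_Suc: "f (x i) + u = x (Suc i)" "f (x1 i) + u = x1 (Suc i)" "f (x2 i) + u = x2 (Suc i)" for i
    using e_step[of "int i * p"] e_step[of "int i * p + 1"] e_step[of "int i * p + 2"]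
    by (simp_all add: x_def x1_def x2_def algebra_simps)
  have o: "x i < x1 i" "x1 i < x2 i" for i by (simp_all add: x_def x1_def x2_def)
  have x2x: "x2 i - x i \<le> 3" for i
    using e_diff_le[of "int i * p + 2" "int i * p" 2] by (simp add: x_def x2_def)
  have sp: "?r * (x1 i - x i) \<le> x2 i - x1 i" for i
    using spacing_next[of "int i * p"] by (simp add: x_def x1_def x2_def)
  have gx: "gap (int i * p) = x1 i - x i" for i by (simp add: gap_def x_def x1_def)
  have \<theta>: "0 < ?\<theta>" "?\<theta> \<le> 1/8" by (rule trap_pos_bounds)+
  have r: "0 < ?r" "?r \<le> 1" by (rule spacing_pos spacing_le_1)+
  have sum_S: "i \<le> q \<Longrightarrow> (\<Sum>j\<in>{1..<Suc i}. 1 / (x1 j - x j)) \<le> inv_gap_sum" for i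
    using sum_inv_gap_orbit_le[of "Suc i" 1 0] by (simp add: gx)
  have d0: "0 < distortion" using distortion_ge_1 by simp
  have E_small: "2 / ?r * (distortion * E i) \<le> ?\<theta> / 2" if "i \<le> q" for i
  proof -
    have "2 / ?r * (distortion * E i) = 2 / ?r * (distortion * C * ?\<theta>) * ?\<theta>
        + 4 * distortion / ?r\<^sup>2 * (s * (\<Sum>j\<in>{1..<Suc i}. 1 / (x1 j - x j)))"
      using r by (simp add: E_def power2_eq_square field_simps)
    also have "2 / ?r * (distortion * C * ?\<theta>) * ?\<theta> = ?\<theta> / 4"
      using d0 C_ge_1 r by (simp add: trap_pos_def)
    also have "4 * distortion / ?r\<^sup>2 * (s * (\<Sum>j\<in>{1..<Suc i}. 1 / (x1 j - x j)))
       \<le> 4 * distortion / ?r\<^sup>2 * trap_width"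
      using d0 s mult_left_mono[OF sum_S[OF that] s(1)] by (intro mult_left_mono) auto
    also have "\<dots> = ?\<theta> / 4" using d0 r by (simp add: trap_width_def field_simps)
    finally show ?thesis by simp
  qed
  have s_gap: "s \<le> (x1 i - x i) / 2" if "1 \<le> i" "i \<le> q" for i
  proof -
    have "1 / (x1 i - x i) \<le> (\<Sum>j\<in>{1..<Suc i}. 1 / (x1 j - x j))"
      using o(1) that by (intro member_le_sum) (auto simp: less_imp_le)
    then have "s * (1 / (x1 i - x i)) \<le> s * inv_gap_sum"
      using sum_S[OF that(2)] s by (intro mult_left_mono) auto
    also have "\<dots> \<le> trap_width" by (rule s(2))
    also have "\<dots> \<le> 1/2"
    proof -
      have "?r\<^sup>2 * ?\<theta> \<le> 1 * (1/8)" using r \<theta> by (intro mult_mono) (auto simp: power_le_one)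
      then show ?thesis using distortion_ge_1 by (simp add: trap_width_def field_simps)
    qed
    finally show ?thesis using o(1)[of i] by (simp add: field_simps)
  qed
  have \<Lambda>_le: "\<Lambda> i \<le> distortion" if "i \<le> q" "\<forall>j\<in>{1..<i}. x j \<le> y j \<and> y j \<le> x1 j" for i
    using prod_growth_factor_between[of i 1 0 y] that by (simp add: \<Lambda>_def x_def x1_def x2_def)
  have \<Lambda>_ge: "1 \<le> \<Lambda> i" if "\<forall>j\<in>{1..<i}. x j \<le> y j \<and> y j \<le> x1 j" for i
    unfolding \<Lambda>_def using that o
    by (intro prod_ge_1 growth_factor_ge_1) (auto intro: less_imp_le[OF order_less_trans])
  have C\<theta>: "0 \<le> C * ?\<theta>\<^sup>2" using C_ge_1 by simp
  have E_pos: "0 \<le> E i" for i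
    unfolding E_def using C\<theta> C_ge_1 s r o(1) by (intro add_nonneg_nonneg mult_nonneg_nonneg sum_nonneg) (auto simp: less_imp_le)
  have E_Suc: "E (Suc i) = E i + 2 / ?r * (s / (x1 (Suc i) - x (Suc i)))" for i
    by (simp add: E_def algebra_simps)
  \<comment> \<open>In the step from \<open>0\<close> to \<open>1\<close> the premise \<open>B\<close> comes from flatness, later from the growth of cross-ratios.\<close>
  have push: "x (Suc i) \<le> y (Suc i) \<and> y (Suc i) - x (Suc i) \<le> ?\<theta> / 2 * (x1 (Suc i) - x (Suc i))
      \<and> cr (x (Suc i)) (y (Suc i)) (x1 (Suc i)) (x2 (Suc i)) \<le> \<Lambda>' * E (Suc i)"
    if i: "Suc i \<le> q" and yi: "x i \<le> y i" "y i \<le> x1 i" and L: "1 \<le> \<Lambda>'" "\<Lambda>' \<le> distortion"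
      and B: "cr (x (Suc i)) (f (y i) + u) (x1 (Suc i)) (x2 (Suc i)) \<le> \<Lambda>' * E i" for i \<Lambda>'
  proof -
    let ?y = "f (y i) + u" and ?a = "x (Suc i)" and ?c = "x1 (Suc i)" and ?d = "x2 (Suc i)"
    have ly: "?a \<le> ?y" "?y \<le> ?c"
      using mono_le[OF yi(1)] mono_le[OF yi(2)] by (simp_all add: x_Suc[symmetric])
    have pos: "0 < ?c - ?a" using o(1) by simp
    have bnd: "2 / ?r * (\<Lambda>' * E j) \<le> ?\<theta> / 2" if "j \<le> q" for j
      by (rule order_trans[OF mult_left_mono[OF mult_right_mono[OF L(2) E_pos]] E_small[OF that]])
        (use r in auto)
    have "?y - ?a \<le> 2 / ?r * cr ?a ?y ?c ?d * (?c - ?a)"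
      by (rule cr_position(1)) (use ly o r sp in auto)
    also have "\<dots> \<le> 2 / ?r * (\<Lambda>' * E i) * (?c - ?a)"
      using B r pos by (intro mult_right_mono mult_left_mono) auto
    also have "\<dots> \<le> ?\<theta> / 2 * (?c - ?a)" using bnd[of i] i pos by (intro mult_right_mono) auto
    also have "\<dots> \<le> 1/2 * (?c - ?a)" using \<theta> pos by (intro mult_right_mono) auto
    finally have room: "?y + s \<le> ?c" using s_gap[of "Suc i"] i by simp
    have "cr ?a (?y + s) ?c ?d \<le> cr ?a ?y ?c ?d + 2 / ?r * (s / (?c - ?a))"
      by (rule cr_push_up) (use ly room o r sp s in auto)
    also have "\<dots> \<le> \<Lambda>' * E i + \<Lambda>' * (2 / ?r * (s / (?c - ?a)))"
      using B L(1) r s pos mult_right_mono[OF L(1), of "2 / ?r * (s / (?c - ?a))"] by (intro add_mono) auto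
    also have "\<dots> = \<Lambda>' * E (Suc i)" by (simp add: E_Suc algebra_simps)
    finally have V: "cr ?a (y (Suc i)) ?c ?d \<le> \<Lambda>' * E (Suc i)" by (simp add: y_Suc)
    have ly': "?a \<le> y (Suc i)" "y (Suc i) \<le> ?c" using ly room s by (auto simp: y_Suc)
    have "y (Suc i) - ?a \<le> 2 / ?r * cr ?a (y (Suc i)) ?c ?d * (?c - ?a)"
      by (rule cr_position(1)) (use ly' o r sp in auto)
    also have "\<dots> \<le> 2 / ?r * (\<Lambda>' * E (Suc i)) * (?c - ?a)"
      using V r pos by (intro mult_right_mono mult_left_mono) auto
    also have "\<dots> \<le> ?\<theta> / 2 * (?c - ?a)" using bnd[of "Suc i"] i pos by (intro mult_right_mono) auto
    finally show ?thesis using ly' V by auto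
  qed
  have main: "(\<forall>j\<in>{1..<Suc (Suc i)}. x j \<le> y j \<and> y j - x j \<le> ?\<theta> / 2 * (x1 j - x j))
      \<and> cr (x (Suc i)) (y (Suc i)) (x1 (Suc i)) (x2 (Suc i)) \<le> \<Lambda> (Suc i) * E (Suc i)" if "Suc i \<le> q" for i
    using that
  proof (induction i)
    case 0
    have g0: "0 < gap 0" "gap 0 \<le> 1" by (rule gap_pos gap_le_1)+
    have x0: "x 0 = 0" "x1 0 = gap 0" using e_zero by (simp_all add: x_def x1_def gap_def)
    have y0: "x 0 \<le> y 0" "y 0 \<le> x1 0"
      using \<theta> g0 mult_right_mono[of ?\<theta> 1 "gap 0"] by (simp_all add: x0 y_def)
    have f0: "0 < f (gap 0)" using strict[of 0 "gap 0"] g0 f_zero by simp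
    have "cr (x 1) (f (y 0) + u) (x1 1) (x2 1) \<le> (f (y 0) + u - x 1) / (x1 1 - x 1)"
      using mono_le[OF y0(1)] mono_le[OF y0(2)] x_Suc[of 0] o[of 1] r sp[of 1]
      by (intro cr_position(2)) auto
    also have "\<dots> = f (?\<theta> * gap 0) / f (gap 0)"
      using x_Suc[of 0] by (simp add: x0 f_zero y_def)
    also have "\<dots> \<le> C * ?\<theta>\<^sup>2"
      using flat_right[of ?\<theta> "gap 0"] \<theta> g0 f0 by (simp add: divide_simps)
    also have "\<dots> = 1 * E 0" by (simp add: E_def)
    finally have "cr (x (Suc 0)) (f (y 0) + u) (x1 (Suc 0)) (x2 (Suc 0)) \<le> 1 * E 0" by simp
    from push[OF _ y0 _ _ this] distortion_ge_1 0 show ?case by (simp add: \<Lambda>_def)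
  next
    case (Suc i)
    let ?i = "Suc i"
    from Suc have IH: "\<forall>j\<in>{1..<Suc ?i}. x j \<le> y j \<and> y j - x j \<le> ?\<theta> / 2 * (x1 j - x j)"
      "cr (x ?i) (y ?i) (x1 ?i) (x2 ?i) \<le> \<Lambda> ?i * E ?i" by auto
    have inn: "x j \<le> y j \<and> y j \<le> x1 j" if "j \<in> {1..<Suc ?i}" for j
    proof -
      have "y j - x j \<le> ?\<theta> / 2 * (x1 j - x j)" "x j \<le> y j" using IH(1) that by auto
      moreover have "?\<theta> / 2 * (x1 j - x j) \<le> 1 * (x1 j - x j)"
        using \<theta> o(1)[of j] by (intro mult_right_mono) auto
      ultimately show ?thesis by auto
    qed
    have yi: "x ?i \<le> y ?i" "y ?i \<le> x1 ?i" using inn[of ?i] by auto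
    have "cr (x (Suc ?i)) (f (y ?i) + u) (x1 (Suc ?i)) (x2 (Suc ?i)) = cr (f (x ?i)) (f (y ?i)) (f (x1 ?i)) (f (x2 ?i))"
      by (simp only: x_Suc[symmetric] cr_translate)
    also have "\<dots> \<le> growth_factor (x ?i) (y ?i) (x1 ?i) (x2 ?i) * cr (x ?i) (y ?i) (x1 ?i) (x2 ?i)"
      using yi o[of ?i] x2x[of ?i] by (intro cr_step) linarith+
    also have "\<dots> \<le> growth_factor (x ?i) (y ?i) (x1 ?i) (x2 ?i) * (\<Lambda> ?i * E ?i)"
      using growth_factor_ge_1[of "x ?i" "x2 ?i" "y ?i" "x1 ?i"] yi o[of ?i] IH(2) by (intro mult_left_mono) auto
    also have "\<dots> = \<Lambda> (Suc ?i) * E ?i" by (simp add: \<Lambda>_def mult_ac)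
    finally have B: "cr (x (Suc ?i)) (f (y ?i) + u) (x1 (Suc ?i)) (x2 (Suc ?i)) \<le> \<Lambda> (Suc ?i) * E ?i" .
    have L: "1 \<le> \<Lambda> (Suc ?i)" "\<Lambda> (Suc ?i) \<le> distortion"
      using \<Lambda>_ge[of "Suc ?i"] \<Lambda>_le[of "Suc ?i"] inn Suc.prems by auto
    from push[OF Suc.prems yi L B] show ?case using IH(1) by (auto simp: less_Suc_eq)
  qed
  obtain i where i: "q = Suc i" using q_pos by (cases q) auto
  have xq: "x q = of_int p" using e_multiple[of p] by (simp add: x_def)
  have "x1 q - x q = gap 0" using gx[of q] gap_add_multiple[of 0 p] by simp
  moreover have "y q - x q \<le> ?\<theta> / 2 * (x1 q - x q)" using main[of i] by (simp add: i)
  ultimately have "y q - of_int p \<le> ?\<theta> / 2 * gap 0" using xq by simp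
  also have "\<dots> \<le> ?\<theta> * gap 0" using \<theta> gap_pos[of 0] by simp
  finally have "y q \<le> ?\<theta> * gap 0 + of_int p" by simp
  then show ?thesis by (auto simp: y_def)
qed

end

section \<open>The gap sum and the distance to a parent parameter\<close>

context critical_cycle
begin

text \<open>At the smaller parameter \<open>u - D\<close> the orbit of \<open>0\<close> falls behind the cycle, and after \<open>q'\<close> steps it has lost
  exactly the whole gap on the left. Until then it lies in the gap to the left of the corresponding point of the
  cycle. The cross-ratio of its position is \<open>1\<close> at the beginning and \<open>0\<close> at the end; it can grow by a
  bounded factor only, and each step lowers it by at least a multiple of \<open>D\<close> divided by the current gap.\<close>

lemma push:
  assumes q': "q' \<le> q" and bezout: "int q' * p - p' * int q = 1" and D: "0 \<le> D"
    and hit: "((\<lambda>x. f x + (u - D)) ^^ q') 0 = of_int p'"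
  shows "D * (\<Sum>i\<in>{1..<Suc q'}. 1 / gap (-1 + int i * p)) \<le> 2 * distortion / spacing"
proof -
  let ?r = spacing
  define y where "y i = ((\<lambda>x. f x + (u - D)) ^^ i) 0" for i
  define x where "x i = e (-1 + int i * p)" for i
  define x1 where "x1 i = e (-1 + int i * p + 1)" for i
  define x2 where "x2 i = e (-1 + int i * p + 2)" for i
  define \<Lambda> where "\<Lambda> i = (\<Prod>j\<in>{0..<i}. growth_factor (x j) (y j) (x1 j) (x2 j))" for i
  define S where "S i = (\<Sum>j\<in>{1..<Suc i}. 1 / (x1 j - x j))" for i
  have y_Suc: "y (Suc i) = (f (y i) + u) - D" for i by (simp add: y_def)
  have x_Suc: "f (x i) + u = x (Suc i)" "f (x1 i) + u = x1 (Suc i)" "f (x2 i) + u = x2 (Suc i)" for i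
    using e_step[of "-1 + int i * p"] e_step[of "-1 + int i * p + 1"] e_step[of "-1 + int i * p + 2"]
    by (simp_all add: x_def x1_def x2_def algebra_simps)
  have o: "x i < x1 i" "x1 i < x2 i" for i by (simp_all add: x_def x1_def x2_def)
  have x2x: "x2 i - x i \<le> 3" for i
    using e_diff_le[of "-1 + int i * p + 2" "-1 + int i * p" 2] by (simp add: x_def x2_def)
  have sp: "?r * (x1 i - x i) \<le> x2 i - x1 i" for i
    using spacing_next[of "-1 + int i * p"] unfolding x_def x1_def x2_def .
  have r: "0 < ?r" "?r \<le> 1" by (rule spacing_pos spacing_le_1)+
  have up: "y i \<le> x1 i" for i
  proof (induction i)
    case (Suc i)
    then show ?case using mono_le[OF Suc.IH] D x_Suc(2)[of i] by (simp add: y_Suc)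
  qed (use e_zero in \<open>simp add: y_def x1_def\<close>)
  have "-1 + int q' * p = int q * p'" using bezout by (simp add: mult.commute)
  then have "x q' = of_int p'" by (simp add: x_def e_multiple)
  then have yq: "y q' = x q'" using hit by (simp add: y_def)
  have low: "x i \<le> y i" if "i \<le> q'" for i
  proof (rule ccontr)
    assume "\<not> x i \<le> y i"
    have "y (i + n) < x (i + n)" for n
    proof (induction n)
      case (Suc n)
      from strict[OF this] D x_Suc(1)[of "i + n"] show ?case by (simp add: y_Suc)
    qed (use \<open>\<not> x i \<le> y i\<close> in simp)
    from this[of "q' - i"] yq that show False by simp
  qed
  have S_nonneg: "0 \<le> S i" for i
    unfolding S_def using o(1) by (intro sum_nonneg) (auto simp: less_imp_le)
  have main: "cr (x i) (y i) (x1 i) (x2 i) + ?r / 2 * D * S i \<le> \<Lambda> i" if "i \<le> q'" for i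
    using that
  proof (induction i)
    case 0
    have "y 0 = x1 0" using e_zero by (simp add: y_def x1_def)
    then show ?case using o[of 0] by (simp add: cr_def S_def \<Lambda>_def)
  next
    case (Suc i)
    let ?y = "f (y i) + u" and ?a = "x (Suc i)" and ?c = "x1 (Suc i)" and ?d = "x2 (Suc i)"
    let ?A = "growth_factor (x i) (y i) (x1 i) (x2 i)"
    have yi: "x i \<le> y i" "y i \<le> x1 i" using low Suc.prems up by auto
    have A: "1 \<le> ?A" using yi o[of i] by (intro growth_factor_ge_1) auto
    have X: "0 \<le> ?r / 2 * D * S i" using r D S_nonneg by simp
    have V: "cr (x i) (y i) (x1 i) (x2 i) + ?r / 2 * D * S i \<le> \<Lambda> i" using Suc by simp
    have "cr ?a ?y ?c ?d = cr (f (x i)) (f (y i)) (f (x1 i)) (f (x2 i))"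
      by (simp only: x_Suc[symmetric] cr_translate)
    also have "\<dots> \<le> ?A * cr (x i) (y i) (x1 i) (x2 i)"
      using yi o[of i] x2x[of i] by (intro cr_step) linarith+
    also have "\<dots> \<le> ?A * (\<Lambda> i - ?r / 2 * D * S i)" using V A by (intro mult_left_mono) auto
    also have "\<dots> = \<Lambda> (Suc i) - ?A * (?r / 2 * D * S i)" by (simp add: \<Lambda>_def algebra_simps)
    also have "\<dots> \<le> \<Lambda> (Suc i) - ?r / 2 * D * S i" using mult_right_mono[OF A X] by simp
    finally have 1: "cr ?a ?y ?c ?d \<le> \<Lambda> (Suc i) - ?r / 2 * D * S i" .
    have "cr ?a (?y - D) ?c ?d + ?r / 2 * (D / (?c - ?a)) \<le> cr ?a ?y ?c ?d"
    proof (rule cr_push_down)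
      show "?a \<le> ?y - D" using low[OF Suc.prems] by (simp add: y_Suc)
      show "?y \<le> ?c" using mono_le[OF yi(2)] x_Suc(2)[of i] by simp
    qed (use o r sp D in auto)
    then show ?case using 1 by (simp add: y_Suc S_def algebra_simps)
  qed
  have "\<Lambda> q' \<le> distortion"
    unfolding \<Lambda>_def x_def x1_def x2_def
    by (rule prod_growth_factor_between) (use q' low up in \<open>auto simp: x_def x1_def\<close>)
  moreover have "0 \<le> cr (x q') (y q') (x1 q') (x2 q')"
    using low[of q'] up[of q'] o[of q'] by (intro cr_nonneg) auto
  ultimately have "?r / 2 * D * S q' \<le> distortion" using main[of q'] by simp
  moreover have "S q' = (\<Sum>i\<in>{1..<Suc q'}. 1 / gap (-1 + int i * p))"
    by (simp add: S_def x_def x1_def gap_def)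
  ultimately show ?thesis using r by (simp add: field_simps)
qed

end

text \<open>A chain of adjacent gaps: the gap to the right of the point of time \<open>i0\<close> and its images under \<open>f\<close>
  iterated \<open>q'\<close> times, as long as the time does not exceed \<open>q\<close>. By the choice of \<open>q'\<close> this iterate moves
  each point of the cycle to its right neighbour. The lengths are \<open>g 0, \<dots>, g J\<close>. The points \<open>Z s j\<close> with
  \<open>s \<le> q'\<close> decompose the step from the chain shifted by one place (\<open>s = 0\<close>) to the chain itself
  (\<open>s = q'\<close>) into single applications of \<open>f\<close>.\<close>

locale critical_chain = critical_cycle +
  fixes q' :: nat and p' :: int and i0 :: nat
  assumes q'_le: "q' \<le> q" and bezout: "int q' * p - p' * int q = 1"
    and i0: "1 \<le> i0" "i0 \<le> q'"
begin

definition J :: nat where "J = (q - i0) div q'"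

definition g :: "nat \<Rightarrow> real" where "g j = gap (int i0 * p + int j)"

definition Z :: "nat \<Rightarrow> nat \<Rightarrow> real" where
  "Z s j = e (int i0 * p + int j + (int s - int q') * p)"

definition T :: "nat \<Rightarrow> real" where "T s = Z s (J + 1) - Z s 0"

lemma q'_pos: "0 < q'" using i0 by simp

lemma J_bounds: "i0 + J * q' \<le> q" "q < i0 + (J + 1) * q'"
proof -
  have "J * q' + (q - i0) mod q' = q - i0" by (simp add: J_def)
  moreover have "(q - i0) mod q' < q'" using q'_pos by simp
  moreover have "i0 \<le> q" using i0 q'_le by simp
  ultimately show "i0 + J * q' \<le> q" "q < i0 + (J + 1) * q'" by (auto simp: algebra_simps)
qed

lemma Z_step: "f (Z s j) + u = Z (Suc s) j"
  using e_step[of "int i0 * p + int j + (int s - int q') * p"] by (simp add: Z_def algebra_simps)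

lemma Z_last: "Z q' j = e (int i0 * p + int j)"
  by (simp add: Z_def)

lemma Z_first: "Z 0 (Suc j) = Z q' j - of_int p'"
proof -
  have "int i0 * p + int (Suc j) + (int 0 - int q') * p = (int i0 * p + int j) + int q * (- p')"
    using bezout by (simp add: algebra_simps)
  then have "Z 0 (Suc j) = e ((int i0 * p + int j) + int q * (- p'))" by (simp only: Z_def)
  then show ?thesis unfolding e_period_int Z_last by simp
qed

lemma Z_strict: "i < j \<Longrightarrow> Z s i < Z s j"
  by (simp add: Z_def)

lemma g_eq: "g j = Z q' (Suc j) - Z q' j"
  by (simp add: g_def gap_def Z_last algebra_simps)

lemma g_pos: "0 < g j"
  by (simp add: g_def gap_pos)

text \<open>Modulo \<open>q\<close> the factor \<open>q'\<close> is inverse to \<open>p\<close>, so it turns indices in the enumeration into times.\<close>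

lemma time_of_position:
  "int q dvd (int i0 * p + int j + (int s - int q') * p) * int q' - (int i0 + int s - int q' + int j * int q')"
proof -
  have "p * int q' = 1 + p' * int q" using bezout by (simp add: algebra_simps)
  moreover have "(int i0 * p + int j + (int s - int q') * p) * int q'
      = (int i0 + int s - int q') * (p * int q') + int j * int q'"
    by (simp add: algebra_simps)
  ultimately have "(int i0 * p + int j + (int s - int q') * p) * int q' - (int i0 + int s - int q' + int j * int q')
     = (int i0 + int s - int q') * p' * int q"
    by (simp add: algebra_simps)
  then show ?thesis by (metis dvd_triv_right)
qed

lemma time_bounds:
  assumes "s < q'" "1 \<le> j" "j \<le> J"
  shows "0 < int i0 + int s - int q' + int j * int q'" "int i0 + int s - int q' + int j * int q' < int q"
proof -
  have "1 * q' \<le> j * q'" "j * q' \<le> J * q'" using assms by (intro mult_le_mono; simp)+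
  then have *: "q' \<le> j * q'" "i0 + j * q' \<le> q" using J_bounds(1) by linarith+
  then have "int q' \<le> int j * int q'" "int i0 + int j * int q' \<le> int q"
    by (metis of_nat_le_iff of_nat_mult, metis of_nat_add of_nat_le_iff of_nat_mult)
  then show "0 < int i0 + int s - int q' + int j * int q'" "int i0 + int s - int q' + int j * int q' < int q"
    using assms i0 by linarith+
qed

text \<open>The times of the inner points stay strictly between \<open>0\<close> and \<open>q\<close>.\<close>

lemma chain_avoids_integers:
  assumes "s < q'"
  shows "{Z s 0<..<Z s (J + 1)} \<inter> \<int> = {}"
proof (rule ccontr)
  assume "\<not> ?thesis"
  then obtain n where n: "int i0 * p + (int s - int q') * p < n"
    "n < int i0 * p + int (J + 1) + (int s - int q') * p" "int q dvd n"
    using integer_between[of "int i0 * p + int 0 + (int s - int q') * p" "int i0 * p + int (J + 1) + (int s - int q') * p"]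
    by (auto simp: Z_def)
  define j where "j = nat (n - (int i0 * p + (int s - int q') * p))"
  have j: "1 \<le> j" "j \<le> J" "n = int i0 * p + int j + (int s - int q') * p"
    using n by (auto simp: j_def)
  have "int q dvd (int i0 * p + int j + (int s - int q') * p) * int q'" using n(3) unfolding j(3) by (rule dvd_mult2)
  then have "int q dvd int i0 + int s - int q' + int j * int q'"
    using dvd_diff[OF _ time_of_position[of j s]] by (metis diff_diff_eq2 add_diff_cancel_left')
  then show False using time_bounds[OF assms j(1,2)] zdvd_not_zless by blast
qed

lemma T_bounds: "0 < T s" "T s \<le> 1"
proof -
  show "0 < T s" by (simp add: T_def Z_strict)
  have "J + 1 \<le> q"
  proof -
    have "J \<le> J * q'" using q'_pos by simp
    then show ?thesis using J_bounds(1) i0 by linarith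
  qed
  then have "Z s (J + 1) \<le> Z s q" unfolding Z_def by simp
  also have "\<dots> = Z s 0 + 1"
    using e_period[of "int i0 * p + (int s - int q') * p"] by (simp add: Z_def algebra_simps)
  finally show "T s \<le> 1" by (simp add: T_def)
qed

text \<open>The first gaps of the chain at the different stages are successive images of a single gap, and all
  other gaps have different times between \<open>0\<close> and \<open>q\<close>; so no point of the circle is covered more than
  twice.\<close>

lemma sum_T: "(\<Sum>s<q'. T s) \<le> 2"
proof -
  let ?\<kappa> = "\<lambda>s j. int i0 * p + int j + (int s - int q') * p"
  have T: "T s = gap (?\<kappa> s 0) + (\<Sum>j\<in>{1..<J+1}. gap (?\<kappa> s j))" for s
  proof -
    have "T s = (\<Sum>j<J + 1. gap (?\<kappa> s j))"
      using e_add_nat[of "?\<kappa> s 0" "J + 1"] by (simp add: T_def Z_def algebra_simps)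
    also have "\<dots> = (\<Sum>j\<in>{0..<J+1}. gap (?\<kappa> s j))" by (simp only: lessThan_atLeast0)
    also have "\<dots> = gap (?\<kappa> s 0) + (\<Sum>j\<in>{Suc 0..<J+1}. gap (?\<kappa> s j))"
      by (subst sum.atLeast_Suc_lessThan) auto
    finally show ?thesis by simp
  qed
  have "(\<Sum>s<q'. gap (?\<kappa> s 0)) = (\<Sum>s\<in>{0..<q'}. gap ((int i0 - int q') * p + int s * p))"
    by (intro sum.cong) (auto simp: algebra_simps)
  also have "\<dots> \<le> 1" using q'_le by (intro sum_gap_orbit_le) simp
  finally have 1: "(\<Sum>s<q'. gap (?\<kappa> s 0)) \<le> 1" .
  have "(\<Sum>s<q'. \<Sum>j\<in>{1..<J+1}. gap (?\<kappa> s j)) = (\<Sum>a\<in>{..<q'} \<times> {1..<J+1}. gap (?\<kappa> (fst a) (snd a)))"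
    by (simp only: sum.cartesian_product split_def)
  also have "\<dots> \<le> 1"
  proof (rule sum_gap_le_1)
    show "inj_on (\<lambda>a. ?\<kappa> (fst a) (snd a) mod int q) ({..<q'} \<times> {1..<J+1})"
    proof (rule inj_onI)
      fix x y assume x: "x \<in> {..<q'} \<times> {1..<J+1}" and y: "y \<in> {..<q'} \<times> {1..<J+1}"
        and xy: "?\<kappa> (fst x) (snd x) mod int q = ?\<kappa> (fst y) (snd y) mod int q"
      obtain s j s' j' where xy': "x = (s, j)" "y = (s', j')" by (cases x, cases y)
      have a: "s < q'" "1 \<le> j" "j \<le> J" "s' < q'" "1 \<le> j'" "j' \<le> J" using x y xy' by auto
      have eq: "?\<kappa> s j mod int q = ?\<kappa> s' j' mod int q" using xy xy' by simp
      let ?t = "\<lambda>s j. int i0 + int s - int q' + int j * int q'"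
      have "(?\<kappa> s j * int q') mod int q = (?\<kappa> s' j' * int q') mod int q"
        using eq by (metis mod_mult_left_eq)
      moreover have "(?\<kappa> s j * int q') mod int q = ?t s j mod int q" for s j
        using time_of_position[of j s] by (simp add: mod_eq_dvd_iff)
      ultimately have "?t s j mod int q = ?t s' j' mod int q" by simp
      then have "?t s j = ?t s' j'"
        using time_bounds[of s j] time_bounds[of s' j'] a by simp
      then have "int (s + j * q') = int (s' + j' * q')" by simp
      then have eq': "s + j * q' = s' + j' * q'" by (simp only: of_nat_eq_iff)
      then have "(s + j * q') mod q' = (s' + j' * q') mod q'" by simp
      then have "s = s'" using a by simp
      then show "x = y" using eq' q'_pos xy' by simp
    qed
  qed simp
  finally have "(\<Sum>s<q'. \<Sum>j\<in>{1..<J+1}. gap (?\<kappa> s j)) \<le> 1" .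
  with 1 show ?thesis by (simp add: T sum.distrib)
qed

lemma sum_T_square: "A \<subseteq> {..<q'} \<Longrightarrow> (\<Sum>s\<in>A. (T s)\<^sup>2) \<le> 2"
proof -
  assume "A \<subseteq> {..<q'}"
  then have "(\<Sum>s\<in>A. (T s)\<^sup>2) \<le> (\<Sum>s<q'. (T s)\<^sup>2)" by (intro sum_mono2) auto
  also have "\<dots> \<le> (\<Sum>s<q'. T s)"
    using T_bounds by (intro sum_mono) (simp add: power2_eq_square mult_left_le less_imp_le)
  finally show ?thesis using sum_T by simp
qed

text \<open>Since \<open>J T / (L R)\<close> shrinks by a bounded factor only, a middle interval that is short at the last
  stage is short at all stages, relative to the whole chain. This is what makes the error term in
  \<open>chain_cr\<close> small.\<close>

lemma chain_space:
  assumes mj: "1 \<le> m" "m < j" "j \<le> J" and s: "s \<le> q'"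
  shows "Z s j - Z s m \<le> T s * (exp (2 * K) * ((Z q' j - Z q' m) * T q' / ((Z q' m - Z q' 0) * (Z q' (J+1) - Z q' j))))"
proof -
  define D where "D s = (Z s j - Z s m) * T s / ((Z s m - Z s 0) * (Z s (J+1) - Z s j))" for s
  have o: "Z s 0 < Z s m" "Z s m < Z s j" "Z s j < Z s (J+1)" for s
    using mj by (auto intro: Z_strict)
  have D_pos: "0 < D s" for s using o[of s] T_bounds by (simp add: D_def)
  have step: "D s \<le> exp (K * (T s)\<^sup>2) * D (Suc s)" if "s < q'" for s
  proof -
    have d: "f (Z s i) - f (Z s j) = Z (Suc s) i - Z (Suc s) j" for i j by (simp add: Z_step[symmetric])
    have "((Z s j - Z s m) * T s) * ((Z (Suc s) m - Z (Suc s) 0) * (Z (Suc s) (J+1) - Z (Suc s) j))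
       \<le> exp (K * (T s)\<^sup>2) * (((Z s m - Z s 0) * (Z s (J+1) - Z s j)) * ((Z (Suc s) j - Z (Suc s) m) * T (Suc s)))"
      using space_smooth[OF o[of s] chain_avoids_integers[OF that]] unfolding T_def d .
    then show ?thesis using o[of s] o[of "Suc s"] unfolding D_def
      by (simp add: divide_le_eq le_divide_eq mult_ac)
  qed
  have "D (q' - n) \<le> exp (K * (\<Sum>s\<in>{q' - n..<q'}. (T s)\<^sup>2)) * D q'" if "n \<le> q'" for n
    using that
  proof (induction n)
    case (Suc n)
    let ?s = "q' - Suc n"
    have S: "Suc ?s = q' - n" using Suc.prems by simp
    have "{?s..<q'} = insert ?s {q' - n..<q'}" using Suc.prems by auto
    then have sum: "(\<Sum>s\<in>{?s..<q'}. (T s)\<^sup>2) = (T ?s)\<^sup>2 + (\<Sum>s\<in>{q' - n..<q'}. (T s)\<^sup>2)"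
      using Suc.prems by simp
    have "D ?s \<le> exp (K * (T ?s)\<^sup>2) * D (q' - n)" using step[of ?s] S Suc.prems by simp
    also have "\<dots> \<le> exp (K * (T ?s)\<^sup>2) * (exp (K * (\<Sum>s\<in>{q' - n..<q'}. (T s)\<^sup>2)) * D q')"
      using Suc by (intro mult_left_mono) auto
    finally show ?case by (simp add: sum distrib_left exp_add mult_ac)
  qed simp
  from this[of "q' - s"] s have "D s \<le> exp (K * (\<Sum>s\<in>{s..<q'}. (T s)\<^sup>2)) * D q'" by simp
  also have "\<dots> \<le> exp (2 * K) * D q'"
  proof -
    have "K * (\<Sum>s\<in>{s..<q'}. (T s)\<^sup>2) \<le> K * 2"
      using K_nonneg by (intro mult_left_mono sum_T_square) auto
    then show ?thesis using D_pos[of q'] by (intro mult_right_mono) (auto simp: mult.commute)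
  qed
  finally have D: "D s \<le> exp (2 * K) * D q'" .
  have LR: "(Z s m - Z s 0) * (Z s (J+1) - Z s j) \<le> T s * T s"
    using o[of s] by (intro mult_mono) (auto simp: T_def)
  have "(Z s j - Z s m) = T s * ((Z s j - Z s m) * T s / (T s * T s))"
    using T_bounds(1)[of s] by simp
  also have "\<dots> \<le> T s * D s"
    unfolding D_def using LR o[of s] T_bounds(1)[of s]
    by (intro mult_left_mono divide_left_mono mult_nonneg_nonneg mult_pos_pos) auto
  also have "\<dots> \<le> T s * (exp (2 * K) * D q')"
    using D T_bounds(1)[of s] by (intro mult_left_mono) auto
  finally show ?thesis by (simp add: D_def)
qed

lemma chain_cr:
  assumes mj: "1 \<le> m" "m < j" "j \<le> J"
  shows "cr (Z q' 0) (Z q' m) (Z q' j) (Z q' (Suc j))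
    \<le> exp (K * (\<Sum>s<q'. (Z s j - Z s m) * T s)) * cr (Z 0 0) (Z 0 m) (Z 0 j) (Z 0 (Suc j))"
proof -
  have "cr (Z n 0) (Z n m) (Z n j) (Z n (Suc j))
    \<le> exp (K * (\<Sum>s<n. (Z s j - Z s m) * T s)) * cr (Z 0 0) (Z 0 m) (Z 0 j) (Z 0 (Suc j))"
    if "n \<le> q'" for n using that
  proof (induction n)
    case (Suc n)
    have o: "Z s 0 < Z s m" "Z s m < Z s j" "Z s j < Z s (Suc j)" "Z s (Suc j) \<le> Z s (J + 1)" for s
      using mj by (auto intro: Z_strict simp: Z_def)
    have nz: "{Z n 0<..<Z n (Suc j)} \<inter> \<int> = {}"
      using chain_avoids_integers[of n] Suc.prems o(4)[of n] by fastforce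
    have pos: "0 \<le> cr (Z n 0) (Z n m) (Z n j) (Z n (Suc j))"
      using o[of n] by (intro cr_nonneg) auto
    have "cr (Z (Suc n) 0) (Z (Suc n) m) (Z (Suc n) j) (Z (Suc n) (Suc j))
      = cr (f (Z n 0)) (f (Z n m)) (f (Z n j)) (f (Z n (Suc j)))"
      by (simp only: Z_step[symmetric] cr_translate)
    also have "\<dots> \<le> exp (K * ((Z n j - Z n m) * (Z n (Suc j) - Z n 0))) * cr (Z n 0) (Z n m) (Z n j) (Z n (Suc j))"
      by (rule cr_smooth[OF _ _ _ _ _ nz]) (use o[of n] in auto)
    also have "\<dots> \<le> exp (K * ((Z n j - Z n m) * T n)) * cr (Z n 0) (Z n m) (Z n j) (Z n (Suc j))"
      using o[of n] K_nonneg pos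
      by (intro mult_right_mono) (auto simp: T_def intro!: mult_left_mono)
    also have "\<dots> \<le> exp (K * ((Z n j - Z n m) * T n)) * (exp (K * (\<Sum>s<n. (Z s j - Z s m) * T s)) * cr (Z 0 0) (Z 0 m) (Z 0 j) (Z 0 (Suc j)))"
      using Suc by (intro mult_left_mono) auto
    finally show ?case by (simp add: distrib_left exp_add mult_ac)
  qed simp
  then show ?thesis by simp
qed

end

context critical_lift
begin

text \<open>In \<open>nonlinearity\<close> the first summand bounds the distortion of the cross-ratio and the second one the change of the factor \<open>(b - a) / (c - a)\<close>.\<close>

definition nonlinearity :: real where "nonlinearity = 6 * K * exp (2 * K) + 1"

definition chain_const :: real where "chain_const = spacing / (4 * nonlinearity)"

definition step_const :: real where
  "step_const = 2 / (chain_const * spacing) * (2 * distortion / spacing)"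

lemma nonlinearity_ge_1: "1 \<le> nonlinearity"
  using K_nonneg by (simp add: nonlinearity_def)

lemma chain_const_pos: "0 < chain_const"
  using spacing_pos nonlinearity_ge_1 by (simp add: chain_const_def)

lemma step_const_pos: "0 < step_const"
  using spacing_pos chain_const_pos distortion_ge_1 by (simp add: step_const_def)

end

context critical_chain
begin

lemma sum_g: "Z q' j - Z q' m = (\<Sum>i\<in>{m..<j}. g i)" if "m \<le> j"
  using that by (simp add: g_eq sum_Suc_diff')

text \<open>Let \<open>n\<close> be the last index before \<open>j\<close> with \<open>g n \<ge> g j\<close>, and put \<open>m = n + 1\<close>. Shifting the interval
  between the points \<open>m\<close> and \<open>j + 1\<close> back by one place adds \<open>g n\<close> and removes \<open>g j\<close>, so it does not
  become shorter. As the cross-ratio of the points \<open>0\<close>, \<open>m\<close>, \<open>j\<close>, \<open>j + 1\<close> hardly decreases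
  under this shift, \<open>g (j - 1)\<close> cannot be much smaller than \<open>g j\<close>. The distance between \<open>m\<close> and \<open>j\<close>, which
  determines both errors, is at most \<open>J\<close> times \<open>g j\<close>. This is a discrete version of the fact
  that the slope of a positive function with bounded second derivative is small where its value is small.\<close>

lemma chain_contract:
  assumes j: "1 \<le> j" "j \<le> J" and \<rho>: "0 < \<rho>" "\<rho> \<le> g 0" "\<rho> \<le> g J"
    and small: "g j < \<rho>" "real J * g j \<le> \<rho>"
  shows "g j * (1 - nonlinearity * real J * g j / \<rho>) \<le> g (j - 1)"
proof -
  define n where "n = Max {n. n < j \<and> g j \<le> g n}"
  have fin: "finite {n. n < j \<and> g j \<le> g n}" by simp
  have "0 \<in> {n. n < j \<and> g j \<le> g n}" using j \<rho> small by simp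
  then have ne: "{n. n < j \<and> g j \<le> g n} \<noteq> {}" by blast
  have n: "n < j" "g j \<le> g n" using Max_in[OF fin ne] by (auto simp: n_def)
  have after: "g i < g j" if "n < i" "i < j" for i
  proof (rule ccontr)
    assume "\<not> g i < g j"
    then have "i \<in> {n. n < j \<and> g j \<le> g n}" using that by simp
    from Max_ge[OF fin this] that(1) show False by (simp add: n_def)
  qed
  define m where "m = Suc n"
  have gj: "0 < g j" by (rule g_pos)
  have J0: "0 \<le> nonlinearity * real J * g j / \<rho>"
    using nonlinearity_ge_1 gj \<rho> by simp
  show ?thesis
  proof (cases "m = j")
    case True
    then have "g j \<le> g (j - 1)" using n by (auto simp: m_def)
    moreover have "g j * (1 - nonlinearity * real J * g j / \<rho>) \<le> g j * 1"
      using J0 gj by (intro mult_left_mono) auto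
    ultimately show ?thesis by simp
  next
    case False
    then have mj: "1 \<le> m" "m < j" using n by (auto simp: m_def)
    define X where "X = Z q' j - Z q' m"
    define L where "L = Z q' m - Z q' 0"
    define R where "R = Z q' (J + 1) - Z q' j"
    have X0: "0 < X" using mj by (simp add: X_def Z_strict)
    have "X = (\<Sum>i\<in>{m..<j}. g i)" using mj by (simp add: X_def sum_g)
    also have "\<dots> \<le> (\<Sum>i\<in>{m..<j}. g j)"
      using after by (intro sum_mono) (auto simp: m_def less_imp_le)
    also have "\<dots> = real (j - m) * g j" by simp
    also have "\<dots> \<le> real J * g j" using j gj by (intro mult_right_mono) auto
    finally have X: "X \<le> real J * g j" .
    have X\<rho>: "X \<le> \<rho>" using X small by simp
    have "g 0 \<le> L"
      using mj Z_strict[of 1 m q'] by (cases "m = 1") (auto simp: L_def g_eq)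
    then have L: "\<rho> \<le> L" using \<rho> by simp
    have "g J \<le> R"
      using j Z_strict[of j J q'] by (cases "j = J") (auto simp: R_def g_eq)
    then have R: "\<rho> \<le> R" using \<rho> by simp
    have T: "T q' = L + X + R" by (simp add: T_def L_def X_def R_def)
    have "T q' / (L * R) \<le> 3 / \<rho>"
    proof -
      have "\<rho> * L \<le> R * L" "\<rho> * R \<le> L * R" "\<rho> * X \<le> L * R"
        using L R X\<rho> X0 \<rho> by (auto intro!: mult_mono)
      then have "\<rho> * T q' \<le> 3 * (L * R)" by (simp add: T algebra_simps)
      moreover have "0 < L * R" using L R \<rho> by simp
      ultimately show ?thesis using \<rho> by (simp add: divide_le_eq pos_le_divide_eq field_simps)
    qed
    then have "X * (T q' / (L * R)) \<le> X * (3 / \<rho>)" using X0 by (intro mult_left_mono) auto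
    then have XT: "X * T q' / (L * R) \<le> 3 * X / \<rho>" by (simp add: mult.commute)
    define \<kappa> where "\<kappa> = K * (\<Sum>s<q'. (Z s j - Z s m) * T s)"
    have "(\<Sum>s<q'. (Z s j - Z s m) * T s) \<le> (\<Sum>s<q'. (exp (2 * K) * (3 * X / \<rho>)) * (T s)\<^sup>2)"
    proof (rule sum_mono)
      fix s assume "s \<in> {..<q'}"
      then have "Z s j - Z s m \<le> T s * (exp (2 * K) * (X * T q' / (L * R)))"
        using chain_space[OF mj j(2), of s] by (simp add: X_def L_def R_def)
      also have "\<dots> \<le> T s * (exp (2 * K) * (3 * X / \<rho>))"
        using XT T_bounds(1)[of s] by (intro mult_left_mono) auto
      finally have "(Z s j - Z s m) * T s \<le> T s * (exp (2 * K) * (3 * X / \<rho>)) * T s"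
        using T_bounds(1)[of s] by (intro mult_right_mono) auto
      then show "(Z s j - Z s m) * T s \<le> (exp (2 * K) * (3 * X / \<rho>)) * (T s)\<^sup>2"
        by (simp add: power2_eq_square mult_ac)
    qed
    also have "\<dots> = (exp (2 * K) * (3 * X / \<rho>)) * (\<Sum>s<q'. (T s)\<^sup>2)" by (simp add: sum_distrib_left)
    also have "\<dots> \<le> (exp (2 * K) * (3 * X / \<rho>)) * 2"
      using X0 \<rho> by (intro mult_left_mono sum_T_square) auto
    finally have \<kappa>_le: "\<kappa> \<le> 6 * K * exp (2 * K) * X / \<rho>"
      using K_nonneg mult_left_mono[of _ _ K] by (fastforce simp: \<kappa>_def mult_ac)
    have \<kappa>_pos: "0 \<le> \<kappa>"
      unfolding \<kappa>_def using K_nonneg T_bounds(1) mj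
      by (intro mult_nonneg_nonneg sum_nonneg) (auto simp: less_imp_le Z_strict)
    have o: "Z q' 0 < Z q' m" "Z q' m < Z q' j" "Z q' j < Z q' (Suc j)"
      using mj by (auto intro: Z_strict)
    have o0: "Z 0 0 < Z 0 m" "Z 0 m < Z 0 j" "Z 0 j < Z 0 (Suc j)"
      using mj by (auto intro: Z_strict)
    have S1: "Z 0 (Suc j) - Z 0 j = g (j - 1)"
      using mj Z_first[of j] Z_first[of "j - 1"] by (simp add: g_eq)
    have S2: "Z q' (Suc j) - Z q' m \<le> Z 0 (Suc j) - Z 0 m"
      using n(2) Z_first[of j] Z_first[of n] by (simp add: m_def g_eq)
    have "(1 - X / \<rho>) * (g j / (Z q' (Suc j) - Z q' m)) \<le> (L / (L + X)) * (g j / (Z q' (Suc j) - Z q' m))"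
    proof (rule mult_right_mono)
      have "X / (L + X) \<le> X / \<rho>" using L X0 \<rho> by (intro divide_left_mono) auto
      moreover have "L / (L + X) = 1 - X / (L + X)" using L X0 \<rho> by (simp add: field_simps)
      ultimately show "1 - X / \<rho> \<le> L / (L + X)" by simp
    qed (use o gj in auto)
    also have "\<dots> = cr (Z q' 0) (Z q' m) (Z q' j) (Z q' (Suc j))"
      by (simp add: cr_def L_def X_def g_eq)
    also have "\<dots> \<le> exp \<kappa> * cr (Z 0 0) (Z 0 m) (Z 0 j) (Z 0 (Suc j))"
      unfolding \<kappa>_def by (rule chain_cr[OF mj j(2)])
    also have "\<dots> = exp \<kappa> * (((Z 0 m - Z 0 0) / (Z 0 j - Z 0 0)) * (g (j - 1) / (Z 0 (Suc j) - Z 0 m)))"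
      by (simp add: cr_def S1)
    also have "\<dots> \<le> exp \<kappa> * (1 * (g (j - 1) / (Z q' (Suc j) - Z q' m)))"
      using o o0 S2 g_pos[of "j - 1"]
      by (intro mult_left_mono mult_mono divide_left_mono mult_pos_pos) auto
    finally have "(1 - X / \<rho>) * g j \<le> exp \<kappa> * g (j - 1)"
      using o by (simp add: divide_le_cancel)
    then have "exp (-\<kappa>) * ((1 - X / \<rho>) * g j) \<le> exp (-\<kappa>) * (exp \<kappa> * g (j - 1))"
      by (intro mult_left_mono) auto
    also have "\<dots> = g (j - 1)" by (simp add: exp_minus)
    finally have main: "exp (-\<kappa>) * ((1 - X / \<rho>) * g j) \<le> g (j - 1)" .
    have "1 - nonlinearity * real J * g j / \<rho> \<le> 1 - nonlinearity * X / \<rho>"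
      using mult_left_mono[OF X, of nonlinearity] nonlinearity_ge_1 \<rho> by (simp add: divide_right_mono mult.assoc)
    also have "\<dots> = 1 - X / \<rho> - 6 * K * exp (2 * K) * X / \<rho>"
      by (simp add: nonlinearity_def algebra_simps add_divide_distrib)
    also have "\<dots> \<le> 1 - X / \<rho> - \<kappa>" using \<kappa>_le by simp
    also have "\<dots> \<le> (1 - \<kappa>) * (1 - X / \<rho>)"
    proof -
      have "1 - y - \<kappa> \<le> (1 - \<kappa>) * (1 - y)" if "0 \<le> y" for y
        using mult_nonneg_nonneg[OF \<kappa>_pos that] by (simp add: algebra_simps)
      from this[of "X / \<rho>"] show ?thesis using X0 \<rho> by simp
    qed
    also have "\<dots> \<le> exp (-\<kappa>) * (1 - X / \<rho>)"
      using exp_ge_add_one_self[of "-\<kappa>"] X\<rho> \<rho> by (intro mult_right_mono) auto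
    finally have "(1 - nonlinearity * real J * g j / \<rho>) * g j \<le> exp (-\<kappa>) * (1 - X / \<rho>) * g j"
      using gj by (intro mult_right_mono) auto
    then show ?thesis using main by (simp add: mult_ac)
  qed
qed

text \<open>Going from the right end to the left, adjacent gaps are comparable as long as they are longer than
  \<open>\<tau>\<close>. The threshold is chosen of order \<open>k\<^sup>-\<^sup>2\<close> such that below it every step shortens the gap at most by
  the factor \<open>1 - 1/(2k)\<close>; at most \<open>k\<close> such steps cost at most the factor \<open>1/2\<close>.\<close>

lemma chain_bound:
  assumes k: "J + 1 \<le> k" and j: "j \<le> J"
  shows "1 / g j \<le> (real k)\<^sup>2 / chain_const * (1 / g 0 + 1 / g J)"
proof -
  define \<rho> where "\<rho> = min (g 0) (g J)"
  have \<rho>: "0 < \<rho>" "\<rho> \<le> g 0" "\<rho> \<le> g J" using g_pos by (auto simp: \<rho>_def)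
  have k1: "1 \<le> real k" "real J \<le> real k" using k by auto
  define \<tau> where "\<tau> = \<rho> / (2 * nonlinearity * (real k)\<^sup>2)"
  have N: "1 \<le> nonlinearity" by (rule nonlinearity_ge_1)
  have k2: "real k \<le> (real k)\<^sup>2" using k1 by (simp add: power2_eq_square)
  have \<tau>0: "0 < \<tau>" using \<rho> N k1 by (simp add: \<tau>_def)
  have k\<tau>: "real k * \<tau> \<le> \<rho> / 2" "nonlinearity * real k * \<tau> / \<rho> = 1 / (2 * real k)"
  proof -
    have eq: "nonlinearity * real k * \<tau> = \<rho> / (2 * real k)"
      using N k1 by (simp add: \<tau>_def power2_eq_square)
    then show "nonlinearity * real k * \<tau> / \<rho> = 1 / (2 * real k)" using \<rho> by simp
    have "real k * \<tau> \<le> nonlinearity * (real k * \<tau>)"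
      using mult_right_mono[OF N, of "real k * \<tau>"] k1 \<tau>0 by simp
    also have "\<dots> = \<rho> / (2 * real k)" using eq by (simp only: mult.assoc)
    also have "\<dots> \<le> \<rho> / 2" using \<rho> k1 by (intro divide_left_mono) auto
    finally show "real k * \<tau> \<le> \<rho> / 2" .
  qed
  have "1 * \<tau> \<le> real k * \<tau>" using k1 \<tau>0 by (intro mult_right_mono) auto
  then have \<tau>\<rho>: "\<tau> < \<rho>" using k\<tau>(1) \<rho> by linarith
  define lam where "lam = 1 - 1 / (2 * real k)"
  have lam: "0 \<le> lam" "lam \<le> 1" using k1 by (simp_all add: lam_def field_simps)
  have st: "0 < spacing * \<tau>" "spacing * \<tau> \<le> \<tau>"
    using spacing_pos spacing_le_1 \<tau>0 by (simp_all add: mult_left_le_one_le)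
  have "spacing * \<tau> * lam ^ n \<le> g (J - n)" if "n \<le> J" for n
    using that
  proof (induction n)
    case 0
    then show ?case using st \<tau>\<rho> \<rho> by simp
  next
    case (Suc n)
    define j where "j = J - n"
    have j: "1 \<le> j" "j \<le> J" "J - Suc n = j - 1" using Suc.prems by (auto simp: j_def)
    have gj: "0 < g j" by (rule g_pos)
    show ?case
    proof (cases "\<tau> \<le> g j")
      case True
      have "spacing * \<tau> * lam ^ Suc n \<le> spacing * \<tau> * 1"
        using st lam by (intro mult_left_mono power_le_one) auto
      also have "\<dots> \<le> spacing * g j" using True spacing_pos by simp
      also have "\<dots> \<le> g (j - 1)"
        using gap_adjacent(2)[of "int i0 * p + int j"] j by (simp add: g_def of_nat_diff algebra_simps)
      finally show ?thesis using j by simp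
    next
      case False
      have le: "real J * g j \<le> real k * \<tau>" using False k1 gj by (intro mult_mono) auto
      have "g j * lam \<le> g j * (1 - nonlinearity * real J * g j / \<rho>)"
      proof (intro mult_left_mono)
        have "nonlinearity * real J * g j / \<rho> \<le> nonlinearity * real k * \<tau> / \<rho>"
          using mult_left_mono[OF le, of nonlinearity] N \<rho> by (simp add: divide_right_mono mult.assoc)
        then show "lam \<le> 1 - nonlinearity * real J * g j / \<rho>" using k\<tau>(2) by (simp add: lam_def)
      qed (use gj in auto)
      also have "\<dots> \<le> g (j - 1)"
        by (rule chain_contract[OF j(1,2) \<rho>]) (use False \<tau>\<rho> le k\<tau>(1) \<rho> in auto)
      finally have "g j * lam \<le> g (j - 1)" .
      moreover have "spacing * \<tau> * lam ^ n * lam \<le> g j * lam"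
        using Suc lam by (intro mult_right_mono) (auto simp: j_def)
      ultimately show ?thesis using j by (simp add: mult_ac)
    qed
  qed
  from this[of "J - j"] j have b: "spacing * \<tau> * lam ^ (J - j) \<le> g j" by simp
  have "1/2 \<le> 1 + real (J - j) * (- (1 / (2 * real k)))"
    using k1 by (simp add: field_simps)
  also have "\<dots> \<le> lam ^ (J - j)"
    using Bernoulli_inequality[of "- (1 / (2 * real k))" "J - j"] k1 by (simp add: lam_def field_simps)
  finally have "spacing * \<tau> * (1/2) \<le> spacing * \<tau> * lam ^ (J - j)" using st by (intro mult_left_mono) auto
  with b have "spacing * \<tau> * (1/2) \<le> g j" by simp
  moreover have "spacing * \<tau> * (1/2) = chain_const * \<rho> / (real k)\<^sup>2"
    by (simp add: \<tau>_def chain_const_def)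
  ultimately have "chain_const * \<rho> / (real k)\<^sup>2 \<le> g j" by (simp only:)
  moreover have pos: "0 < chain_const * \<rho> / (real k)\<^sup>2" using chain_const_pos \<rho> k1 by simp
  ultimately have "1 / g j \<le> 1 / (chain_const * \<rho> / (real k)\<^sup>2)" by (intro frac_le) simp_all
  also have "\<dots> = (real k)\<^sup>2 / chain_const * (1 / \<rho>)" by simp
  also have "\<dots> \<le> (real k)\<^sup>2 / chain_const * (1 / g 0 + 1 / g J)"
    using g_pos[of 0] g_pos[of J] chain_const_pos
    by (intro mult_left_mono) (auto simp: \<rho>_def min_def)
  finally show ?thesis .
qed

end

context critical_cycle
begin

text \<open>The gap at time \<open>x\<close> belongs to the chain that starts at the time in \<open>{1..q'}\<close> congruent to \<open>x\<close> modulo \<open>q'\<close>.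
  The chain that starts at time \<open>i\<close> ends at the point of time \<open>i1 i\<close>, again in \<open>{1..q'}\<close>. So the first
  and the last gap of each chain are comparable with gaps to the left of points with such times, and each of
  these is used once as a first and once as a last gap.\<close>

lemma inv_gap_sum_le:
  assumes q': "0 < q'" "q' \<le> q" and bezout: "int q' * p - p' * int q = 1"
  shows "inv_gap_sum \<le> 2 * (real (q div q' + 1)) ^ 3 / (chain_const * spacing)
     * (\<Sum>i\<in>{1..<Suc q'}. 1 / gap (-1 + int i * p))"
proof -
  define k where "k = q div q' + 1"
  define \<Phi> where "\<Phi> i = 1 / gap (-1 + int i * p)" for i :: nat
  define J where "J i = (q - i) div q'" for i
  \<comment> \<open>The time of the right end point of the chain, reduced modulo \<open>q\<close>.\<close>
  define i1 where "i1 i = i + (J i + 1) * q' - q" for i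
  define B where "B = (real k)\<^sup>2 / (chain_const * spacing)"
  have \<Phi>0: "0 \<le> \<Phi> i" for i using gap_pos by (simp add: \<Phi>_def less_imp_le)
  have B0: "0 \<le> B" using chain_const_pos spacing_pos by (simp add: B_def)
  have Jb: "i + J i * q' \<le> q" "q < i + (J i + 1) * q'" if "i \<in> {1..<Suc q'}" for i
  proof -
    interpret ch: critical_chain f K C u p q e q' p' i
      by unfold_locales (use that q' bezout in auto)
    have "ch.J = J i" by (simp add: J_def ch.J_def)
    then show "i + J i * q' \<le> q" "q < i + (J i + 1) * q'" using ch.J_bounds by simp_all
  qed
  have bound: "1 / gap (int i * p + int j) \<le> B * (\<Phi> i + \<Phi> (i1 i))"
    if i: "i \<in> {1..<Suc q'}" and j: "j \<le> J i" for i j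
  proof -
    interpret ch: critical_chain f K C u p q e q' p' i
      by unfold_locales (use i q' bezout in auto)
    have J: "ch.J = J i" by (simp add: J_def ch.J_def)
    have "J i + 1 \<le> k" unfolding k_def J_def by (simp add: div_le_mono)
    then have "1 / ch.g j \<le> (real k)\<^sup>2 / chain_const * (1 / ch.g 0 + 1 / ch.g (J i))"
      using ch.chain_bound[of k j] j by (simp add: J)
    also have "\<dots> \<le> (real k)\<^sup>2 / chain_const * (1 / spacing * (\<Phi> i + \<Phi> (i1 i)))"
    proof (rule mult_left_mono)
      have "spacing * gap (-1 + int i * p) \<le> ch.g 0"
        using gap_adjacent(1)[of "-1 + int i * p"] by (simp add: ch.g_def)
      then have "1 / ch.g 0 \<le> 1 / (spacing * gap (-1 + int i * p))"
        using gap_pos spacing_pos by (intro divide_left_mono mult_pos_pos ch.g_pos) auto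
      then have 1: "1 / ch.g 0 \<le> 1 / spacing * \<Phi> i" by (simp add: \<Phi>_def)
      have "int (i1 i) = int i + (int (J i) + 1) * int q' - int q"
        using Jb(2)[OF i] unfolding i1_def by (simp add: of_nat_diff algebra_simps)
      then have "-1 + int (i1 i) * p = -1 + (int i + (int (J i) + 1) * int q' - int q) * p"
        by (simp only:)
      also have "\<dots> = -1 + int i * p + (int (J i) + 1) * (int q' * p) - int q * p"
        by (simp add: algebra_simps)
      also have "int q' * p = 1 + p' * int q" using bezout by simp
      also have "-1 + int i * p + (int (J i) + 1) * (1 + p' * int q) - int q * p
         = (int i * p + int (J i)) + int q * ((int (J i) + 1) * p' - p)" by (simp add: algebra_simps)
      finally have "ch.g (J i) = gap (-1 + int (i1 i) * p)"
        by (simp only: ch.g_def gap_add_multiple)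
      then have "1 / ch.g (J i) = 1 * \<Phi> (i1 i)" by (simp add: \<Phi>_def)
      also have "\<dots> \<le> 1 / spacing * \<Phi> (i1 i)"
        using spacing_pos spacing_le_1 \<Phi>0 by (intro mult_right_mono) auto
      finally show "1 / ch.g 0 + 1 / ch.g (J i) \<le> 1 / spacing * (\<Phi> i + \<Phi> (i1 i))"
        using 1 by (simp add: algebra_simps)
    qed (use chain_const_pos in simp)
    finally show ?thesis by (simp add: ch.g_def B_def)
  qed
  let ?A = "{1..<1+q}"
  have "inv_gap_sum = (\<Sum>x\<in>?A. 1 / gap (0 + int x * p))" by (rule sum_inv_gap_orbit[symmetric])
  also have "\<dots> = (\<Sum>r\<in>{..<q'}. \<Sum>x\<in>{x \<in> ?A. (x - 1) mod q' = r}. 1 / gap (0 + int x * p))"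
    by (rule sum.group[symmetric]) (use q' in auto)
  also have "\<dots> \<le> (\<Sum>r\<in>{..<q'}. real k * (B * (\<Phi> (Suc r) + \<Phi> (i1 (Suc r)))))"
  proof (rule sum_mono)
    fix r assume "r \<in> {..<q'}"
    then have i: "Suc r \<in> {1..<Suc q'}" by simp
    have "(\<Sum>x\<in>{x \<in> ?A. (x - 1) mod q' = r}. 1 / gap (0 + int x * p))
      \<le> (\<Sum>x\<in>{x \<in> ?A. (x - 1) mod q' = r}. B * (\<Phi> (Suc r) + \<Phi> (i1 (Suc r))))"
    proof (rule sum_mono)
      fix x assume x: "x \<in> {x \<in> ?A. (x - 1) mod q' = r}"
      define j where "j = (x - 1) div q'"
      have "x - 1 = j * q' + r" using x by (auto simp: j_def)
      then have xe: "x = Suc r + j * q'" using x by auto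
      have "j \<le> J (Suc r)"
        unfolding J_def using x q' xe by (auto simp: less_eq_div_iff_mult_less_eq)
      from bound[OF i this] have "1 / gap (int (Suc r) * p + int j) \<le> B * (\<Phi> (Suc r) + \<Phi> (i1 (Suc r)))" .
      moreover have "int x * p = (int (Suc r) * p + int j) + int q * (int j * p')"
      proof -
        have "int x * p = int (Suc r) * p + int j * (int q' * p)" by (simp add: xe algebra_simps)
        also have "int q' * p = 1 + p' * int q" using bezout by simp
        finally show ?thesis by (simp add: algebra_simps)
      qed
      then have "gap (int x * p) = gap (int (Suc r) * p + int j)" by (simp only: gap_add_multiple)
      ultimately show "1 / gap (0 + int x * p) \<le> B * (\<Phi> (Suc r) + \<Phi> (i1 (Suc r)))" by simp
    qed
    also have "\<dots> = real (card {x \<in> ?A. (x - 1) mod q' = r}) * (B * (\<Phi> (Suc r) + \<Phi> (i1 (Suc r))))"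
      by simp
    also have "\<dots> \<le> real k * (B * (\<Phi> (Suc r) + \<Phi> (i1 (Suc r))))"
    proof (rule mult_right_mono)
      have "card {x \<in> ?A. (x - 1) mod q' = r} \<le> card {..<k}"
      proof (rule card_inj_on_le)
        show "inj_on (\<lambda>x. (x - 1) div q') {x \<in> ?A. (x - 1) mod q' = r}"
        proof (rule inj_onI)
          fix x y assume a: "x \<in> {x \<in> ?A. (x - 1) mod q' = r}" "y \<in> {x \<in> ?A. (x - 1) mod q' = r}"
            "(x - 1) div q' = (y - 1) div q'"
          then have "x - 1 = y - 1" by (metis (mono_tags, lifting) div_mult_mod_eq mem_Collect_eq)
          then show "x = y" using a by auto
        qed
        show "(\<lambda>x. (x - 1) div q') ` {x \<in> ?A. (x - 1) mod q' = r} \<subseteq> {..<k}"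
          by (auto simp: k_def less_Suc_eq_le intro!: div_le_mono)
      qed simp
      then show "real (card {x \<in> ?A. (x - 1) mod q' = r}) \<le> real k" by simp
    qed (use B0 \<Phi>0 in auto)
    finally show "(\<Sum>x\<in>{x \<in> ?A. (x - 1) mod q' = r}. 1 / gap (0 + int x * p)) \<le> real k * (B * (\<Phi> (Suc r) + \<Phi> (i1 (Suc r))))" .
  qed
  also have "\<dots> = real k * B * ((\<Sum>r\<in>{..<q'}. \<Phi> (Suc r)) + (\<Sum>r\<in>{..<q'}. \<Phi> (i1 (Suc r))))"
    by (simp add: sum_distrib_left sum.distrib mult_ac distrib_left)
  also have "(\<Sum>r\<in>{..<q'}. \<Phi> (Suc r)) = (\<Sum>i\<in>{1..<Suc q'}. \<Phi> i)"
    by (simp only: One_nat_def sum.atLeast_Suc_lessThan_Suc_shift comp_def lessThan_atLeast0)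
  also have "(\<Sum>r\<in>{..<q'}. \<Phi> (i1 (Suc r))) = (\<Sum>i\<in>{1..<Suc q'}. \<Phi> (i1 i))"
    by (simp only: One_nat_def sum.atLeast_Suc_lessThan_Suc_shift comp_def lessThan_atLeast0)
  also have "\<dots> = (\<Sum>i\<in>i1 ` {1..<Suc q'}. \<Phi> i)"
  proof (rule sum.reindex[symmetric, unfolded comp_def])
    show "inj_on i1 {1..<Suc q'}"
    proof (rule inj_onI)
      fix a b assume ab: "a \<in> {1..<Suc q'}" "b \<in> {1..<Suc q'}" "i1 a = i1 b"
      then have "a + (J a + 1) * q' = b + (J b + 1) * q'"
        using Jb(2)[of a] Jb(2)[of b] unfolding i1_def by linarith
      moreover have "a = Suc (a - 1)" "b = Suc (b - 1)" using ab by auto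
      ultimately have "(a - 1) + (J a + 1) * q' = (b - 1) + (J b + 1) * q'" by linarith
      then have "((a - 1) + (J a + 1) * q') mod q' = ((b - 1) + (J b + 1) * q') mod q'"
        by (rule arg_cong)
      then have "(a - 1) mod q' = (b - 1) mod q'" by (simp only: mod_mult_self1)
      then show "a = b" using ab by auto
    qed
  qed
  also have "\<dots> \<le> (\<Sum>i\<in>{1..<Suc q'}. \<Phi> i)"
  proof (rule sum_mono2)
    show "i1 ` {1..<Suc q'} \<subseteq> {1..<Suc q'}"
    proof
      fix y assume "y \<in> i1 ` {1..<Suc q'}"
      then obtain a where a: "a \<in> {1..<Suc q'}" "y = i1 a" by auto
      have "(J a + 1) * q' = J a * q' + q'" by simp
      then have "1 \<le> i1 a" "i1 a < Suc q'" using Jb[OF a(1)] unfolding i1_def by linarith+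
      then show "y \<in> {1..<Suc q'}" using a(2) by simp
    qed
  qed (use \<Phi>0 in auto)
  finally have "inv_gap_sum \<le> real k * B * ((\<Sum>i\<in>{1..<Suc q'}. \<Phi> i) + (\<Sum>i\<in>{1..<Suc q'}. \<Phi> i))"
    using B0 by (simp add: mult_left_mono)
  also have "\<dots> = 2 * (real k) ^ 3 / (chain_const * spacing) * (\<Sum>i\<in>{1..<Suc q'}. \<Phi> i)"
    by (simp add: B_def power2_eq_square power3_eq_cube)
  finally show ?thesis by (simp add: k_def \<Phi>_def)
qed

lemma parameter_gap:
  assumes q': "0 < q'" "q' \<le> q" and bezout: "int q' * p - p' * int q = 1" and D: "0 \<le> D"
    and hit: "((\<lambda>x. f x + (u - D)) ^^ q') 0 = of_int p'"
  shows "D * inv_gap_sum \<le> step_const * (real (q div q' + 1)) ^ 3"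
proof -
  let ?S = "\<Sum>i\<in>{1..<Suc q'}. 1 / gap (-1 + int i * p)" and ?k = "real (q div q' + 1)"
  have "D * inv_gap_sum \<le> D * (2 * ?k ^ 3 / (chain_const * spacing) * ?S)"
    by (rule mult_left_mono[OF inv_gap_sum_le[OF q' bezout] D])
  also have "\<dots> = 2 * ?k ^ 3 / (chain_const * spacing) * (D * ?S)" by simp
  also have "\<dots> \<le> 2 * ?k ^ 3 / (chain_const * spacing) * (2 * distortion / spacing)"
    using push[OF q'(2) bezout D hit] chain_const_pos spacing_pos by (intro mult_left_mono) auto
  finally show ?thesis by (simp add: step_const_def mult_ac)
qed

end

section \<open>Polynomial lower bounds for tongues\<close>

lemma small_bezout:
  fixes p :: int and q :: nat
  assumes "0 < q" "coprime p (int q)"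
  shows "\<exists>q' p'. 0 < q' \<and> q' \<le> q \<and> int q' * p - p' * int q = 1"
proof -
  obtain a b where ab: "a * p + b * int q = 1"
    using bezout_int[of p "int q"] assms(2) by auto
  define r where "r = (a - 1) mod int q + 1"
  have "0 \<le> (a - 1) mod int q" "(a - 1) mod int q < int q" using assms(1) by simp_all
  then have r: "1 \<le> r" "r \<le> int q" by (auto simp: r_def)
  have "a = int q * ((a - 1) div int q) + r" by (simp add: r_def)
  then have "(int q * ((a - 1) div int q) + r) * p + b * int q = 1" using ab by simp
  then have "int (nat r) * p - (- b - (a - 1) div int q * p) * int q = 1"
    using r by (simp add: algebra_simps)
  then show ?thesis using r by (intro exI[of _ "nat r"] exI[of _ "- b - (a - 1) div int q * p"]) auto
qed

context critical_lift
begin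

text \<open>Reflection exchanges the two flatness conditions and reverses the order of four points.\<close>

lemma reflect: "critical_lift (\<lambda>x. - f (- x)) K C"
proof
  show "- f (- x) < - f (- y)" if "x < y" for x y using strict[of "- y" "- x"] that by simp
  show "isCont (\<lambda>x. - f (- x)) x" for x
    by (intro continuous_intros isCont_o2[OF _ cont])
  show "- f (- (x + 1)) = - f (- x) + 1" for x using shift[of "- x - 1"] by simp
  show "(- f (- c) - - f (- a)) * (- f (- d) - - f (- b)) * ((c - b) * (d - a))
    \<le> exp (K * ((b - a) * (d - c))) * ((c - a) * (d - b) * ((- f (- c) - - f (- b)) * (- f (- d) - - f (- a))))"
    if "a < b" "b < c" "c < d" "{a<..<d} \<inter> \<int> = {}" for a b c d
  proof -
    have "{- d<..<- a} \<inter> \<int> = {}"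
    proof (rule ccontr)
      assume "\<not> ?thesis"
      then obtain x where "- d < x" "x < - a" "x \<in> \<int>" by auto
      then have "- x \<in> {a<..<d} \<inter> \<int>" by auto
      then show False using that by blast
    qed
    then show ?thesis using smooth[of "- d" "- c" "- b" "- a"] that by (simp add: mult_ac)
  qed
  show "cr (- f (- a)) (- f (- b)) (- f (- c)) (- f (- d)) \<le> C * cr a b c d"
    if "a \<le> b" "b \<le> c" "c \<le> d" "a < c" "b < d" "d - a \<le> 3" for a b c d
  proof -
    have r: "cr (- d) (- c) (- b) (- a) = cr a b c d" for a b c d
      by (simp add: cr_def mult_ac)
    show ?thesis using rough[of "- d" "- c" "- b" "- a"] that r[of "- f (- d)" "- f (- c)" "- f (- b)" "- f (- a)"]
      by (simp add: r)
  qed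
qed (use f_zero K_nonneg C_ge_1 flat_left flat_right in auto)

lemma shift_int: "f (x + of_int n) = f x + of_int n"
  by (rule lift_shift_int) (rule shift)

abbreviation it :: "real \<Rightarrow> nat \<Rightarrow> real \<Rightarrow> real" where
  "it t n \<equiv> (\<lambda>x. f x + t) ^^ n"

lemma it_strict: "x < y \<Longrightarrow> it t n x < it t n y"
  by (induction n) (auto intro: strict)

lemma it_mono: "x \<le> y \<Longrightarrow> it t n x \<le> it t n y"
  using it_strict[of x y] by (cases "x = y") (auto simp: less_imp_le)

lemma it_shift: "it t n (x + of_int m) = it t n x + of_int m"
  by (induction n) (auto simp: shift_int)

lemma it_mono_t: "s \<le> t \<Longrightarrow> it s n x \<le> it t n x"
  by (induction n) (auto intro!: add_mono mono_le)

lemma it_cont: "isCont (\<lambda>t. it t n x) t"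
  by (induction n) (auto intro!: continuous_intros isCont_o2[OF _ cont])

lemma it_int: "it (of_int m) n 0 = of_int (int n * m)"
proof (induction n)
  case (Suc n)
  have "f (of_int (int n * m)) = of_int (int n * m)"
    using shift_int[of 0 "int n * m"] f_zero by simp
  then show ?case using Suc by (simp add: algebra_simps)
qed simp

lemma it_add: "it t (m + n) x = it t m (it t n x)"
  by (simp add: funpow_add)

lemma it_mult_le: "it t n x \<le> x + of_int m \<Longrightarrow> it t (k * n) x \<le> x + of_int (int k * m)"
proof (induction k)
  case (Suc k)
  have "it t (Suc k * n) x = it t n (it t (k * n) x)" by (simp add: it_add)
  also have "\<dots> \<le> it t n (x + of_int (int k * m))" using Suc by (intro it_mono) auto
  also have "\<dots> = it t n x + of_int (int k * m)" by (rule it_shift)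
  also have "\<dots> \<le> x + of_int m + of_int (int k * m)" using Suc by simp
  finally show ?case by (simp add: algebra_simps)
qed simp

lemma it_mult_ge: "x + of_int m \<le> it t n x \<Longrightarrow> x + of_int (int k * m) \<le> it t (k * n) x"
proof (induction k)
  case (Suc k)
  have "x + of_int (int (Suc k) * m) = x + of_int m + of_int (int k * m)" by (simp add: algebra_simps)
  also have "\<dots> \<le> it t n x + of_int (int k * m)" using Suc by simp
  also have "\<dots> = it t n (x + of_int (int k * m))" by (rule it_shift[symmetric])
  also have "\<dots> \<le> it t n (it t (k * n) x)" using Suc by (intro it_mono) auto
  finally show ?case by (simp add: it_add)
qed simp

lemma it_mult_eq: "it t n 0 = of_int m \<Longrightarrow> it t (k * n) 0 = of_int (int k * m)"
  using it_mult_le[where t = t and n = n and x = 0 and m = m and k = k]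
    it_mult_ge[where t = t and n = n and x = 0 and m = m and k = k] by simp

lemma superstable_parameter:
  assumes "0 < n"
  shows "\<exists>t. it t n 0 = of_int m"
proof -
  have "int n * - \<bar>m\<bar> \<le> m" "m \<le> int n * \<bar>m\<bar>"
  proof -
    have "1 * \<bar>m\<bar> \<le> int n * \<bar>m\<bar>" using assms by (intro mult_right_mono) auto
    then show "int n * - \<bar>m\<bar> \<le> m" "m \<le> int n * \<bar>m\<bar>" by auto
  qed
  then have "it (of_int (- \<bar>m\<bar>)) n 0 \<le> of_int m" "of_int m \<le> it (of_int \<bar>m\<bar>) n 0"
    unfolding it_int by (simp_all only: of_int_le_iff)
  from IVT[where f = "\<lambda>t. it t n 0", OF this] show ?thesis using it_cont by auto
qed

text \<open>Otherwise the mean displacement per step would be at most \<open>m' / n'\<close>, which is smaller than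
  the value \<open>m / n\<close> attained by the orbit of \<open>0\<close>.\<close>

lemma no_other_rotation:
  assumes "it t n 0 = of_int m" "int n' * m - m' * int n = 1"
  shows "x + of_int m' < it t n' x"
proof (rule ccontr)
  assume "\<not> x + of_int m' < it t n' x"
  then have le: "it t n' x \<le> x + of_int m'" by simp
  define j where "j = \<lceil>- x\<rceil>"
  have j: "0 \<le> x + of_int j" unfolding j_def using le_of_int_ceiling[of "- x"] by linarith
  have "real k \<le> x + of_int j" for k
  proof -
    have "of_int (int (k * n') * m) = it t (k * n' * n) 0" using it_mult_eq[OF assms(1)] by simp
    also have "\<dots> \<le> it t (k * n' * n) (x + of_int j)" by (rule it_mono[OF j])
    also have "\<dots> = it t ((k * n) * n') x + of_int j" by (simp add: it_shift mult_ac)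
    also have "\<dots> \<le> x + of_int (int (k * n) * m') + of_int j" using it_mult_le[OF le, of "k * n"] by simp
    finally have "of_int (int k * (int n' * m - m' * int n)) \<le> x + of_int j"
      by (simp add: algebra_simps)
    then show ?thesis by (simp only: assms(2))
  qed
  then show False using reals_Archimedean2 by (meson linorder_not_le)
qed

text \<open>The point with index \<open>i p + j q\<close> is the \<open>i\<close>-th image of \<open>0\<close> translated by \<open>j\<close>. For the order,
  let \<open>q' p - p' q = 1\<close>: the successor of a point is its \<open>q'\<close>-th image translated by \<open>-p'\<close>, and this is to the
  right of it by \<open>no_other_rotation\<close>.\<close>

lemma cycle_exists:
  assumes q: "0 < q" "coprime p (int q)" and hit: "it u q 0 = of_int p"
  shows "\<exists>e. critical_cycle f K C u p q e"
proof -
  obtain q' p' where bz: "0 < q'" "int q' * p - p' * int q = 1" using small_bezout[OF q] by blast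
  have unique': "it u i 0 + of_int j = it u i' 0 + of_int j'"
    if eq: "int i * p + j * int q = int i' * p + j' * int q" and "i' \<le> i" for i i' :: nat and j j' :: int
  proof -
    have "(int i - int i') * p = (j' - j) * int q" using eq by (simp add: algebra_simps)
    then have "int q dvd (int i - int i') * p" by simp
    then have "int q dvd int i - int i'" using q by (simp add: coprime_commute coprime_dvd_mult_left_iff)
    then have "q dvd i - i'" using \<open>i' \<le> i\<close> by (metis int_dvd_int_iff of_nat_diff)
    then obtain r where r: "i = i' + r * q" using \<open>i' \<le> i\<close> by (metis dvd_def le_add_diff_inverse mult.commute)
    have "int q * (int r * p) = int q * (j' - j)" using eq by (simp add: r algebra_simps)
    then have j: "j' = j + int r * p" using q by simp
    have "it u i 0 = it u i' (it u (r * q) 0)" by (simp add: r it_add)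
    also have "\<dots> = it u i' (0 + of_int (int r * p))" using it_mult_eq[OF hit, of r] by simp
    also have "\<dots> = it u i' 0 + of_int (int r * p)" by (rule it_shift)
    finally show ?thesis by (simp add: j)
  qed
  have unique: "it u i 0 + of_int j = it u i' 0 + of_int j'"
    if "int i * p + j * int q = int i' * p + j' * int q" for i i' :: nat and j j' :: int
    using unique'[of i j i' j'] unique'[of i' j' i j] that by (cases "i' \<le> i") auto
  define e where "e m = (SOME y. \<exists>i j. m = int i * p + j * int q \<and> y = it u i 0 + of_int j)" for m
  have e: "e (int i * p + j * int q) = it u i 0 + of_int j" for i j
  proof -
    have "\<exists>i' j'. int i * p + j * int q = int i' * p + j' * int q \<and> e (int i * p + j * int q) = it u i' 0 + of_int j'"
      unfolding e_def by (rule someI_ex) blast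
    then show ?thesis using unique by metis
  qed
  have rep: "\<exists>i j. m = int i * p + j * int q" for m
  proof -
    define i where "i = nat ((m * int q') mod int q)"
    have "int i = (m * int q') mod int q" using q by (simp add: i_def)
    then have i: "m * int q' = int q * ((m * int q') div int q) + int i" by simp
    have "m = m * (int q' * p - p' * int q)" by (simp only: bz(2) mult_1_right)
    also have "\<dots> = (m * int q') * p - m * p' * int q" by (simp add: algebra_simps)
    also have "\<dots> = int i * p + ((m * int q') div int q * p - m * p') * int q"
      by (subst i) (simp add: algebra_simps)
    finally show ?thesis by blast
  qed
  have "critical_cycle f K C u p q e"
  proof
    show "0 < q" "coprime p (int q)" using q by auto
    show "e 0 = 0" using e[of 0 0] by simp
    show "e (m + int q) = e m + 1" for m
    proof -
      obtain i j where m: "m = int i * p + j * int q" using rep by blast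
      have "m + int q = int i * p + (j + 1) * int q" by (simp add: m algebra_simps)
      then show ?thesis by (simp only: e m)
    qed
    show "f (e m) + u = e (m + p)" for m
    proof -
      obtain i j where m: "m = int i * p + j * int q" using rep by blast
      have "m + p = int (Suc i) * p + j * int q" by (simp add: m algebra_simps)
      then have "e (m + p) = it u (Suc i) 0 + of_int j" by (simp only: e)
      then show ?thesis by (simp add: m e shift_int)
    qed
    show "e m < e (m + 1)" for m
    proof -
      obtain i j where m: "m = int i * p + j * int q" using rep by blast
      have "m + 1 = int (i + q') * p + (j - p') * int q" using bz by (simp add: m algebra_simps)
      then have "e (m + 1) = it u (i + q') 0 + of_int (j - p')" by (simp only: e)
      also have "\<dots> = it u i (it u q' 0) + of_int (j - p')" by (simp add: it_add)
      also have "\<dots> > it u i (0 + of_int p') + of_int (j - p')"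
        using it_strict[OF no_other_rotation[OF hit bz(2), of 0]] by simp
      finally show ?thesis by (simp only: it_shift m e)
    qed
  qed
  then show ?thesis by blast
qed

end

context critical_cycle
begin

lemma reflect_cycle: "critical_cycle (\<lambda>x. - f (- x)) K C (- u) (- p) q (\<lambda>m. - e (- m))"
proof -
  interpret r: critical_lift "\<lambda>x. - f (- x)" K C by (rule reflect)
  show ?thesis
  proof
    show "0 < q" "coprime (- p) (int q)" using q_pos p_q_coprime by auto
    show "- e (- 0) = 0" using e_zero by simp
    show "- e (- m) < - e (- (m + 1))" for m by simp
    show "- e (- (m + int q)) = - e (- m) + 1" for m using e_period[of "- m - int q"] by simp
    show "- f (- (- e (- m))) + (- u) = - e (- (m + (- p)))" for m using e_step[of "- m"] by (simp add: algebra_simps)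
  qed
qed

lemma inv_gap_sum_reflect: "critical_cycle.inv_gap_sum q (\<lambda>m. - e (- m)) = inv_gap_sum"
proof -
  interpret r: critical_cycle "\<lambda>x. - f (- x)" K C "- u" "- p" q "\<lambda>m. - e (- m)" by (rule reflect_cycle)
  have g: "r.gap m = gap (int q - 1 - m)" for m
  proof -
    have "- (m + 1) = - m - 1" "- m - 1 + 1 = - m" by simp_all
    then have "r.gap m = gap (- m - 1)" by (simp only: r.gap_def gap_def)
    also have "\<dots> = gap (- m - 1 + int q * 1)" by (rule gap_add_multiple[symmetric])
    also have "- m - 1 + int q * 1 = int q - 1 - m" by simp
    finally show ?thesis .
  qed
  show ?thesis unfolding r.inv_gap_sum_def inv_gap_sum_def
    by (rule sum.reindex_bij_witness[of _ "\<lambda>m. int q - 1 - m" "\<lambda>m. int q - 1 - m"]) (auto simp: g)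
qed

text \<open>At the superstable parameter \<open>u\<close> of \<open>p/q\<close> all points move by more than \<open>p'\<close> in \<open>q'\<close> steps. So \<open>u\<close>
  exceeds every parameter in the tongue of \<open>p'/q'\<close>, and \<open>u - u'\<close> is at least the width of
  that tongue to the right of \<open>u'\<close>.\<close>

lemma inv_gap_sum_le_of_parent:
  assumes q': "0 < q'" "q' \<le> q" and bezout: "int q' * p - p' * int q = 1" and w: "0 \<le> w"
    and parent: "\<And>u'. it u' q' 0 = of_int p' \<Longrightarrow> \<exists>x. it (u' + w) q' x \<le> x + of_int p'"
  shows "w * inv_gap_sum \<le> step_const * (real (q div q' + 1)) ^ 3"
proof -
  have hit: "it u q 0 = of_int p"
  proof -
    have "it u i 0 = e (int i * p)" for i
    proof (induction i)
      case (Suc i)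
      then show ?case using e_step[of "int i * p"] by (simp add: algebra_simps)
    qed (use e_zero in simp)
    then show ?thesis using e_multiple[of p] by simp
  qed
  obtain u' where u': "it u' q' 0 = of_int p'" using superstable_parameter q' by blast
  obtain x where x: "it (u' + w) q' x \<le> x + of_int p'" using parent[OF u'] by blast
  have "x + of_int p' < it u q' x" by (rule no_other_rotation[OF hit bezout])
  then have "u' + w < u" using x it_mono_t[of u "u' + w" q' x] by linarith
  then have D: "w \<le> u - u'" by simp
  have S: "0 \<le> inv_gap_sum"
    unfolding inv_gap_sum_def using gap_pos by (intro sum_nonneg) (auto simp: less_imp_le)
  have "w * inv_gap_sum \<le> (u - u') * inv_gap_sum" using D S by (intro mult_right_mono) auto
  also have "\<dots> \<le> step_const * (real (q div q' + 1)) ^ 3"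
    by (rule parameter_gap[OF q' bezout]) (use D w u' in auto)
  finally show ?thesis .
qed

end

text \<open>The denominators of the two Farey parents of \<open>p/q\<close> add up to \<open>q\<close>, so one of them is at most \<open>q/2\<close>. The
  alternative tells on which side of \<open>p/q\<close> the corresponding fraction \<open>p'/q'\<close> lies; the form of the second case is
  that of the first one after reflection.\<close>

lemma half_bezout:
  fixes p :: int and q :: nat
  assumes "2 \<le> q" "coprime p (int q)"
  shows "\<exists>q' p'. 0 < q' \<and> 2 * q' \<le> q \<and> (int q' * p - p' * int q = 1 \<or> int q' * (- p) - (- p') * int q = 1)"
proof -
  obtain r s where r: "0 < r" "r \<le> q" "int r * p - s * int q = 1" using small_bezout[of q p] assms by auto
  have "r \<noteq> q"
  proof
    assume "r = q"
    then have "int q * (p - s) = 1" using r(3) by (simp add: algebra_simps)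
    then show False using assms(1) by (auto dest: zmult_eq_1_iff[THEN iffD1])
  qed
  show ?thesis
  proof (cases "2 * r \<le> q")
    case True
    then show ?thesis using r by blast
  next
    case False
    have "int (q - r) * (- p) - (- (p - s)) * int q = 1" using r by (simp add: of_nat_diff algebra_simps)
    then show ?thesis using False r \<open>r \<noteq> q\<close> by (intro exI[of _ "q - r"] exI[of _ "p - s"]) auto
  qed
qed

lemma coprime_of_bezout:
  fixes p p' :: int assumes "int q' * p - p' * int q = 1" shows "coprime p' (int q')"
proof (rule coprimeI)
  fix c assume "c dvd p'" "c dvd int q'"
  then have "c dvd int q' * p - p' * int q" by (intro dvd_diff) auto
  then show "is_unit c" using assms by simp
qed

text \<open>With \<open>y = q / q'\<close> the passage from \<open>p'/q'\<close> to \<open>p/q\<close> costs a factor of order \<open>y\<^sup>3\<close>, whereas the claimed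
  bound decreases by \<open>y\<close> to the power \<open>m + 3\<close>. Since \<open>y \<ge> 2\<close>, the remaining power \<open>y\<^sup>m\<close> absorbs the
  constants. The claim is made for all maps with the same constants, because a parent on the right-hand side is
  treated by reflection.\<close>

lemma (in critical_lift) tongue_width:
  fixes m :: nat
  assumes m: "8 * step_const \<le> trap_width * 2 ^ m"
    and g: "critical_lift g K C" and q: "0 < q" "coprime p (int q)"
    and hit: "((\<lambda>x. g x + u) ^^ q) 0 = of_int p"
  shows "\<exists>x. ((\<lambda>x. g x + (u + trap_width / real q ^ (m + 3))) ^^ q) x \<le> x + of_int p"
  using g q hit
proof (induction q arbitrary: g p u rule: less_induct)
  case (less q)
  interpret G: critical_lift g K C by (rule less.prems)
  obtain e where "critical_cycle g K C u p q e" using G.cycle_exists less.prems by blast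
  then interpret cy: critical_cycle g K C u p q e .
  have tw: "0 < trap_width" by (rule trap_width_pos)
  have "trap_width / real q ^ (m + 3) * cy.inv_gap_sum \<le> trap_width"
  proof (cases "q = 1")
    case True
    have "cy.gap 0 = 1" using cy.e_period[of 0] True by (simp add: cy.gap_def)
    moreover have "{0..<int q} = {0}" using True by auto
    ultimately have "cy.inv_gap_sum = 1" by (simp add: cy.inv_gap_sum_def)
    then show ?thesis by (simp add: True)
  next
    case False
    then have "2 \<le> q" using less.prems by simp
    from half_bezout[OF this less.prems(3)] obtain q' p' where q': "0 < q'" "2 * q' \<le> q"
      and bz: "int q' * p - p' * int q = 1 \<or> int q' * (- p) - (- p') * int q = 1" by blast
    define w where "w = trap_width / real q' ^ (m + 3)"
    have w: "0 < w" using tw q' by (simp add: w_def)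
    have "q' < q" "q' \<le> q" using q' by auto
    have bound: "w * cy.inv_gap_sum \<le> step_const * (real (q div q' + 1)) ^ 3"
      using bz
    proof
      assume b: "int q' * p - p' * int q = 1"
      show ?thesis
      proof (rule cy.inv_gap_sum_le_of_parent[OF q'(1) \<open>q' \<le> q\<close> b])
        fix u' assume "((\<lambda>x. g x + u') ^^ q') 0 = of_int p'"
        then show "\<exists>x. ((\<lambda>x. g x + (u' + w)) ^^ q') x \<le> x + of_int p'"
          unfolding w_def by (intro less.IH[OF \<open>q' < q\<close> less.prems(1) q'(1) coprime_of_bezout[OF b]])
      qed (use w in simp)
    next
      assume b: "int q' * (- p) - (- p') * int q = 1"
      interpret r: critical_cycle "\<lambda>x. - g (- x)" K C "- u" "- p" q "\<lambda>m. - e (- m)" by (rule cy.reflect_cycle)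
      have "w * r.inv_gap_sum \<le> step_const * (real (q div q' + 1)) ^ 3"
      proof (rule r.inv_gap_sum_le_of_parent[OF q'(1) \<open>q' \<le> q\<close> b])
        fix u' assume "((\<lambda>x. - g (- x) + u') ^^ q') 0 = of_int (- p')"
        then show "\<exists>x. ((\<lambda>x. - g (- x) + (u' + w)) ^^ q') x \<le> x + of_int (- p')"
          unfolding w_def by (intro less.IH[OF \<open>q' < q\<close> G.reflect q'(1) coprime_of_bezout[OF b]])
      qed (use w in simp)
      then show ?thesis by (simp only: cy.inv_gap_sum_reflect)
    qed
    define y where "y = real q / real q'"
    have y: "2 \<le> y" using q' by (simp add: y_def field_simps)
    have qd: "real q' * real (q div q') \<le> real q" by (metis of_nat_le_iff of_nat_mult times_div_less_eq_dividend)
    then have "real (q div q' + 1) \<le> 2 * y" using y q' by (simp add: y_def field_simps)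
    then have "(real (q div q' + 1)) ^ 3 \<le> (2 * y) ^ 3" by (intro power_mono) auto
    then have k: "(real (q div q' + 1)) ^ 3 \<le> 8 * y ^ 3" by (simp add: power_mult_distrib)
    have yq: "real q ^ (m + 3) = y ^ (m + 3) * real q' ^ (m + 3)" using q' by (simp add: y_def power_divide)
    have "trap_width / real q ^ (m + 3) * cy.inv_gap_sum = (w * cy.inv_gap_sum) / y ^ (m + 3)"
      by (simp add: w_def yq)
    also have "\<dots> \<le> (step_const * (8 * y ^ 3)) / y ^ (m + 3)"
      using order_trans[OF bound mult_left_mono[OF k less_imp_le[OF step_const_pos]]] y
      by (intro divide_right_mono) auto
    also have "\<dots> = 8 * step_const / y ^ m" using y by (simp add: power_add)
    also have "\<dots> \<le> 8 * step_const / 2 ^ m"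
      using y step_const_pos by (intro divide_left_mono power_mono) auto
    also have "\<dots> \<le> trap_width" using m by (simp add: divide_le_eq)
    finally show ?thesis .
  qed
  from cy.trap[OF _ this] tw show ?case by simp
qed

section \<open>Rotation numbers\<close>

text \<open>The displacement of a point under iterates is additive up to bounded errors, which yields the existence of the
  limit for every monotone lift of degree one.\<close>

locale circle_lift =
  fixes h :: "real \<Rightarrow> real"
  assumes h_mono: "x \<le> y \<Longrightarrow> h x \<le> h y" and h_shift: "h (x + 1) = h x + 1"
begin

lemma pow_mono: "x \<le> y \<Longrightarrow> (h ^^ n) x \<le> (h ^^ n) y"
  by (induction n) (auto intro: h_mono)

lemma pow_shift: "(h ^^ n) (x + of_int m) = (h ^^ n) x + of_int m"
proof (induction n)
  case (Suc n)
  have "h (y + of_int m) = h y + of_int m" for y by (rule lift_shift_int) (rule h_shift)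
  then show ?case using Suc by simp
qed simp

lemma displacement: "\<bar>((h ^^ n) x - x) - (h ^^ n) 0\<bar> \<le> 1"
proof -
  have "(h ^^ n) (0 + of_int \<lfloor>x\<rfloor>) \<le> (h ^^ n) x" "(h ^^ n) x \<le> (h ^^ n) (0 + of_int (\<lfloor>x\<rfloor> + 1))"
    by (intro pow_mono; linarith)+
  then have "(h ^^ n) 0 + of_int \<lfloor>x\<rfloor> \<le> (h ^^ n) x" "(h ^^ n) x \<le> (h ^^ n) 0 + of_int (\<lfloor>x\<rfloor> + 1)"
    by (simp_all only: pow_shift)
  then show ?thesis by linarith
qed

lemma multiple_displacement: "\<bar>(h ^^ (m * n)) 0 - real m * (h ^^ n) 0\<bar> \<le> real m"
proof (induction m)
  case (Suc m)
  have "(h ^^ (Suc m * n)) 0 = (h ^^ n) ((h ^^ (m * n)) 0)" by (simp add: funpow_add)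
  then have "\<bar>(h ^^ (Suc m * n)) 0 - (h ^^ (m * n)) 0 - (h ^^ n) 0\<bar> \<le> 1"
    using displacement[of n "(h ^^ (m * n)) 0"] by simp
  then show ?case using Suc by (simp add: algebra_simps)
qed simp

lemma mean_displacement_close:
  assumes "0 < m" "0 < n"
  shows "\<bar>(h ^^ m) 0 / real m - (h ^^ n) 0 / real n\<bar> \<le> 1 / real m + 1 / real n"
proof -
  have *: "\<bar>(h ^^ (m * n)) 0 / real (m * n) - (h ^^ n) 0 / real n\<bar> \<le> 1 / real n"
    if "0 < m" "0 < n" for m n
  proof -
    have "(h ^^ (m * n)) 0 / real (m * n) - (h ^^ n) 0 / real n
       = ((h ^^ (m * n)) 0 - real m * (h ^^ n) 0) / real (m * n)"
      using that by (simp add: field_simps)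
    also have "\<bar>\<dots>\<bar> \<le> real m / real (m * n)"
      unfolding abs_divide abs_of_nat by (rule divide_right_mono[OF multiple_displacement]) simp
    finally show ?thesis using that by simp
  qed
  show ?thesis using *[OF assms] *[OF assms(2,1)] by (simp only: mult.commute[of n m])
qed

lemma rotation_number_exists: "\<exists>r. \<forall>x. (\<lambda>n. (h ^^ n) x / real n) \<longlonglongrightarrow> r"
proof -
  have "Cauchy (\<lambda>n. (h ^^ n) 0 / real n)"
  proof (rule CauchyI)
    fix \<epsilon> :: real assume "0 < \<epsilon>"
    then obtain M where M: "0 < M" "1 / real M < \<epsilon> / 2"
      using real_arch_inverse[of "\<epsilon> / 2"] by (auto simp: inverse_eq_divide)
    show "\<exists>M. \<forall>m\<ge>M. \<forall>n\<ge>M. norm ((h ^^ m) 0 / real m - (h ^^ n) 0 / real n) < \<epsilon>"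
    proof (intro exI[of _ M] allI impI)
      fix m n assume mn: "M \<le> m" "M \<le> n"
      have "1 / real m \<le> 1 / real M" "1 / real n \<le> 1 / real M"
        using M mn by (auto intro!: divide_left_mono)
      then show "norm ((h ^^ m) 0 / real m - (h ^^ n) 0 / real n) < \<epsilon>"
        using mean_displacement_close[of m n] M mn by simp
    qed
  qed
  then obtain r where r: "(\<lambda>n. (h ^^ n) 0 / real n) \<longlonglongrightarrow> r"
    using real_Cauchy_convergent convergent_def by blast
  have "(\<lambda>n. (h ^^ n) x / real n) \<longlonglongrightarrow> r" for x
  proof -
    have "(\<lambda>n. (h ^^ n) x / real n - (h ^^ n) 0 / real n) \<longlonglongrightarrow> 0"
    proof (rule Lim_null_comparison)
      show "\<forall>\<^sub>F n in sequentially. norm ((h ^^ n) x / real n - (h ^^ n) 0 / real n) \<le> (1 + \<bar>x\<bar>) / real n"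
      proof (intro always_eventually allI)
        fix n
        have "\<bar>(h ^^ n) x - (h ^^ n) 0\<bar> \<le> 1 + \<bar>x\<bar>" using displacement[of n x] by linarith
        then show "norm ((h ^^ n) x / real n - (h ^^ n) 0 / real n) \<le> (1 + \<bar>x\<bar>) / real n"
          by (simp add: diff_divide_distrib[symmetric] divide_right_mono)
      qed
      show "(\<lambda>n. (1 + \<bar>x\<bar>) / real n) \<longlonglongrightarrow> 0" by (rule lim_const_over_n)
    qed
    from tendsto_add[OF this r] show ?thesis by simp
  qed
  then show ?thesis by blast
qed

lemma rotation_number_limit: "(\<lambda>n. (h ^^ n) x / real n) \<longlonglongrightarrow> rotation_number h"
proof -
  obtain r where r: "\<forall>x. (\<lambda>n. (h ^^ n) x / real n) \<longlonglongrightarrow> r" using rotation_number_exists by blast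
  have "rotation_number h = r"
    unfolding rotation_number_def
    using r by (intro the_equality) (auto intro: LIMSEQ_unique)
  then show ?thesis using r by simp
qed

lemma pow_multiple: "(h ^^ (Suc k * q)) x = (h ^^ q) ((h ^^ (k * q)) x)"
  by (simp add: funpow_add)

lemma rotation_number_along_multiples:
  assumes "0 < q"
  shows "(\<lambda>k. (h ^^ (k * q)) x / real (k * q)) \<longlonglongrightarrow> rotation_number h"
    and "(\<lambda>k. x / real (k * q) + of_int p / real q) \<longlonglongrightarrow> of_int p / real q"
proof -
  have "strict_mono (\<lambda>k. k * q)" using assms by (simp add: strict_mono_def)
  from LIMSEQ_subseq_LIMSEQ[OF rotation_number_limit this]
  show "(\<lambda>k. (h ^^ (k * q)) x / real (k * q)) \<longlonglongrightarrow> rotation_number h" by (simp add: comp_def)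
  have "(\<lambda>k. (x / real q) / real k + of_int p / real q) \<longlonglongrightarrow> 0 + of_int p / real q"
    by (intro tendsto_add lim_const_over_n tendsto_const)
  then show "(\<lambda>k. x / real (k * q) + of_int p / real q) \<longlonglongrightarrow> of_int p / real q" by (simp add: mult.commute)
qed

lemma rotation_number_le:
  assumes q: "0 < q" and le: "(h ^^ q) x \<le> x + of_int p"
  shows "rotation_number h \<le> of_int p / real q"
proof (rule LIMSEQ_le[OF rotation_number_along_multiples(1)[OF q, of x] rotation_number_along_multiples(2)[OF q, of x p]])
  have "(h ^^ (k * q)) x \<le> x + of_int (int k * p)" for k
  proof (induction k)
    case (Suc k)
    have "(h ^^ (Suc k * q)) x \<le> (h ^^ q) (x + of_int (int k * p))"
      unfolding pow_multiple by (rule pow_mono[OF Suc])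
    also have "\<dots> \<le> x + of_int (int (Suc k) * p)" using le by (simp only: pow_shift) (simp add: algebra_simps)
    finally show ?case .
  qed simp
  then have "(h ^^ (k * q)) x / real (k * q) \<le> x / real (k * q) + of_int p / real q" if "1 \<le> k" for k
    using that q divide_right_mono[of "(h ^^ (k * q)) x" "x + of_int (int k * p)" "real (k * q)"]
    by (simp add: add_divide_distrib)
  then show "\<exists>N. \<forall>n\<ge>N. (h ^^ (n * q)) x / real (n * q) \<le> x / real (n * q) + of_int p / real q" by blast
qed

lemma rotation_number_ge:
  assumes q: "0 < q" and le: "x + of_int p \<le> (h ^^ q) x"
  shows "of_int p / real q \<le> rotation_number h"
proof (rule LIMSEQ_le[OF rotation_number_along_multiples(2)[OF q, of x p] rotation_number_along_multiples(1)[OF q, of x]])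
  have "x + of_int (int k * p) \<le> (h ^^ (k * q)) x" for k
  proof (induction k)
    case (Suc k)
    have "x + of_int (int (Suc k) * p) \<le> (h ^^ q) (x + of_int (int k * p))"
      using le by (simp only: pow_shift) (simp add: algebra_simps)
    also have "\<dots> \<le> (h ^^ (Suc k * q)) x"
      unfolding pow_multiple by (rule pow_mono[OF Suc])
    finally show ?case .
  qed simp
  then have "x / real (k * q) + of_int p / real q \<le> (h ^^ (k * q)) x / real (k * q)" if "1 \<le> k" for k
    using that q divide_right_mono[of "x + of_int (int k * p)" "(h ^^ (k * q)) x" "real (k * q)"]
    by (simp add: add_divide_distrib)
  then show "\<exists>N. \<forall>n\<ge>N. x / real (n * q) + of_int p / real q \<le> (h ^^ (n * q)) x / real (n * q)" by blast
qed

end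

lemma rational_between:
  fixes a b :: real
  assumes "0 < b - a" "b - a \<le> 1"
  shows "\<exists>p q. 0 < q \<and> coprime p (int q) \<and> a < of_int p / real q \<and> of_int p / real q < b \<and> real q \<le> 3 / (b - a)"
proof -
  define n where "n = nat \<lceil>1 / (b - a)\<rceil> + 1"
  have n1: "1 / (b - a) < real n" unfolding n_def using real_nat_ceiling_ge[of "1 / (b - a)"] by linarith
  have "real (nat \<lceil>1 / (b - a)\<rceil>) \<le> 1 / (b - a) + 1" using assms by (simp add: of_nat_nat)
  moreover have "1 \<le> 1 / (b - a)" using assms by simp
  moreover have "real n = real (nat \<lceil>1 / (b - a)\<rceil>) + 1" by (simp add: n_def)
  ultimately have "real n \<le> 3 * (1 / (b - a))" by linarith
  then have n3: "real n \<le> 3 / (b - a)" by simp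
  have n0: "0 < n" by (simp add: n_def)
  define m where "m = \<lfloor>real n * a\<rfloor> + 1"
  have nab: "1 < real n * (b - a)" using n1 assms by (simp add: divide_less_eq)
  have m: "real n * a < of_int m" "of_int m < real n * b"
    using nab unfolding m_def by (simp_all add: algebra_simps) linarith+
  define d where "d = gcd m (int n)"
  have d: "0 < d" using n0 by (simp add: d_def)
  obtain p q' where pq: "m = d * p" "int n = d * q'" "coprime p q'"
    using gcd_coprime_exists[of m "int n"] d unfolding d_def by (metis mult.commute less_irrefl)
  have q': "0 < q'" using pq(2) n0 d by (metis of_nat_0_less_iff zero_less_mult_pos)
  define q where "q = nat q'"
  have q: "0 < q" "int q = q'" using q' by (auto simp: q_def)
  have nq: "real n = of_int d * real q" using pq(2) q(2) by (metis of_int_mult of_int_of_nat_eq)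
  have "of_int p / real q = of_int m / real n" using d by (simp add: pq(1) nq)
  moreover have "a < of_int m / real n" "of_int m / real n < b"
    using m n0 by (simp_all add: pos_less_divide_eq pos_divide_less_eq mult.commute)
  ultimately have "a < of_int p / real q" "of_int p / real q < b" by (simp_all only:)
  moreover have "1 * real q \<le> real n" unfolding nq using d by (intro mult_right_mono) auto
  then have "real q \<le> 3 / (b - a)" using n3 by simp
  ultimately show ?thesis using q pq(3) by blast
qed

context critical_lift
begin

lemma circle_lift: "circle_lift (\<lambda>x. f x + t)"
  by unfold_locales (use mono_le shift in auto)

definition rho :: "real \<Rightarrow> real" where "rho t = rotation_number (\<lambda>x. f x + t)"

lemma rho_le: "0 < q \<Longrightarrow> it t q x \<le> x + of_int p \<Longrightarrow> rho t \<le> of_int p / real q"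
  unfolding rho_def by (rule circle_lift.rotation_number_le[OF circle_lift])

lemma rho_ge: "0 < q \<Longrightarrow> x + of_int p \<le> it t q x \<Longrightarrow> of_int p / real q \<le> rho t"
  unfolding rho_def by (rule circle_lift.rotation_number_ge[OF circle_lift])

lemma rho_bounds: "0 \<le> t \<Longrightarrow> t \<le> 1 \<Longrightarrow> 0 \<le> rho t \<and> rho t \<le> 1"
  using rho_le[of 1 t 0 1] rho_ge[of 1 0 0 t] f_zero by simp

lemma rho_mono: "s \<le> t \<Longrightarrow> rho s \<le> rho t"
  unfolding rho_def
  by (rule LIMSEQ_le[OF circle_lift.rotation_number_limit[OF circle_lift, of s 0]
        circle_lift.rotation_number_limit[OF circle_lift, of t 0]])
    (auto intro!: divide_right_mono it_mono_t exI[of _ 0])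

text \<open>Both \<open>s\<close> and \<open>t\<close> are outside the tongue of any fraction strictly between their rotation numbers; they lie
  on different sides of it.\<close>

lemma rho_increment:
  assumes m: "8 * step_const \<le> trap_width * 2 ^ m" and st: "0 \<le> s" "t \<le> 1" "s \<le> t" "rho s < rho t"
  shows "trap_width * ((rho t - rho s) / 3) ^ (m + 3) \<le> t - s"
proof -
  let ?\<delta> = "rho t - rho s"
  have \<delta>: "0 < ?\<delta>" "?\<delta> \<le> 1" using st rho_bounds[of s] rho_bounds[of t] by auto
  obtain p q where q: "0 < q" "coprime p (int q)" and between: "rho s < of_int p / real q" "of_int p / real q < rho t"
    and q_le: "real q \<le> 3 / ?\<delta>"
    using rational_between[OF \<delta>] by blast
  obtain u where u: "it u q 0 = of_int p" using superstable_parameter[OF q(1)] by blast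
  define w where "w = trap_width / real q ^ (m + 3)"
  obtain x where x: "it (u + w) q x \<le> x + of_int p"
    using tongue_width[OF m critical_lift_axioms q u] unfolding w_def by blast
  have "s < u"
  proof (rule ccontr)
    assume "\<not> s < u"
    then have "0 + of_int p \<le> it s q 0" using it_mono_t[of u s q 0] u by simp
    from rho_ge[OF q(1) this] between show False by simp
  qed
  moreover have "u + w < t"
  proof (rule ccontr)
    assume "\<not> u + w < t"
    then have "it t q x \<le> x + of_int p" using it_mono_t[of t "u + w" q x] x by simp
    from rho_le[OF q(1) this] between show False by simp
  qed
  moreover have "trap_width * (?\<delta> / 3) ^ (m + 3) \<le> w"
  proof -
    have "?\<delta> / 3 \<le> 1 / real q" using q_le q \<delta> by (simp add: field_simps)
    then have "(?\<delta> / 3) ^ (m + 3) \<le> (1 / real q) ^ (m + 3)" using \<delta> by (intro power_mono) auto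
    then show ?thesis
      using mult_left_mono[of _ _ trap_width] trap_width_pos by (fastforce simp: w_def power_divide)
  qed
  ultimately show ?thesis by linarith
qed

lemma rho_Hoelder:
  "\<exists>C>0. \<exists>\<alpha>. 0 < \<alpha> \<and> \<alpha> \<le> 1 \<and>
    (\<forall>t\<in>{0<..<1}. \<forall>s\<in>{0<..<1}. \<bar>rho t - rho s\<bar> \<le> C * \<bar>t - s\<bar> powr \<alpha>)"
proof -
  obtain m where "8 * step_const / trap_width < 2 ^ m"
    using real_arch_pow[of 2 "8 * step_const / trap_width"] by auto
  then have m: "8 * step_const \<le> trap_width * 2 ^ m" using trap_width_pos by (simp add: divide_less_eq mult.commute)
  define \<alpha> where "\<alpha> = 1 / real (m + 3)"
  define B where "B = 3 / trap_width powr \<alpha>"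
  have B: "0 < B" using trap_width_pos by (simp add: B_def)
  have \<alpha>: "0 < \<alpha>" "\<alpha> \<le> 1" by (simp_all add: \<alpha>_def)
  have main: "rho t - rho s \<le> B * (t - s) powr \<alpha>" if st: "0 < s" "t < 1" "s \<le> t" for s t
  proof (cases "rho s < rho t")
    case True
    define y where "y = (rho t - rho s) / 3"
    have y: "0 < y" using True by (simp add: y_def)
    have "y = (y ^ (m + 3)) powr \<alpha>"
      using y by (simp add: \<alpha>_def powr_realpow[symmetric] powr_powr)
    also have "\<dots> \<le> ((t - s) / trap_width) powr \<alpha>"
    proof (rule powr_mono2)
      show "y ^ (m + 3) \<le> (t - s) / trap_width"
        using rho_increment[OF m _ _ st(3) True] st trap_width_pos by (simp add: y_def pos_le_divide_eq mult.commute)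
    qed (use y \<alpha> in auto)
    also have "\<dots> = (t - s) powr \<alpha> / trap_width powr \<alpha>"
      by (rule powr_divide)
    finally show ?thesis by (simp add: y_def B_def mult.commute)
  next
    case False
    have "0 \<le> B * (t - s) powr \<alpha>" using B by simp
    then show ?thesis using False by linarith
  qed
  have "\<bar>rho t - rho s\<bar> \<le> B * \<bar>t - s\<bar> powr \<alpha>" if "t \<in> {0<..<1}" "s \<in> {0<..<1}" for s t
  proof (cases "s \<le> t")
    case True
    then show ?thesis using main[of s t] rho_mono[OF True] that by simp
  next
    case False
    then show ?thesis using main[of t s] rho_mono[of t s] that by (simp add: abs_minus_commute)
  qed
  then show ?thesis using B \<alpha> by blast
qed

end


section \<open>Smooth lifts with a non-flat critical point\<close>

lemma increment_le:
  fixes g g' :: "real \<Rightarrow> real"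
  assumes "a \<le> b" and d: "\<And>x. a \<le> x \<Longrightarrow> x \<le> b \<Longrightarrow> (g has_real_derivative g' x) (at x)"
    and le: "\<And>x. a \<le> x \<Longrightarrow> x \<le> b \<Longrightarrow> g' x \<le> M"
  shows "g b - g a \<le> M * (b - a)"
proof -
  have "M * a - g a \<le> M * b - g b"
  proof (rule DERIV_nonneg_imp_nondecreasing[OF \<open>a \<le> b\<close>])
    fix x assume x: "a \<le> x" "x \<le> b"
    have "((\<lambda>x. M * x - g x) has_real_derivative (M - g' x)) (at x)"
      using d[OF x] by (auto intro!: derivative_eq_intros)
    then show "\<exists>y. ((\<lambda>x. M * x - g x) has_real_derivative y) (at x) \<and> 0 \<le> y"
      using le[OF x] by force
  qed
  then show ?thesis by (simp add: algebra_simps)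
qed

lemma increment_ge:
  fixes g g' :: "real \<Rightarrow> real"
  assumes "a \<le> b" and d: "\<And>x. a \<le> x \<Longrightarrow> x \<le> b \<Longrightarrow> (g has_real_derivative g' x) (at x)"
    and le: "\<And>x. a \<le> x \<Longrightarrow> x \<le> b \<Longrightarrow> M \<le> g' x"
  shows "M * (b - a) \<le> g b - g a"
  using increment_le[OF \<open>a \<le> b\<close>, of "\<lambda>x. - g x" "\<lambda>x. - g' x" "- M"] d le
  by (force intro!: derivative_eq_intros)

text \<open>Up to the factor \<open>exp (K (y - x)\<^sup>2)\<close> the mean of \<open>f'\<close> over an interval dominates the geometric mean of its
  values at the ends. For concave \<open>log f'\<close> this follows by pairing points that are symmetric about the midpoint:
  \<open>f' (x + v) + f' (y - v) \<ge> 2 sqrt (f' (x + v) f' (y - v)) \<ge> 2 sqrt (f' x f' y)\<close>. The hypothesis on the derivatives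
  says that the second derivative of \<open>log f'\<close> is at most \<open>K\<close>.\<close>

lemma two_point:
  fixes f D1 D2 D3 :: "real \<Rightarrow> real"
  assumes d1: "\<And>x. (f has_real_derivative D1 x) (at x)"
    and d2: "\<And>x. (D1 has_real_derivative D2 x) (at x)"
    and d3: "\<And>x. (D2 has_real_derivative D3 x) (at x)"
    and K: "0 \<le> K" and pos: "\<And>z. x \<le> z \<Longrightarrow> z \<le> y \<Longrightarrow> 0 < D1 z"
    and concave: "\<And>z. x \<le> z \<Longrightarrow> z \<le> y \<Longrightarrow> D3 z * D1 z - (D2 z)\<^sup>2 \<le> K * (D1 z)\<^sup>2"
    and "x \<le> y"
  shows "D1 x * D1 y * (y - x)\<^sup>2 \<le> exp (K * (y - x)\<^sup>2) * (f y - f x)\<^sup>2"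
proof -
  define h where "h = y - x"
  have h: "0 \<le> h" using \<open>x \<le> y\<close> by (simp add: h_def)
  define P where "P z = D2 z / D1 z" for z
  have dP: "(P has_real_derivative (D3 z * D1 z - (D2 z)\<^sup>2) / (D1 z)\<^sup>2) (at z)" if "x \<le> z" "z \<le> y" for z
    unfolding P_def using pos[OF that]
    by (auto intro!: derivative_eq_intros d2 d3 simp: power2_eq_square)
  have dP_le: "(D3 z * D1 z - (D2 z)\<^sup>2) / (D1 z)\<^sup>2 \<le> K" if "x \<le> z" "z \<le> y" for z
    using pos[OF that] concave[OF that] by (simp add: divide_le_eq)
  define \<theta> where "\<theta> v = ln (D1 (x + v)) + ln (D1 (y - v))" for v
  define m where "m = sqrt (D1 x * D1 y) * exp (- (K * h\<^sup>2) / 4)"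
  have pxy: "0 < D1 x" "0 < D1 y" using pos[of x] pos[of y] \<open>x \<le> y\<close> by auto
  have \<theta>_ge: "\<theta> 0 - K * h\<^sup>2 / 2 \<le> \<theta> v" if v: "0 \<le> v" "v \<le> h / 2" for v
  proof -
    have "- (K * h) * (v - 0) \<le> \<theta> v - \<theta> 0"
    proof (rule increment_ge[OF v(1)])
      fix w assume w: "0 \<le> w" "w \<le> v"
      then have r: "x \<le> x + w" "x + w \<le> y" "x \<le> y - w" "y - w \<le> y" "x + w \<le> y - w" using v by (auto simp: h_def field_simps)
      show "(\<theta> has_real_derivative P (x + w) - P (y - w)) (at w)"
        unfolding \<theta>_def P_def using pos[OF r(1,2)] pos[OF r(3,4)]
        by (auto intro!: derivative_eq_intros DERIV_chain2[OF d2])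
      have "P (y - w) - P (x + w) \<le> K * ((y - w) - (x + w))"
        by (rule increment_le[OF r(5), of P "\<lambda>z. (D3 z * D1 z - (D2 z)\<^sup>2) / (D1 z)\<^sup>2"])
          (use dP dP_le r in auto)
      also have "\<dots> \<le> K * h" using w K by (intro mult_left_mono) (auto simp: h_def)
      finally show "- (K * h) \<le> P (x + w) - P (y - w)" by simp
    qed
    moreover have "K * h * v \<le> K * h * (h / 2)" using v K h by (intro mult_left_mono) auto
    ultimately show ?thesis by (simp add: power2_eq_square)
  qed
  have slope: "2 * m \<le> D1 (x + v) + D1 (y - v)" if v: "0 \<le> v" "v \<le> h / 2" for v
  proof -
    have p: "0 < D1 (x + v)" "0 < D1 (y - v)" using v by (auto intro!: pos simp: h_def field_simps)
    have "ln (m\<^sup>2) = \<theta> 0 - K * h\<^sup>2 / 2"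
      using pxy by (simp add: m_def power_mult_distrib ln_mult \<theta>_def exp_double[symmetric])
    also have "\<dots> \<le> \<theta> v" by (rule \<theta>_ge[OF v])
    also have "\<dots> = ln (D1 (x + v) * D1 (y - v))" using p by (simp add: \<theta>_def ln_mult)
    finally have "m\<^sup>2 \<le> D1 (x + v) * D1 (y - v)"
      using p pxy by (subst (asm) ln_le_cancel_iff) (auto simp: m_def)
    then have "(2 * m)\<^sup>2 \<le> 4 * (D1 (x + v) * D1 (y - v))" by (simp add: power_mult_distrib)
    also have "\<dots> \<le> (D1 (x + v) + D1 (y - v))\<^sup>2"
      using zero_le_power2[of "D1 (x + v) - D1 (y - v)"] by (simp add: power2_eq_square algebra_simps)
    finally show ?thesis by (rule power2_le_imp_le) (use p in auto)
  qed
  have "2 * m * (h / 2 - 0) \<le> (f (x + h / 2) - f (y - h / 2)) - (f (x + 0) - f (y - 0))"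
  proof (rule increment_ge)
    fix v assume v: "0 \<le> v" "v \<le> h / 2"
    show "((\<lambda>v. f (x + v) - f (y - v)) has_real_derivative D1 (x + v) + D1 (y - v)) (at v)"
      by (auto intro!: derivative_eq_intros DERIV_chain2[OF d1])
  qed (use h slope in auto)
  moreover have "x + h / 2 = y - h / 2" by (simp add: h_def field_simps)
  ultimately have "m * h \<le> f y - f x" by simp
  then have "(m * h)\<^sup>2 \<le> (f y - f x)\<^sup>2"
    using h pxy by (intro power_mono) (auto simp: m_def)
  then have "exp (K * h\<^sup>2 / 2) * (m * h)\<^sup>2 \<le> exp (K * h\<^sup>2 / 2) * (f y - f x)\<^sup>2" by (intro mult_left_mono) auto
  also have "\<dots> \<le> exp (K * h\<^sup>2) * (f y - f x)\<^sup>2" using K by (intro mult_right_mono) auto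
  also have "exp (K * h\<^sup>2 / 2) * (m * h)\<^sup>2 = D1 x * D1 y * h\<^sup>2"
    using pxy by (simp add: m_def power_mult_distrib exp_double[symmetric] mult_exp_exp)
  finally show ?thesis by (simp add: h_def)
qed

text \<open>The mixed derivative of \<open>ln ((f y - f x) / (y - x))\<close> is \<open>f' x f' y / (f y - f x)\<^sup>2 - 1 / (y - x)\<^sup>2\<close>, which is
  at most \<open>K\<close> by hypothesis. Integrated over \<open>x \<in> [a, b]\<close> and \<open>y \<in> [c, d]\<close> this gives the claim; the two
  integrations are applications of the mean value theorem.\<close>

lemma cross_ratio_integration:
  fixes f D1 :: "real \<Rightarrow> real"
  assumes d1: "\<And>x. (f has_real_derivative D1 x) (at x)"
    and inc: "\<And>x y. x < y \<Longrightarrow> f x < f y"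
    and two: "\<And>x y. a \<le> x \<Longrightarrow> x < y \<Longrightarrow> y \<le> d \<Longrightarrow>
       D1 x * D1 y * (y - x)\<^sup>2 \<le> (1 + K * (y - x)\<^sup>2) * (f y - f x)\<^sup>2"
    and o: "a < b" "b < c" "c < d"
  shows "(f c - f a) * (f d - f b) * ((c - b) * (d - a))
    \<le> exp (K * ((b - a) * (d - c))) * ((c - a) * (d - b) * ((f c - f b) * (f d - f a)))"
proof -
  define k where "k x y = - D1 x / (f y - f x) + 1 / (y - x)" for x y
  have k_le: "k x d - k x c \<le> K * (d - c)" if x: "a \<le> x" "x < c" for x
  proof (rule increment_le)
    fix y assume y: "c \<le> y" "y \<le> d"
    have p: "0 < f y - f x" "0 < y - x" using inc[of x y] x y by auto
    show "(k x has_real_derivative D1 x * D1 y / (f y - f x)\<^sup>2 - 1 / (y - x)\<^sup>2) (at y)"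
      unfolding k_def using p by (auto intro!: derivative_eq_intros d1 simp: power2_eq_square)
    have "D1 x * D1 y / (f y - f x)\<^sup>2 \<le> (1 + K * (y - x)\<^sup>2) / (y - x)\<^sup>2"
      using two[of x y] x y p by (simp add: divide_simps mult_ac)
    also have "\<dots> = 1 / (y - x)\<^sup>2 + K" using p by (simp add: field_simps)
    finally show "D1 x * D1 y / (f y - f x)\<^sup>2 - 1 / (y - x)\<^sup>2 \<le> K" by simp
  qed (use o in auto)
  define G where "G x = (ln (f d - f x) - ln (d - x)) - (ln (f c - f x) - ln (c - x))" for x
  have "G b - G a \<le> K * (d - c) * (b - a)"
  proof (rule increment_le)
    fix x assume x: "a \<le> x" "x \<le> b"
    have p: "0 < f d - f x" "0 < d - x" "0 < f c - f x" "0 < c - x"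
      using inc[of x d] inc[of x c] x o by auto
    show "(G has_real_derivative k x d - k x c) (at x)"
      unfolding G_def k_def using p by (auto intro!: derivative_eq_intros d1)
    show "k x d - k x c \<le> K * (d - c)" using k_le[of x] x o by simp
  qed (use o in auto)
  moreover have p: "0 < f d - f a" "0 < f d - f b" "0 < f c - f a" "0 < f c - f b"
    "0 < d - a" "0 < d - b" "0 < c - a" "0 < c - b"
    using inc o by auto
  have "G b - G a = ln (((f c - f a) * (f d - f b) * ((c - b) * (d - a))) / ((c - a) * (d - b) * ((f c - f b) * (f d - f a))))"
    using p by (simp add: G_def ln_div ln_mult)
  ultimately have ln_le: "ln (((f c - f a) * (f d - f b) * ((c - b) * (d - a))) / ((c - a) * (d - b) * ((f c - f b) * (f d - f a)))) \<le> K * ((b - a) * (d - c))"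
    by (simp add: mult_ac)
  have "0 < ((f c - f a) * (f d - f b) * ((c - b) * (d - a))) / ((c - a) * (d - b) * ((f c - f b) * (f d - f a)))"
    using p by (intro divide_pos_pos mult_pos_pos)
  from exp_ln[OF this] ln_le
  have "((f c - f a) * (f d - f b) * ((c - b) * (d - a))) / ((c - a) * (d - b) * ((f c - f b) * (f d - f a))) \<le> exp (K * ((b - a) * (d - c)))"
    by (metis exp_le_cancel_iff)
  then show ?thesis
    using p by (subst (asm) pos_divide_le_eq) (auto intro!: mult_pos_pos)
qed

text \<open>The derivative is comparable with the \<open>N\<close>-th power of the distance to the nearest integer. On a
  quarter of \<open>[z, z + h]\<close> this distance is at least half as large as at \<open>z\<close>, even if the interval
  contains a critical point.\<close>

lemma forward_growth:
  fixes f D1 :: "real \<Rightarrow> real"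
  assumes d1: "\<And>x. (f has_real_derivative D1 x) (at x)"
    and per: "\<And>x (n::int). D1 (x + of_int n) = D1 x" "\<And>x (n::int). f (x + of_int n) = f x + of_int n"
    and inc: "\<And>x y. x \<le> y \<Longrightarrow> f x \<le> f y"
    and c: "0 < c1" "0 < c2"
    and bnd: "\<And>x. \<bar>x\<bar> \<le> 3/4 \<Longrightarrow> c1 * \<bar>x\<bar> ^ N \<le> D1 x" "\<And>x. \<bar>x\<bar> \<le> 3/4 \<Longrightarrow> D1 x \<le> c2 * \<bar>x\<bar> ^ N"
    and h: "0 < h" "h \<le> 1/2"
  shows "c1 / (4 * 2 ^ N * c2) * h * D1 z \<le> f (z + h) - f z"
proof -
  define z0 where "z0 = z - of_int (round z)"
  have z: "z = z0 + of_int (round z)" by (simp add: z0_def)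
  have z0: "\<bar>z0\<bar> \<le> 1/2" using of_int_round_abs_le[of z] by (simp add: z0_def abs_minus_commute)
  have "\<exists>w. z0 \<le> w \<and> w \<le> z0 + 3 * h / 4 \<and> (\<forall>v. w \<le> v \<and> v \<le> w + h / 4 \<longrightarrow> \<bar>z0\<bar> / 2 \<le> \<bar>v\<bar> \<and> \<bar>v\<bar> \<le> 3/4)"
  proof -
    consider "0 \<le> z0" | "z0 < 0" "h / 4 \<le> \<bar>z0\<bar> / 2" | "z0 < 0" "\<bar>z0\<bar> / 2 < h / 4" by linarith
    then show ?thesis
    proof cases
      case 1
      then show ?thesis using z0 h by (intro exI[of _ z0]) auto
    next
      case 2
      then show ?thesis using z0 h by (intro exI[of _ z0]) auto
    next
      case 3
      then show ?thesis using z0 h by (intro exI[of _ "z0 + 3 * h / 4"]) auto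
    qed
  qed
  then obtain w where w: "z0 \<le> w" "w \<le> z0 + 3 * h / 4"
    and v: "\<And>v. w \<le> v \<Longrightarrow> v \<le> w + h / 4 \<Longrightarrow> \<bar>z0\<bar> / 2 \<le> \<bar>v\<bar> \<and> \<bar>v\<bar> \<le> 3/4" by blast
  have D: "c1 / (2 ^ N * c2) * D1 z0 \<le> c1 * (\<bar>z0\<bar> / 2) ^ N"
    using bnd(2)[of z0] z0 c by (simp add: power_divide field_simps)
  have "c1 * (\<bar>z0\<bar> / 2) ^ N * ((w + h / 4) - w) \<le> f (w + h / 4) - f w"
  proof (rule increment_ge)
    fix x assume x: "w \<le> x" "x \<le> w + h / 4"
    have "c1 * (\<bar>z0\<bar> / 2) ^ N \<le> c1 * \<bar>x\<bar> ^ N"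
      using v[OF x] c by (intro mult_left_mono power_mono) auto
    also have "\<dots> \<le> D1 x" using v[OF x] by (intro bnd) auto
    finally show "c1 * (\<bar>z0\<bar> / 2) ^ N \<le> D1 x" .
  qed (use h d1 in auto)
  also have "\<dots> \<le> f (z0 + h) - f z0"
    using inc[of z0 w] inc[of "w + h / 4" "z0 + h"] w h by auto
  also have "\<dots> = f (z + h) - f z"
    using per(2)[of "z0 + h" "round z"] per(2)[of z0 "round z"] by (simp add: z0_def algebra_simps)
  finally have "c1 * (\<bar>z0\<bar> / 2) ^ N * (h / 4) \<le> f (z + h) - f z" by simp
  moreover have "c1 / (2 ^ N * c2) * D1 z0 * (h / 4) \<le> c1 * (\<bar>z0\<bar> / 2) ^ N * (h / 4)"
    using D h by (intro mult_right_mono) auto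
  moreover have "D1 z0 = D1 z" using per(1)[of z0 "round z"] by (simp add: z0_def)
  moreover have "c1 / (4 * 2 ^ N * c2) * h * D1 z = c1 / (2 ^ N * c2) * D1 z * (h / 4)" by (simp add: mult_ac)
  ultimately show ?thesis by (metis order.trans)
qed

text \<open>Both \<open>f (\<theta> b)\<close> and \<open>f b\<close> are comparable with the \<open>N + 1\<close>-st power of their arguments, and \<open>N + 1 \<ge> 2\<close>.\<close>

lemma forward_flat:
  fixes f D1 :: "real \<Rightarrow> real"
  assumes d1: "\<And>x. (f has_real_derivative D1 x) (at x)"
    and inc: "\<And>x y. x \<le> y \<Longrightarrow> f x \<le> f y" and f01: "f 0 = 0" "f 1 = 1"
    and c: "0 < c1" "0 < c2" and N: "1 \<le> N"
    and bnd: "\<And>x. \<bar>x\<bar> \<le> 3/4 \<Longrightarrow> c1 * \<bar>x\<bar> ^ N \<le> D1 x" "\<And>x. \<bar>x\<bar> \<le> 3/4 \<Longrightarrow> D1 x \<le> c2 * \<bar>x\<bar> ^ N"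
    and \<theta>: "0 < \<theta>" "\<theta> \<le> 1" and b: "0 < b" "b \<le> 1"
  shows "f (\<theta> * b) \<le> (c2 + 2 ^ Suc N) * 4 ^ Suc N / c1 * \<theta>\<^sup>2 * f b"
proof -
  have up: "f x \<le> (c2 + 2 ^ Suc N) * x ^ Suc N" if x: "0 < x" "x \<le> 1" for x
  proof (cases "x \<le> 3/4")
    case True
    have "f x - f 0 \<le> c2 * x ^ N * (x - 0)"
    proof (rule increment_le)
      fix y assume y: "0 \<le> y" "y \<le> x"
      have "D1 y \<le> c2 * \<bar>y\<bar> ^ N" using y True by (intro bnd) auto
      also have "\<dots> \<le> c2 * x ^ N" using y c by (intro mult_left_mono power_mono) auto
      finally show "D1 y \<le> c2 * x ^ N" .
    qed (use x d1 in auto)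
    also have "\<dots> \<le> (c2 + 2 ^ Suc N) * x ^ Suc N" using x by (simp add: algebra_simps)
    finally show ?thesis using f01 by simp
  next
    case False
    have "f x \<le> 1" using inc[of x 1] f01 x by simp
    also have "1 \<le> (2 * x) ^ Suc N" using False by (intro one_le_power) auto
    also have "\<dots> = 2 ^ Suc N * x ^ Suc N" by (simp add: power_mult_distrib)
    also have "\<dots> \<le> (c2 + 2 ^ Suc N) * x ^ Suc N" using c x by (intro mult_right_mono) auto
    finally show ?thesis .
  qed
  have "c1 * (b / 4) ^ N * (b / 2 - b / 4) \<le> f (b / 2) - f (b / 4)"
  proof (rule increment_ge)
    fix y assume y: "b / 4 \<le> y" "y \<le> b / 2"
    have "c1 * (b / 4) ^ N \<le> c1 * \<bar>y\<bar> ^ N" using y b c by (intro mult_left_mono power_mono) auto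
    also have "\<dots> \<le> D1 y" using y b by (intro bnd) auto
    finally show "c1 * (b / 4) ^ N \<le> D1 y" .
  qed (use b d1 in auto)
  also have "\<dots> \<le> f b" using inc[of "b/2" b] inc[of 0 "b/4"] f01 b by simp
  finally have low: "c1 / 4 ^ Suc N * b ^ Suc N \<le> f b" by (simp add: power_divide field_simps)
  have pw: "\<theta> ^ Suc N \<le> \<theta>\<^sup>2" using \<theta> N by (intro power_decreasing) auto
  have "f (\<theta> * b) \<le> (c2 + 2 ^ Suc N) * (\<theta> * b) ^ Suc N"
    using \<theta> b by (intro up) (auto simp: mult_le_one)
  also have "\<dots> = (c2 + 2 ^ Suc N) * 4 ^ Suc N / c1 * \<theta> ^ Suc N * (c1 / 4 ^ Suc N * b ^ Suc N)"
    using c by (simp add: power_mult_distrib field_simps)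
  also have "\<dots> \<le> (c2 + 2 ^ Suc N) * 4 ^ Suc N / c1 * \<theta>\<^sup>2 * f b"
    using low pw c \<theta> b by (intro mult_mono mult_left_mono) (auto intro!: mult_nonneg_nonneg divide_nonneg_nonneg)
  finally show ?thesis .
qed

text \<open>The derivative at a point is nowhere much larger than its mean over an interval that contains the point. So
  neither of the factors \<open>(b - a) / (c - a)\<close> and \<open>(d - c) / (d - b)\<close> can grow much.\<close>

lemma rough_of_mean:
  fixes f D1 :: "real \<Rightarrow> real"
  assumes d1: "\<And>x. (f has_real_derivative D1 x) (at x)"
    and inc: "\<And>x y. x < y \<Longrightarrow> f x < f y" and M: "0 < M"
    and mean: "\<And>x y z. x \<le> z \<Longrightarrow> z \<le> y \<Longrightarrow> x < y \<Longrightarrow> y \<le> x + 3 \<Longrightarrow> D1 z * (y - x) \<le> M * (f y - f x)"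
    and o: "a \<le> b" "b \<le> c" "c \<le> d" "a < c" "b < d" "d - a \<le> 3"
  shows "cr (f a) (f b) (f c) (f d) \<le> M\<^sup>2 * cr a b c d"
proof -
  have part: "(f v - f u) / (f y - f x) \<le> M * ((v - u) / (y - x))"
    if "x \<le> u" "u \<le> v" "v \<le> y" "x < y" "y \<le> x + 3" for x y u v
  proof (cases "u = v")
    case False
    then have "u < v" using that by simp
    then obtain z where z: "u < z" "z < v" "f v - f u = (v - u) * D1 z"
      using MVT2[of u v f D1] d1 by blast
    have "D1 z * (y - x) \<le> M * (f y - f x)" using that z by (intro mean) auto
    then have "(v - u) * (D1 z * (y - x)) \<le> (v - u) * (M * (f y - f x))"
      using \<open>u < v\<close> by (intro mult_left_mono) auto
    then show ?thesis using inc[of x y] that z(3) by (simp add: divide_simps mult_ac)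
  qed simp
  have split: "cr a b c d = ((b - a) / (c - a)) * ((d - c) / (d - b))" for a b c d by (simp add: cr_def)
  have le: "f x \<le> f y" if "x \<le> y" for x y using inc[of x y] that by (cases "x = y") auto
  have "cr (f a) (f b) (f c) (f d) \<le> (M * ((b - a) / (c - a))) * (M * ((d - c) / (d - b)))"
    unfolding split using o M le
    by (intro mult_mono part) (auto intro!: divide_nonneg_nonneg mult_nonneg_nonneg)
  then show ?thesis by (simp add: split power2_eq_square mult_ac)
qed

text \<open>Successive use of l'Hopital's rule, downwards from the first derivative that does not vanish.\<close>

lemma taylor_quotient:
  fixes D :: "nat \<Rightarrow> real \<Rightarrow> real"
  assumes der: "\<And>i x. i < l \<Longrightarrow> (D i has_real_derivative D (Suc i) x) (at x)"
    and zero: "\<And>i. i < l \<Longrightarrow> D i 0 = 0" and cont: "isCont (D l) 0" and "n \<le> l"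
  shows "((\<lambda>x. D (l - n) x / x ^ n) \<longlongrightarrow> D l 0 / fact n) (at 0)"
  using \<open>n \<le> l\<close>
proof (induction n)
  case 0
  then show ?case using cont by (simp add: isCont_def)
next
  case (Suc n)
  let ?i = "l - Suc n"
  have i: "?i < l" "Suc ?i = l - n" using Suc.prems by auto
  show ?case
  proof (rule lhopital[where f' = "D (l - n)" and g' = "\<lambda>x. real (Suc n) * x ^ n"])
    show "(D ?i \<longlongrightarrow> 0) (at 0)"
      using DERIV_isCont[OF der[OF i(1), of 0]] zero[OF i(1)] by (simp add: isCont_def)
    show "((\<lambda>x::real. x ^ Suc n) \<longlongrightarrow> 0) (at 0)" by (auto intro!: tendsto_eq_intros)
    show "\<forall>\<^sub>F x::real in at 0. x ^ Suc n \<noteq> 0"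
      by (rule eventually_mono[OF eventually_neq_at_within[of 0]]) simp
    show "\<forall>\<^sub>F x::real in at 0. real (Suc n) * x ^ n \<noteq> 0"
      by (rule eventually_mono[OF eventually_neq_at_within[of 0]]) simp
    show "\<forall>\<^sub>F x in at 0. (D ?i has_real_derivative D (l - n) x) (at x)"
      using der[OF i(1)] i(2) by simp
    show "\<forall>\<^sub>F x::real in at 0. ((\<lambda>x. x ^ Suc n) has_real_derivative real (Suc n) * x ^ n) (at x)"
      using DERIV_pow[of "Suc n"] by (intro always_eventually allI) simp
    have "((\<lambda>x. (D (l - n) x / x ^ n) / real (Suc n)) \<longlongrightarrow> D l 0 / fact n / real (Suc n)) (at 0)"
      using Suc by (intro tendsto_divide[OF _ tendsto_const]) auto
    then show "((\<lambda>x. D (l - n) x / (real (Suc n) * x ^ n)) \<longlongrightarrow> D l 0 / fact (Suc n)) (at 0)"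
      by (simp add: mult_ac)
  qed
qed

text \<open>Here \<open>l\<close> is the order of the critical point, that is, the least order of a non-vanishing derivative at \<open>0\<close>.\<close>

locale smooth_lift =
  fixes f :: "real \<Rightarrow> real" and l :: nat
  assumes strict: "x < y \<Longrightarrow> f x < f y"
    and shift: "f (x + 1) = f x + 1"
    and f_zero: "f 0 = 0"
    and C3: "C_diff 3 f"
    and critical: "deriv f x = 0 \<longleftrightarrow> x \<in> \<int>"
    and Cl: "C_diff l f"
    and order: "(deriv ^^ l) f 0 \<noteq> 0"
    and minimal: "i < l \<Longrightarrow> (deriv ^^ i) f 0 = 0"
begin

definition D :: "nat \<Rightarrow> real \<Rightarrow> real" where "D i = (deriv ^^ i) f"

lemma D_Suc: "D (Suc i) = deriv (D i)" by (simp add: D_def)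

lemma D0: "D 0 = f" by (simp add: D_def)

lemma D_der: "i < 3 \<or> i < l \<Longrightarrow> (D i has_real_derivative D (Suc i) x) (at x)"
  using C3 Cl unfolding C_diff_def D_Suc DERIV_deriv_iff_field_differentiable by (auto simp: D_def)

lemma d1: "(f has_real_derivative D 1 x) (at x)"
  using D_der[of 0 x] by (simp add: D0)

lemma D_cont: "i \<le> 3 \<Longrightarrow> continuous_on S (D i)"
proof -
  assume "i \<le> 3"
  then have "continuous_on UNIV (D i)"
  proof (cases "i = 3")
    case True
    then show ?thesis using C3 by (simp add: C_diff_def D_def)
  next
    case False
    then show ?thesis using \<open>i \<le> 3\<close>
      by (intro continuous_at_imp_continuous_on ballI DERIV_isCont[OF D_der]) auto
  qed
  then show ?thesis by (rule continuous_on_subset) simp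
qed

lemma shift_int: "f (x + of_int n) = f x + of_int n"
  by (rule lift_shift_int) (rule shift)

lemma D_periodic: "0 < i \<Longrightarrow> i \<le> 3 \<Longrightarrow> D i (x + of_int n) = D i x"
proof (induction i arbitrary: x)
  case (Suc i)
  have 1: "((\<lambda>x. D i (x + of_int n)) has_real_derivative D (Suc i) (x + of_int n)) (at x)"
    using D_der[of i "x + of_int n"] Suc.prems by (simp add: DERIV_shift)
  have 2: "((\<lambda>x. D i (x + of_int n)) has_real_derivative D (Suc i) x) (at x)"
  proof (cases "i = 0")
    case True
    have "((\<lambda>x. f x + of_int n) has_real_derivative D 1 x) (at x)"
      by (auto intro!: derivative_eq_intros d1)
    then show ?thesis by (simp add: True D0 shift_int)
  next
    case False
    then have "(\<lambda>x. D i (x + of_int n)) = D i" using Suc by auto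
    then show ?thesis using D_der[of i x] Suc.prems by simp
  qed
  show ?case using DERIV_unique[OF 1 2] .
qed simp

lemma D1_nonneg: "0 \<le> D 1 x"
proof -
  have "mono_on UNIV f"
    using strict by (auto simp: mono_on_def order_le_less)
  from mono_on_imp_deriv_nonneg[OF this d1] show ?thesis by simp
qed

lemma D1_pos: "x \<notin> \<int> \<Longrightarrow> 0 < D 1 x"
  using D1_nonneg[of x] critical[of x] by (simp add: D_def order_less_le)

lemma quotient:
  "n \<le> l \<Longrightarrow> ((\<lambda>x. D (l - n) x / x ^ n) \<longlongrightarrow> D l 0 / fact n) (at 0)"
proof (rule taylor_quotient)
  show "isCont (D l) 0"
    using Cl by (simp add: C_diff_def D_def continuous_on_eq_continuous_at)
qed (use D_der minimal in \<open>auto simp: D_def\<close>)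

lemma l_ge_2: "2 \<le> l"
proof -
  have "l \<noteq> 0" using order f_zero by (metis funpow_0)
  moreover have "l \<noteq> 1" using order critical[of 0] by auto
  ultimately show ?thesis by simp
qed

definition N where "N = l - 1"

lemma quotient1: "((\<lambda>x. D 1 x / x ^ N) \<longlongrightarrow> D l 0 / fact N) (at 0)"
  using quotient[of N] l_ge_2 by (simp add: N_def)

text \<open>The derivative of \<open>f\<close> is nonnegative on both sides of \<open>0\<close>, so its leading term \<open>D l 0 / N! x\<^sup>N\<close> does not change sign.\<close>

lemma leading_pos: "0 < D l 0" and N_even: "even N"
proof -
  have nz: "D l 0 \<noteq> 0" using order by (simp add: D_def)
  have "0 \<le> D l 0 / fact N"
  proof (rule tendsto_lowerbound)
    show "((\<lambda>x. D 1 x / x ^ N) \<longlongrightarrow> D l 0 / fact N) (at_right 0)"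
      using quotient1 by (rule filterlim_mono[OF _ order_refl at_le]) simp
    show "\<forall>\<^sub>F x in at_right 0. 0 \<le> D 1 x / x ^ N"
      using D1_nonneg by (auto simp: eventually_at_filter)
  qed simp
  then have "0 \<le> D l 0" using fact_gt_zero[of N, where 'a = real] by (simp only: zero_le_divide_iff) simp
  then show pos: "0 < D l 0" using nz by simp
  show "even N"
  proof (rule ccontr)
    assume "odd N"
    have "D l 0 / fact N \<le> 0"
    proof (rule tendsto_upperbound)
      show "((\<lambda>x. D 1 x / x ^ N) \<longlongrightarrow> D l 0 / fact N) (at_left 0)"
        using quotient1 by (rule filterlim_mono[OF _ order_refl at_le]) simp
      show "\<forall>\<^sub>F x in at_left 0. D 1 x / x ^ N \<le> 0"
        using D1_nonneg \<open>odd N\<close>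
        by (auto simp: eventually_at_filter divide_nonneg_nonpos zero_less_power_eq power_less_zero_eq less_imp_le)
    qed simp
    then show False using pos fact_gt_zero[of N, where 'a = real]
      by (simp only: divide_le_0_iff) linarith
  qed
qed

lemma N_ge_2: "2 \<le> N"
proof -
  have "1 \<le> N" using l_ge_2 by (simp add: N_def)
  moreover have "N \<noteq> 1" using N_even by auto
  ultimately show ?thesis by simp
qed

text \<open>The second derivative of \<open>log f'\<close>, namely \<open>(f''' f' - f''\<^sup>2) / f'\<^sup>2\<close>, behaves like \<open>-N / x\<^sup>2\<close> near the critical
  point.\<close>

lemma near_critical_point:
  "\<exists>r>0. r \<le> 1/4 \<and> (\<forall>x. x \<noteq> 0 \<longrightarrow> \<bar>x\<bar> < r \<longrightarrow>
     D l 0 / fact N / 2 \<le> D 1 x / x ^ N \<and> D 1 x / x ^ N \<le> 2 * (D l 0 / fact N)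
     \<and> D 3 x * D 1 x - (D 2 x)\<^sup>2 \<le> 0)"
proof -
  obtain k where k: "N = Suc (Suc k)" using N_ge_2 by (metis Suc_le_D numeral_2_eq_2 Suc_le_mono)
  let ?A = "D l 0"
  have lk: "l = k + 3" using k l_ge_2 by (simp add: N_def)
  have q3: "((\<lambda>x. D 3 x / x ^ k) \<longlongrightarrow> ?A / fact k) (at 0)"
    and q2: "((\<lambda>x. D 2 x / x ^ Suc k) \<longlongrightarrow> ?A / fact (Suc k)) (at 0)"
    using quotient[of k] quotient[of "Suc k"] lk by (simp_all add: numeral_eq_Suc)
  have "((\<lambda>x. (D 3 x / x ^ k) * (D 1 x / x ^ N) - (D 2 x / x ^ Suc k)\<^sup>2) \<longlongrightarrow>
     (?A / fact k) * (?A / fact N) - (?A / fact (Suc k))\<^sup>2) (at 0)"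
    by (intro tendsto_intros q3 q2 quotient1)
  moreover have "(?A / fact k) * (?A / fact N) - (?A / fact (Suc k))\<^sup>2 < 0"
  proof -
    have "(?A / fact k) * (?A / fact N) - (?A / fact (Suc k))\<^sup>2
       = (?A / fact k)\<^sup>2 * (1 / ((real k + 2) * (real k + 1)) - 1 / (real k + 1)\<^sup>2)"
    proof -
      have "(A / F) * (A / (b * (a * F))) - (A / (a * F))\<^sup>2 = (A / F)\<^sup>2 * (1 / (b * a) - 1 / a\<^sup>2)"
        if "a \<noteq> 0" "b \<noteq> 0" "F \<noteq> 0" for A F a b :: real
        using that by (simp add: power2_eq_square field_simps)
      from this[of "real k + 1" "real k + 2" "fact k" ?A] show ?thesis by (simp add: k add_ac)
    qed
    moreover have "1 / ((real k + 2) * (real k + 1)) < 1 / (real k + 1)\<^sup>2"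
      by (simp add: power2_eq_square divide_strict_left_mono)
    moreover have "0 < (?A / fact k)\<^sup>2" using leading_pos by simp
    ultimately show ?thesis by (simp add: mult_less_0_iff)
  qed
  ultimately have "\<forall>\<^sub>F x in at 0. (D 3 x / x ^ k) * (D 1 x / x ^ N) - (D 2 x / x ^ Suc k)\<^sup>2 < 0"
    by (rule order_tendstoD(2))
  moreover have half: "x / 2 < x \<and> x < 2 * x" if "0 < x" for x :: real using that by simp
  have B: "0 < ?A / fact N" using leading_pos by simp
  have "\<forall>\<^sub>F x in at 0. ?A / fact N / 2 < D 1 x / x ^ N"
    by (rule order_tendstoD(1)[OF quotient1]) (use half[OF B] in blast)
  moreover have "\<forall>\<^sub>F x in at 0. D 1 x / x ^ N < 2 * (?A / fact N)"
    by (rule order_tendstoD(2)[OF quotient1]) (use half[OF B] in blast)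
  ultimately have "\<forall>\<^sub>F x in at 0. (D 3 x / x ^ k) * (D 1 x / x ^ N) - (D 2 x / x ^ Suc k)\<^sup>2 < 0 \<and>
     ?A / fact N / 2 < D 1 x / x ^ N \<and> D 1 x / x ^ N < 2 * (?A / fact N)"
    by eventually_elim auto
  then obtain r where r: "0 < r" and *: "\<And>x. x \<noteq> 0 \<Longrightarrow> \<bar>x\<bar> < r \<Longrightarrow>
     (D 3 x / x ^ k) * (D 1 x / x ^ N) - (D 2 x / x ^ Suc k)\<^sup>2 < 0 \<and>
     ?A / fact N / 2 < D 1 x / x ^ N \<and> D 1 x / x ^ N < 2 * (?A / fact N)"
    by (auto simp: eventually_at dist_real_def)
  have "D 3 x * D 1 x - (D 2 x)\<^sup>2 \<le> 0" if "x \<noteq> 0" "\<bar>x\<bar> < r" for x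
  proof -
    have "(D 3 x / x ^ k) * (D 1 x / x ^ N) - (D 2 x / x ^ Suc k)\<^sup>2
       = (D 3 x * D 1 x - (D 2 x)\<^sup>2) / (x ^ Suc k)\<^sup>2"
      using that by (simp add: k power2_eq_square field_simps)
    then have "(D 3 x * D 1 x - (D 2 x)\<^sup>2) / (x ^ Suc k)\<^sup>2 < 0" using *[OF that] by simp
    then show ?thesis using that by (simp add: divide_less_0_iff)
  qed
  then show ?thesis using r * by (intro exI[of _ "min r (1/4)"]) (auto simp: less_imp_le)
qed

text \<open>Near the integers the left-hand side is not positive, and elsewhere continuity on a compact interval suffices.\<close>

lemma log_concavity_defect:
  "\<exists>K\<ge>0. \<forall>x. 0 < x \<longrightarrow> x < 1 \<longrightarrow> D 3 x * D 1 x - (D 2 x)\<^sup>2 \<le> K * (D 1 x)\<^sup>2"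
proof -
  obtain r where r: "0 < r" "r \<le> 1/4"
    and neg: "\<And>x. x \<noteq> 0 \<Longrightarrow> \<bar>x\<bar> < r \<Longrightarrow> D 3 x * D 1 x - (D 2 x)\<^sup>2 \<le> 0"
    using near_critical_point by blast
  have pos: "0 < D 1 x" if "0 < x" "x < 1" for x
    using that by (intro D1_pos) (auto elim!: Ints_cases)
  let ?h = "\<lambda>x. (D 3 x * D 1 x - (D 2 x)\<^sup>2) / (D 1 x)\<^sup>2"
  have "\<forall>x\<in>{r..1-r}. (D 1 x)\<^sup>2 \<noteq> 0"
  proof
    fix x assume "x \<in> {r..1-r}"
    then have "0 < D 1 x" using r by (intro pos) auto
    then show "(D 1 x)\<^sup>2 \<noteq> 0" by simp
  qed
  then have co: "continuous_on {r..1-r} ?h"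
    by (intro continuous_intros D_cont) auto
  have "{r..1-r} \<noteq> {}" using r by auto
  then obtain x0 where x0: "\<And>x. x \<in> {r..1-r} \<Longrightarrow> ?h x \<le> ?h x0"
    using continuous_attains_sup[OF compact_Icc _ co] by blast
  define K where "K = max 0 (?h x0)"
  have K: "0 \<le> K" "?h x0 \<le> K" by (auto simp: K_def)
  have "D 3 x * D 1 x - (D 2 x)\<^sup>2 \<le> K * (D 1 x)\<^sup>2" if x: "0 < x" "x < 1" for x
  proof -
    have "0 \<le> K * (D 1 x)\<^sup>2" using K(1) by simp
    moreover consider "x < r" | "1 - r < x" | "x \<in> {r..1-r}" by force
    then show ?thesis
    proof cases
      case 1
      then show ?thesis using neg[of x] x \<open>0 \<le> K * (D 1 x)\<^sup>2\<close> by simp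
    next
      case 2
      have "D i (x - 1) = D i x" if "0 < i" "i \<le> 3" for i
        using D_periodic[OF that, of x "-1"] by simp
      then show ?thesis using neg[of "x - 1"] 2 x \<open>0 \<le> K * (D 1 x)\<^sup>2\<close> by simp
    next
      case 3
      have "?h x \<le> K" using order_trans[OF x0[OF 3] K(2)] .
      then show ?thesis using pos[OF x] by (simp only: pos_divide_le_eq zero_less_power)
    qed
  qed
  then show ?thesis using K(1) by blast
qed

lemma power_bounds:
  "\<exists>c1>0. \<exists>c2>0. \<forall>x. \<bar>x\<bar> \<le> 3/4 \<longrightarrow> c1 * \<bar>x\<bar> ^ N \<le> D 1 x \<and> D 1 x \<le> c2 * \<bar>x\<bar> ^ N"
proof -
  obtain r where r: "0 < r" "r \<le> 1/4"
    and near: "\<And>x. x \<noteq> 0 \<Longrightarrow> \<bar>x\<bar> < r \<Longrightarrow> D l 0 / fact N / 2 \<le> D 1 x / x ^ N \<and> D 1 x / x ^ N \<le> 2 * (D l 0 / fact N)"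
    using near_critical_point by blast
  let ?S = "{-3/4..-r} \<union> {r..3/4}" and ?h = "\<lambda>x. D 1 x / \<bar>x\<bar> ^ N"
  let ?A = "D l 0 / fact N"
  have A: "0 < ?A" using leading_pos by simp
  have pos: "0 < D 1 x" if "x \<noteq> 0" "\<bar>x\<bar> \<le> 3/4" for x
    using that by (intro D1_pos) (auto elim!: Ints_cases)
  have ab: "\<bar>x\<bar> ^ N = x ^ N" for x :: real using N_even by (simp add: power_even_abs)
  have co: "continuous_on ?S ?h"
    by (intro continuous_intros D_cont) (use r in auto)
  have cp: "compact ?S" by auto
  have ne: "?S \<noteq> {}" using r by auto
  obtain x1 where x1: "x1 \<in> ?S" "\<And>x. x \<in> ?S \<Longrightarrow> ?h x1 \<le> ?h x"
    using continuous_attains_inf[OF cp ne co] by blast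
  obtain x2 where x2: "x2 \<in> ?S" "\<And>x. x \<in> ?S \<Longrightarrow> ?h x \<le> ?h x2"
    using continuous_attains_sup[OF cp ne co] by blast
  have h1: "0 < ?h x1" using x1(1) r by (intro divide_pos_pos pos) auto
  let ?c1 = "min (?A / 2) (?h x1)" and ?c2 = "max (2 * ?A) (?h x2)"
  have "?c1 * \<bar>x\<bar> ^ N \<le> D 1 x \<and> D 1 x \<le> ?c2 * \<bar>x\<bar> ^ N" if x: "\<bar>x\<bar> \<le> 3/4" for x
  proof (cases "x = 0")
    case True
    have "D 1 0 = 0" using critical[of 0] by (simp add: D_def)
    then show ?thesis using True N_ge_2 by (simp add: power_0_left)
  next
    case False
    then have p: "0 < \<bar>x\<bar> ^ N" by simp
    have "?c1 \<le> ?h x \<and> ?h x \<le> ?c2"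
    proof (cases "\<bar>x\<bar> < r")
      case True
      then show ?thesis using near[OF False True] by (simp add: ab min_le_iff_disj le_max_iff_disj)
    next
      case f: False
      have "x \<in> ?S" using f x by auto
      then show ?thesis using x1(2)[of x] x2(2)[of x] by (simp only: min_le_iff_disj le_max_iff_disj) simp
    qed
    then show ?thesis using p by (simp only: pos_le_divide_eq pos_divide_le_eq)
  qed
  moreover have "0 < ?c1" "0 < ?c2" using A h1 by auto
  ultimately show ?thesis by blast
qed

end

context smooth_lift
begin

text \<open>In \<open>two_point\<close> the factor \<open>exp (K1 (y - x)\<^sup>2)\<close> is replaced by \<open>1 + K (y - x)\<^sup>2\<close>, which is possible as
  \<open>y - x \<le> 1\<close>. The conditions on the left of the critical point are those of the reflected map \<open>g\<close>.\<close>

lemma critical_lift_exists: "\<exists>K C. critical_lift f K C"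
proof -
  obtain K1 where K1: "0 \<le> K1"
    and concave: "\<And>x. 0 < x \<Longrightarrow> x < 1 \<Longrightarrow> D 3 x * D 1 x - (D 2 x)\<^sup>2 \<le> K1 * (D 1 x)\<^sup>2"
    using log_concavity_defect by blast
  obtain c1 c2 where c: "0 < c1" "0 < c2"
    and bnd: "\<And>x. \<bar>x\<bar> \<le> 3/4 \<Longrightarrow> c1 * \<bar>x\<bar> ^ N \<le> D 1 x" "\<And>x. \<bar>x\<bar> \<le> 3/4 \<Longrightarrow> D 1 x \<le> c2 * \<bar>x\<bar> ^ N"
    using power_bounds by blast
  have mono: "f x \<le> f y" if "x \<le> y" for x y using strict[of x y] that by (cases "x = y") auto
  define K where "K = K1 * exp K1"
  have K: "0 \<le> K" using K1 by (simp add: K_def)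
  have D1_int: "D 1 (of_int n) = 0" for n using critical[of "of_int n"] by (simp add: D_def)
  have two: "D 1 x * D 1 y * (y - x)\<^sup>2 \<le> (1 + K * (y - x)\<^sup>2) * (f y - f x)\<^sup>2"
    if "0 \<le> x" "x < y" "y \<le> 1" for x y
  proof (cases "x = 0 \<or> y = 1")
    case True
    then have "D 1 x * D 1 y = 0" using D1_int[of 0] D1_int[of 1] by auto
    moreover have "0 \<le> (1 + K * (y - x)\<^sup>2) * (f y - f x)\<^sup>2" using K by simp
    ultimately show ?thesis by (simp only: mult_zero_left)
  next
    case False
    have "D 1 x * D 1 y * (y - x)\<^sup>2 \<le> exp (K1 * (y - x)\<^sup>2) * (f y - f x)\<^sup>2"
    proof (rule two_point[of f "D 1" "D 2" "D 3"])
      show "(D 1 has_real_derivative D 2 x) (at x)" "(D 2 has_real_derivative D 3 x) (at x)" for x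
        using D_der[of 1 x] D_der[of 2 x] by (simp_all add: numeral_eq_Suc)
      show "0 < D 1 z" if "x \<le> z" "z \<le> y" for z
      proof (rule D1_pos)
        have "0 < z" "z < 1" using that False \<open>0 \<le> x\<close> \<open>y \<le> 1\<close> by auto
        then show "z \<notin> \<int>" by (auto elim!: Ints_cases)
      qed
    qed (use d1 K1 concave that False in auto)
    also have "\<dots> \<le> (1 + K * (y - x)\<^sup>2) * (f y - f x)\<^sup>2"
    proof (rule mult_right_mono)
      let ?t = "K1 * (y - x)\<^sup>2"
      have h: "(y - x)\<^sup>2 \<le> 1" using that by (simp add: power_le_one)
      have "1 - ?t \<le> exp (- ?t)" using exp_ge_add_one_self[of "- ?t"] by simp
      then have "exp ?t * (1 - ?t) \<le> exp ?t * exp (- ?t)" by (intro mult_left_mono) auto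
      then have "exp ?t \<le> 1 + ?t * exp ?t" by (simp add: exp_minus algebra_simps)
      also have "?t * exp ?t \<le> ?t * exp K1"
        using K1 h mult_left_mono[OF h K1] by (intro mult_left_mono) auto
      finally show "exp ?t \<le> 1 + K * (y - x)\<^sup>2" by (simp add: K_def mult_ac)
    qed simp
    finally show ?thesis .
  qed
  have smooth: "(f c - f a) * (f d - f b) * ((c - b) * (d - a))
      \<le> exp (K * ((b - a) * (d - c))) * ((c - a) * (d - b) * ((f c - f b) * (f d - f a)))"
    if o: "a < b" "b < c" "c < d" and nz: "{a<..<d} \<inter> \<int> = {}" for a b c d
  proof -
    define n where "n = \<lfloor>a\<rfloor>"
    have n: "of_int n \<le> a" "a < of_int n + 1" by (auto simp: n_def)
    have "d \<le> of_int n + 1"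
    proof (rule ccontr)
      assume "\<not> d \<le> of_int n + 1"
      then have "of_int (n + 1) \<in> {a<..<d} \<inter> \<int>" using n by simp
      then show False using nz by blast
    qed
    then have d: "d - of_int n \<le> 1" by simp
    have fn: "f (x - of_int n) = f x - of_int n" for x using shift_int[of "x - of_int n" n] by simp
    have "(f (c - of_int n) - f (a - of_int n)) * (f (d - of_int n) - f (b - of_int n))
        * (((c - of_int n) - (b - of_int n)) * ((d - of_int n) - (a - of_int n)))
      \<le> exp (K * (((b - of_int n) - (a - of_int n)) * ((d - of_int n) - (c - of_int n))))
        * (((c - of_int n) - (a - of_int n)) * ((d - of_int n) - (b - of_int n))
           * ((f (c - of_int n) - f (b - of_int n)) * (f (d - of_int n) - f (a - of_int n))))"
      by (rule cross_ratio_integration[of f "D 1"]) (use d1 strict two n d o in auto)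
    then show ?thesis by (simp add: fn)
  qed
  define g where "g x = - f (- x)" for x
  have dg: "(g has_real_derivative D 1 (- x)) (at x)" for x
    unfolding g_def by (auto intro!: derivative_eq_intros DERIV_chain2[OF d1])
  have mono_g: "g x \<le> g y" if "x \<le> y" for x y using mono[of "- y" "- x"] that by (simp add: g_def)
  have bnd_g: "c1 * \<bar>x\<bar> ^ N \<le> D 1 (- x)" "D 1 (- x) \<le> c2 * \<bar>x\<bar> ^ N" if "\<bar>x\<bar> \<le> 3/4" for x
    using bnd[of "- x"] that by auto
  have per_g: "D 1 (- (x + of_int n)) = D 1 (- x)" "g (x + of_int n) = g x + of_int n" for x and n :: int
    using D_periodic[of 1 "- x" "- n"] shift_int[of "- x" "- n"] by (simp_all add: g_def)
  have per: "D 1 (x + of_int n) = D 1 x" for x and n :: int using D_periodic[of 1 x n] by simp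
  define m where "m = c1 / (4 * 2 ^ N * c2)"
  have m: "0 < m" using c by (simp add: m_def)
  have right: "m * h * D 1 z \<le> f (z + h) - f z" if "0 < h" "h \<le> 1/2" for h z
    unfolding m_def by (rule forward_growth[OF d1 per shift_int mono c bnd that])
  have left: "m * h * D 1 z \<le> f z - f (z - h)" if "0 < h" "h \<le> 1/2" for h z
    using forward_growth[OF dg per_g mono_g c bnd_g that, of "- z"] by (simp add: m_def g_def)
  have mean: "D 1 z * (y - x) \<le> 6 / m * (f y - f x)" if z: "x \<le> z" "z \<le> y" "x < y" "y \<le> x + 3" for x y z
  proof -
    define h where "h = (y - x) / 6"
    have h: "0 < h" "h \<le> 1/2" using z by (auto simp: h_def)
    have "m * h * D 1 z \<le> f y - f x"
    proof (cases "z + h \<le> y")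
      case True
      then show ?thesis using right[OF h, of z] mono[of x z] mono[of "z + h" y] z by simp
    next
      case False
      then have "x \<le> z - h" using z by (simp add: h_def field_simps)
      then show ?thesis using left[OF h, of z] mono[of z y] mono[of x "z - h"] z by simp
    qed
    then show ?thesis using m by (simp add: h_def field_simps)
  qed
  define C where "C = (6 / m)\<^sup>2 + (c2 + 2 ^ Suc N) * 4 ^ Suc N / c1 + 1"
  have C: "1 \<le> C" "(6 / m)\<^sup>2 \<le> C" "(c2 + 2 ^ Suc N) * 4 ^ Suc N / c1 \<le> C" using c by (auto simp: C_def)
  have f1: "f 1 = 1" "g 0 = 0" "g 1 = 1" using shift_int[of 0 1] shift_int[of 0 "-1"] f_zero by (auto simp: g_def)
  have N1: "1 \<le> N" using N_ge_2 by simp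
  have "critical_lift f K C"
  proof
    show "x < y \<Longrightarrow> f x < f y" for x y by (rule strict)
    show "isCont f x" for x by (rule DERIV_isCont[OF d1])
    show "f (x + 1) = f x + 1" for x by (rule shift)
    show "cr (f a) (f b) (f c) (f d) \<le> C * cr a b c d"
      if o: "a \<le> b" "b \<le> c" "c \<le> d" "a < c" "b < d" "d - a \<le> 3" for a b c d
    proof -
      have "cr (f a) (f b) (f c) (f d) \<le> (6 / m)\<^sup>2 * cr a b c d"
        by (rule rough_of_mean[OF d1 strict _ mean o]) (use m in auto)
      also have "\<dots> \<le> C * cr a b c d"
        using o by (intro mult_right_mono C) (auto simp: cr_def)
      finally show ?thesis .
    qed
    show "f (\<theta> * b) \<le> C * \<theta>\<^sup>2 * f b" if \<theta>: "0 < \<theta>" "\<theta> \<le> 1" and b: "0 < b" "b \<le> 1" for \<theta> b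
    proof (rule order_trans[OF forward_flat[OF d1 mono f_zero f1(1) c N1 bnd \<theta> b]])
      show "(c2 + 2 ^ Suc N) * 4 ^ Suc N / c1 * \<theta>\<^sup>2 * f b \<le> C * \<theta>\<^sup>2 * f b"
        using mono[of 0 b] b f_zero by (intro mult_right_mono C) auto
    qed
    show "- f (- (\<theta> * b)) \<le> C * \<theta>\<^sup>2 * - f (- b)" if \<theta>: "0 < \<theta>" "\<theta> \<le> 1" and b: "0 < b" "b \<le> 1" for \<theta> b
    proof -
      have "g (\<theta> * b) \<le> C * \<theta>\<^sup>2 * g b"
      proof (rule order_trans[OF forward_flat[OF dg mono_g f1(2,3) c N1 bnd_g \<theta> b]])
        show "(c2 + 2 ^ Suc N) * 4 ^ Suc N / c1 * \<theta>\<^sup>2 * g b \<le> C * \<theta>\<^sup>2 * g b"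
          using mono_g[of 0 b] b f1 by (intro mult_right_mono C) auto
      qed
      then show ?thesis by (simp only: g_def)
    qed
  qed (use smooth K C f_zero in auto)
  then show ?thesis by blast
qed

end

section \<open>Hoelder continuity of the rotation number\<close>

theorem theoremA:
  fixes f0 :: "real \<Rightarrow> real" and l :: nat
  assumes "strict_mono f0"
    and "\<exists>g. homeomorphism UNIV UNIV f0 g"
    and "\<And>x. f0 (x + 1) = f0 x + 1"
    and "f0 0 = 0"
    and "C_diff 3 f0"
    and "\<And>x. deriv f0 x = 0 \<longleftrightarrow> x \<in> \<int>"
    and "l \<ge> 1"
    and "C_diff l f0"
    and "(deriv ^^ l) f0 0 \<noteq> 0"
  shows "\<exists>C>0. \<exists>\<alpha>. 0 < \<alpha> \<and> \<alpha> \<le> 1 \<and>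
    (\<forall>t\<in>{0<..<1}. \<forall>s\<in>{0<..<1}.
      \<bar>rotation_number (\<lambda>x. f0 x + t) - rotation_number (\<lambda>x. f0 x + s)\<bar>
        \<le> C * \<bar>t - s\<bar> powr \<alpha>)"
proof -
  \<comment> \<open>The given order need not be minimal; the order of the critical point is.\<close>
  define n where "n = (LEAST i. (deriv ^^ i) f0 0 \<noteq> 0)"
  have order: "(deriv ^^ n) f0 0 \<noteq> 0" unfolding n_def by (rule LeastI[of _ l]) (rule assms)
  have minimal: "(deriv ^^ i) f0 0 = 0" if "i < n" for i
    using not_less_Least[of i "\<lambda>i. (deriv ^^ i) f0 0 \<noteq> 0"] that by (simp add: n_def)
  have "n \<le> l" unfolding n_def by (rule Least_le) (rule assms)
  have "C_diff n f0"
  proof (cases "n = l")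
    case True
    then show ?thesis using assms by simp
  next
    case False
    then have "n < l" using \<open>n \<le> l\<close> by simp
    then have "(deriv ^^ n) f0 field_differentiable at x" for x using assms(8) by (simp add: C_diff_def)
    then have "continuous_on UNIV ((deriv ^^ n) f0)"
      by (intro continuous_at_imp_continuous_on ballI field_differentiable_imp_continuous_at)
    then show ?thesis using assms(8) \<open>n < l\<close> by (simp add: C_diff_def)
  qed
  then interpret smooth_lift f0 n
    by unfold_locales (use assms order minimal in \<open>auto simp: strict_mono_def\<close>)
  obtain K C where "critical_lift f0 K C" using critical_lift_exists by blast
  then interpret critical_lift f0 K C .
  show ?thesis using rho_Hoelder by (simp only: rho_def)
qed

end
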